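(* Let $k\geq 3$ and $n\geq 2k$ be integers. Then the complex algebra $QP_k(n)=\mathrm{End}_{S_n}(W^{\otimes k})$ is generated by $$\{\bar d\mid d\in\mathcal{G}\},\qquad \mathcal{G}=\{s_1,\dots,s_{k-1},e_1,b_1,t_1,h_1\}.$$
   Context: Let $[k]=\{1,\dots,k\}$ and $[k']=\{1',\dots,k'\}$ be disjoint sets. A $k$-partition diagram is a set partition $d$ of $[k]\cup[k']$ (drawn with vertices $1,\dots,k$ in the top row and $1',\dots,k'$ in the bottom row). The following diagrams are specified by listing their blocks; all vertices not mentioned are in blocks $\{j,j'\}$: - $s_i$: blocks $\{i,(i+1)'\}$ and $\{i+1,i'\}$ ($1\le i\le k-1$); - $e_1$: blocks $\{1,2\}$ and $\{1',2'\}$; - $b_1$: block $\{1,2,1',2'\}$; - $t_1$: blocks $\{1,2,1'\}$ and $\{3,2',3'\}$; - $h_1$: blocks $\{1,2,3\}$ and $\{1',2',3'\}$. Let $V$ be the permutation representation of $S_n$ over $\mathbb{C}$ with basis $v_1,\dots,v_n$. A diagram $d$ acts on $V^{\otimes k}$ by $$d\cdot(v_{i_{1'}}\otimes\cdots\otimes v_{i_{k'}})=\sum v_{i_1}\otimes\cdots\otimes v_{i_k},$$ where the sum is over all $(i_1,\dots,i_k)\in\{1,\dots,n\}^k$ such that $i_s=i_t$ whenever $s,t\in[k]\cup[k']$ lie in the same block of $d$. Let $W\subset V$ be the irreducible $S_n$-submodule spanned by $w_j=v_j-v_1$, $2\leq j\leq n$ (isomorphic to $S^{(n-1,1)}$).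 Let $\pi:V\to W$, $\pi(v_i)=v_i-\frac1n\sum_{j=1}^n v_j$. For a diagram $d$, $\bar d$ denotes the operator $\pi^{\otimes k}\circ d$ restricted to $W^{\otimes k}$; it is an element of $QP_k(n)$. *)

theory Defs
  imports Complex_Main "HOL-Library.Function_Algebras" "HOL-Library.FuncSet"
    "HOL-Library.Disjoint_Sets" "HOL-Combinatorics.Permutations"
begin

section \<open>Partition diagrams\<close>

text \<open>\<open>Top j\<close> is the vertex $j$ and \<open>Bot j\<close> is the vertex $j'$.\<close>

datatype vertex = Top nat | Bot nat

type_synonym diagram = "vertex set set"

definition vertices :: "nat \<Rightarrow> vertex set" where
  "vertices k = Top ` {1..k} \<union> Bot ` {1..k}"

definition partition_diagrams :: "nat \<Rightarrow> diagram set" where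
  "partition_diagrams k = {d. partition_on (vertices k) d}"

text \<open>The diagram specified by some of its blocks, the unmentioned vertices forming
  vertical edges.\<close>

definition diagram_of :: "nat \<Rightarrow> vertex set set \<Rightarrow> diagram" where
  "diagram_of k B =
     B \<union> {{Top j, Bot j} | j. j \<in> {1..k} \<and> Top j \<notin> \<Union>B \<and> Bot j \<notin> \<Union>B}"

definition s_diag :: "nat \<Rightarrow> nat \<Rightarrow> diagram" where
  "s_diag k i = diagram_of k {{Top i, Bot (i + 1)}, {Top (i + 1), Bot i}}"

definition e1_diag :: "nat \<Rightarrow> diagram" where
  "e1_diag k = diagram_of k {{Top 1, Top 2}, {Bot 1, Bot 2}}"

definition b1_diag :: "nat \<Rightarrow> diagram" where
  "b1_diag k = diagram_of k {{Top 1, Top 2, Bot 1, Bot 2}}"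

definition t1_diag :: "nat \<Rightarrow> diagram" where
  "t1_diag k = diagram_of k {{Top 1, Top 2, Bot 1}, {Top 3, Bot 2, Bot 3}}"

definition h1_diag :: "nat \<Rightarrow> diagram" where
  "h1_diag k = diagram_of k {{Top 1, Top 2, Top 3}, {Bot 1, Bot 2, Bot 3}}"

definition generator_diagrams :: "nat \<Rightarrow> diagram set" where
  "generator_diagrams k =
     {s_diag k i | i. i \<in> {1..k - 1}} \<union> {e1_diag k, b1_diag k, t1_diag k, h1_diag k}"

lemma partition_diagram_of:
  assumes "disjoint B" "{} \<notin> B" "\<Union>B \<subseteq> vertices k"
    and "\<And>j. Top j \<in> \<Union>B \<longleftrightarrow> Bot j \<in> \<Union>B"
  shows "diagram_of k B \<in> partition_diagrams k"
proof -
  let ?E = "{{Top j, Bot j} | j. j \<in> {1..k} \<and> Top j \<notin> \<Union>B \<and> Bot j \<notin> \<Union>B}"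
  have "\<Union>(B \<union> ?E) = vertices k"
  proof
    show "\<Union>(B \<union> ?E) \<subseteq> vertices k"
      using assms(3) by (auto simp: vertices_def)
    show "vertices k \<subseteq> \<Union>(B \<union> ?E)"
    proof
      fix v assume "v \<in> vertices k"
      then obtain j where j: "j \<in> {1..k}" "v = Top j \<or> v = Bot j"
        by (auto simp: vertices_def)
      show "v \<in> \<Union>(B \<union> ?E)"
      proof (cases "Top j \<in> \<Union>B")
        case True
        then show ?thesis using assms(4)[of j] j by auto
      next
        case False
        then have "{Top j, Bot j} \<in> ?E" using assms(4)[of j] j by blast
        then show ?thesis using j by blast
      qed
    qed
  qed
  moreover have "disjoint (B \<union> ?E)"
  proof (rule disjoint_union)
    show "disjoint ?E" by (auto simp: disjoint_def)
    show "\<Union>B \<inter> \<Union>?E = {}" by blast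
  qed (fact assms(1))
  ultimately show ?thesis
    using assms(2) by (auto simp: partition_diagrams_def diagram_of_def partition_on_def)
qed

lemma generator_diagrams_subset:
  assumes "k \<ge> 3"
  shows "generator_diagrams k \<subseteq> partition_diagrams k"
proof -
  have "s_diag k i \<in> partition_diagrams k" if "i \<in> {1..k - 1}" for i
    unfolding s_diag_def
  proof (rule partition_diagram_of)
    show "disjoint {{Top i, Bot (i + 1)}, {Top (i + 1), Bot i}}"
      by (simp add: disjoint_def)
    show "\<Union>{{Top i, Bot (i + 1)}, {Top (i + 1), Bot i}} \<subseteq> vertices k"
      using that assms by (auto simp: vertices_def)
  qed auto
  moreover have "e1_diag k \<in> partition_diagrams k"
    unfolding e1_diag_def using assms
    by (intro partition_diagram_of) (simp_all add: disjoint_def vertices_def image_iff)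
  moreover have "b1_diag k \<in> partition_diagrams k"
    unfolding b1_diag_def using assms
    by (intro partition_diagram_of) (simp_all add: disjoint_def vertices_def image_iff)
  moreover have "t1_diag k \<in> partition_diagrams k"
    unfolding t1_diag_def using assms
    by (intro partition_diagram_of) (simp_all add: disjoint_def vertices_def image_iff, auto)
  moreover have "h1_diag k \<in> partition_diagrams k"
    unfolding h1_diag_def using assms
    by (intro partition_diagram_of) (simp_all add: disjoint_def vertices_def image_iff)
  ultimately show ?thesis
    unfolding generator_diagrams_def by blast
qed


section \<open>Tensor powers of the permutation representation\<close>

text \<open>A vector with coordinates indexed by \<open>'i\<close> is a function \<open>'i \<Rightarrow> complex\<close>. Addition is
  pointwise; subspaces and spans are those of the library locale \<^locale>\<open>vector_space\<close>.\<close>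

definition fscale :: "complex \<Rightarrow> ('i \<Rightarrow> complex) \<Rightarrow> 'i \<Rightarrow> complex" where
  "fscale c x = (\<lambda>i. c * x i)"

interpretation fun_space: vector_space fscale
  by standard (auto simp: fscale_def fun_eq_iff algebra_simps)

text \<open>The linear map sending the basis vector with index \<open>i \<in> I\<close> to \<open>F i\<close>.\<close>

definition linear_extension ::
  "'i set \<Rightarrow> ('i \<Rightarrow> 'j \<Rightarrow> complex) \<Rightarrow> ('i \<Rightarrow> complex) \<Rightarrow> 'j \<Rightarrow> complex" where
  "linear_extension I F x = (\<Sum>i\<in>I. fscale (x i) (F i))"

lemma linear_extension_basis:
  assumes "finite I" "i \<in> I"
  shows "linear_extension I F (\<lambda>j. if j = i then 1 else 0) = F i"
proof -
  have "linear_extension I F (\<lambda>j. if j = i then 1 else 0) = (\<Sum>j\<in>I. if j = i then F j else 0)"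
    unfolding linear_extension_def by (intro sum.cong) (auto simp: fscale_def fun_eq_iff)
  then show ?thesis using assms by simp
qed

type_synonym vec = "nat \<Rightarrow> complex"
type_synonym tensor = "(nat \<Rightarrow> nat) \<Rightarrow> complex"

definition vbasis :: "nat \<Rightarrow> vec" where
  "vbasis j = (\<lambda>i. if i = j then 1 else 0)"

definition permV :: "nat \<Rightarrow> vec set" where
  "permV n = fun_space.span (vbasis ` {1..n})"

definition permW :: "nat \<Rightarrow> vec set" where
  "permW n = fun_space.span ((\<lambda>j. vbasis j - vbasis 1) ` {2..n})"

lemma permW_subset_permV: "permW n \<subseteq> permV n"
  unfolding permW_def permV_def
proof (intro fun_space.span_minimal fun_space.subspace_span subsetI)
  fix x assume "x \<in> (\<lambda>j. vbasis j - vbasis 1) ` {2..n}"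
  then obtain j where j: "j \<in> {2..n}" "x = vbasis j - vbasis 1" by blast
  then have "j \<in> {1..n}" "1 \<in> {1..n}" by auto
  then show "x \<in> fun_space.span (vbasis ` {1..n})"
    unfolding j(2) by (intro fun_space.span_diff fun_space.span_base imageI)
qed

text \<open>The projection $\pi$ of \<open>permV n\<close> onto \<open>permW n\<close>, and the representation of $S_n$ on \<open>permV n\<close>.\<close>

definition proj :: "nat \<Rightarrow> vec \<Rightarrow> vec" where
  "proj n = linear_extension {1..n} (\<lambda>i. vbasis i - fscale (1 / of_nat n) (\<Sum>j=1..n. vbasis j))"

definition perm_rep :: "nat \<Rightarrow> (nat \<Rightarrow> nat) \<Rightarrow> vec \<Rightarrow> vec" where
  "perm_rep n \<sigma> = linear_extension {1..n} (\<lambda>i. vbasis (\<sigma> i))"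

text \<open>A tensor of order \<open>k\<close> is given by its coordinates, indexed by the functions on \<open>{1..k}\<close>
  (extended by \<open>undefined\<close>).\<close>

definition multi_indices :: "nat \<Rightarrow> nat \<Rightarrow> (nat \<Rightarrow> nat) set" where
  "multi_indices n k = {1..k} \<rightarrow>\<^sub>E {1..n}"

definition pure_tensor :: "nat \<Rightarrow> (nat \<Rightarrow> vec) \<Rightarrow> tensor" where
  "pure_tensor k x = (\<lambda>i. if i \<in> extensional {1..k} then \<Prod>s=1..k. x s (i s) else 0)"

definition tensor_power :: "nat \<Rightarrow> vec set \<Rightarrow> tensor set" where
  "tensor_power k U = fun_space.span {pure_tensor k x | x. \<forall>s\<in>{1..k}. x s \<in> U}"

definition basis_tensor :: "nat \<Rightarrow> (nat \<Rightarrow> nat) \<Rightarrow> tensor" where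
  "basis_tensor k i = pure_tensor k (\<lambda>s. vbasis (i s))"

lemma basis_tensor_apply:
  assumes "i \<in> multi_indices n k"
  shows "basis_tensor k i = (\<lambda>j. if j = i then 1 else 0)"
proof
  fix j
  have ext: "i \<in> extensional {1..k}"
    using assms by (auto simp: multi_indices_def PiE_def)
  have "(\<Prod>s=1..k. vbasis (i s) (j s)) = 0" if j: "j \<in> extensional {1..k}" "j \<noteq> i"
  proof -
    obtain s where "s \<in> {1..k}" "j s \<noteq> i s"
      using extensionalityI[OF j(1) ext] j(2) by blast
    then show ?thesis by (auto simp: vbasis_def intro!: prod_zero)
  qed
  then show "basis_tensor k i j = (if j = i then 1 else 0)"
    using ext by (auto simp: basis_tensor_def pure_tensor_def vbasis_def)
qed

text \<open>The map $f^{\otimes k}$ on $V^{\otimes k}$.\<close>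

definition tensor_map :: "nat \<Rightarrow> nat \<Rightarrow> (vec \<Rightarrow> vec) \<Rightarrow> tensor \<Rightarrow> tensor" where
  "tensor_map n k f =
     linear_extension (multi_indices n k) (\<lambda>i. pure_tensor k (\<lambda>s. f (vbasis (i s))))"


section \<open>The action of diagrams\<close>

text \<open>The index attached to a vertex when the top row is labelled by \<open>i\<close> and the bottom row
  by \<open>j\<close>.\<close>

fun label :: "(nat \<Rightarrow> nat) \<Rightarrow> (nat \<Rightarrow> nat) \<Rightarrow> vertex \<Rightarrow> nat" where
  "label i j (Top s) = i s"
| "label i j (Bot s) = j s"

definition compatible :: "diagram \<Rightarrow> (nat \<Rightarrow> nat) \<Rightarrow> (nat \<Rightarrow> nat) \<Rightarrow> bool" where
  "compatible d i j \<longleftrightarrow> (\<forall>b\<in>d. \<forall>s\<in>b. \<forall>t\<in>b. label i j s = label i j t)"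

definition diagram_action :: "nat \<Rightarrow> nat \<Rightarrow> diagram \<Rightarrow> tensor \<Rightarrow> tensor" where
  "diagram_action n k d = linear_extension (multi_indices n k)
     (\<lambda>j. \<Sum>i\<in>{i \<in> multi_indices n k. compatible d i j}. basis_tensor k i)"

lemma diagram_action_basis:
  assumes "j \<in> multi_indices n k"
  shows "diagram_action n k d (basis_tensor k j) =
    (\<Sum>i\<in>{i \<in> multi_indices n k. compatible d i j}. basis_tensor k i)"
proof -
  have "finite (multi_indices n k)"
    unfolding multi_indices_def by (intro finite_PiE) auto
  then show ?thesis
    using assms by (simp add: diagram_action_def basis_tensor_apply linear_extension_basis)
qed


section \<open>Operators on the tensor powers of W\<close>

text \<open>Operators on a subspace \<open>U\<close> are functions with value \<open>undefined\<close> outside \<open>U\<close>.\<close>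

definition endomorphisms :: "('i \<Rightarrow> complex) set \<Rightarrow> (('i \<Rightarrow> complex) \<Rightarrow> 'i \<Rightarrow> complex) set" where
  "endomorphisms U = {f \<in> U \<rightarrow>\<^sub>E U.
     (\<forall>x\<in>U. \<forall>y\<in>U. f (x + y) = f x + f y) \<and> (\<forall>c. \<forall>x\<in>U. f (fscale c x) = fscale c (f x))}"

definition QP :: "nat \<Rightarrow> nat \<Rightarrow> (tensor \<Rightarrow> tensor) set" where
  "QP k n = {f \<in> endomorphisms (tensor_power k (permW n)).
     \<forall>\<sigma>. \<sigma> permutes {1..n} \<longrightarrow> (\<forall>x\<in>tensor_power k (permW n).
       f (tensor_map n k (perm_rep n \<sigma>) x) = tensor_map n k (perm_rep n \<sigma>) (f x))}"

definition bar :: "nat \<Rightarrow> nat \<Rightarrow> diagram \<Rightarrow> tensor \<Rightarrow> tensor" where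
  "bar n k d =
     restrict (tensor_map n k (proj n) \<circ> diagram_action n k d) (tensor_power k (permW n))"

text \<open>The unital complex algebra of operators on \<open>U\<close> generated by \<open>S\<close>.\<close>

inductive_set generated_algebra ::
  "('i \<Rightarrow> complex) set \<Rightarrow> (('i \<Rightarrow> complex) \<Rightarrow> 'i \<Rightarrow> complex) set
     \<Rightarrow> (('i \<Rightarrow> complex) \<Rightarrow> 'i \<Rightarrow> complex) set"
  for U S where
    gen: "f \<in> S \<Longrightarrow> f \<in> generated_algebra U S"
  | one: "restrict id U \<in> generated_algebra U S"
  | add: "f \<in> generated_algebra U S \<Longrightarrow> g \<in> generated_algebra U S
      \<Longrightarrow> restrict (\<lambda>x. f x + g x) U \<in> generated_algebra U S"
  | scale: "f \<in> generated_algebra U S \<Longrightarrow> restrict (\<lambda>x. fscale c (f x)) U \<in> generated_algebra U S"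
  | comp: "f \<in> generated_algebra U S \<Longrightarrow> g \<in> generated_algebra U S
      \<Longrightarrow> compose U f g \<in> generated_algebra U S"

end

theory Submission
  imports Defs
begin

text \<open>The theorem identifies two algebras of operators on $W^{\otimes k}$, where $P = \pi^{\otimes k}$ projects
$V^{\otimes k}$ onto $W^{\otimes k}$. Operators on $V^{\otimes k}$ are handled through their matrices, called
kernels, whose entries are indexed by labelings of the $2k$ vertices with numbers from $1$ to $n$. A
kernel \<open>\<kappa>\<close> induces the operator \<open>kop \<kappa>\<close>, the restriction of $P \kappa$ to $W^{\otimes k}$, and the
kernel of a diagram is the indicator of the labelings that are constant on its blocks. A kernel that
ignores the label of some vertex induces zero (lemma \<open>kop_indep\<close>); in particular every diagram with
an isolated vertex does.

The generated algebra consists of equivariant operators because diagrams and $P$ have invariant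
matrices (\<open>generated_subset_QP\<close>). Conversely, an element of $QP_k(n)$ is induced by an invariant
kernel (\<open>QP_kernel\<close>). The value of such a kernel at a labeling depends only on which labels coincide,
and the indicator of a pattern of coincidences is a combination of diagrams (\<open>invariant_part_span\<close>).
So it suffices to show that the operator of every diagram is generated.

This is proved by downward induction on the number of blocks (\<open>part_ker_generated\<close>). The product of
the operators of two kernels $\gamma$ and $\kappa$ is the operator of $\gamma P \kappa$, not that of
$\gamma\kappa$. Expanding $P$ into averages over slots, all terms except $\gamma\kappa$ come from diagrams
in which some vertices of the middle row have been isolated; if none of them was isolated before, these
terms have more blocks. Multiplication by $b_1$ or $t_1$, moved to arbitrary slots by permutations,
decreases the number of blocks by at most one (\<open>num_blocks_fuse_col\<close>). Hence, modulo diagrams already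
treated, $\bar b_1$ and $\bar t_1$ multiply as the diagrams do (\<open>fuse_step\<close>), and they produce every diagram
without isolated vertices that has a block of size at least four, or two blocks of size at least three
that are not contained in opposite rows, from a diagram with one block more (\<open>fusible_step\<close> and its mirror
image \<open>fusible_flip_step\<close>).

For $e_1$ and $h_1$ the product is taken with a diagram in which the affected vertices are joined to
the bottom row by edges; then all error terms vanish on $W^{\otimes k}$ (\<open>cupcap_step\<close>). The diagram
$h_1$ yields a triple in the top row together with a triple in the bottom row, and $e_1$ reduces diagrams
all of whose blocks are pairs to permutations (\<open>all_pairs_generated\<close>). Since the number of vertices is
even, blocks of size three cannot occur singly when all other blocks are pairs, so these cases are
exhaustive.\<close>

section \<open>Preliminaries\<close>

lemma sum_fun_apply: "(\<Sum>i\<in>A. F i) x = (\<Sum>i\<in>A. F i x)" for F :: "'a \<Rightarrow> 'b \<Rightarrow> complex"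
  by (induction A rule: infinite_finite_induct) simp_all

lemma permutes_extend:
  assumes "finite S" "A \<subseteq> S" "inj_on f A" "f ` A \<subseteq> S"
  obtains \<sigma> where "\<sigma> permutes S" "\<And>a. a \<in> A \<Longrightarrow> \<sigma> a = f a"
proof -
  have fin: "finite A" "finite (S - A)" "finite (S - f ` A)"
    using assms finite_subset by auto
  have "card (S - A) = card (S - f ` A)"
    using assms fin by (simp add: card_Diff_subset card_image)
  then obtain g where g: "bij_betw g (S - A) (S - f ` A)"
    using finite_same_card_bij fin by blast
  define \<sigma> where "\<sigma> = (\<lambda>x. if x \<in> A then f x else if x \<in> S then g x else x)"
  have "bij_betw \<sigma> A (f ` A)"
    using assms(3) by (auto simp: \<sigma>_def bij_betw_def inj_on_def)
  moreover have "bij_betw \<sigma> (S - A) (S - f ` A)"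
    using bij_betw_cong[of "S - A" \<sigma> g] g by (simp add: \<sigma>_def)
  ultimately have "bij_betw \<sigma> (A \<union> (S - A)) (f ` A \<union> (S - f ` A))"
    by (rule bij_betw_combine) blast
  moreover have "A \<union> (S - A) = S" "f ` A \<union> (S - f ` A) = S" using assms by auto
  ultimately have "\<sigma> permutes S"
    by (intro bij_imp_permutes) (use assms in \<open>auto simp: \<sigma>_def\<close>)
  then show thesis by (rule that) (simp add: \<sigma>_def)
qed

lemma two_elements:
  assumes "card A \<ge> 2" obtains x y where "x \<in> A" "y \<in> A" "x \<noteq> y"
proof -
  have "finite A" using assms card.infinite[of A] by (cases "finite A") auto
  then have "\<not> (\<forall>x\<in>A. \<forall>y\<in>A. x = y)" using assms card_le_Suc0_iff_eq[of A] by auto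
  then show thesis using that by blast
qed

section \<open>Kernels on labelings of the vertices\<close>

text \<open>A kernel is the matrix of an operator on $V^{\otimes k}$. Its entries are indexed by labelings of
all $2k$ vertices: the labels of the top row form the row index, those of the bottom row the column
index. In this form a diagram is its own kernel, and fixing, changing or averaging a label makes
sense for either row.\<close>

type_synonym kernel = "(vertex \<Rightarrow> nat) \<Rightarrow> complex"

definition top_row :: "(vertex \<Rightarrow> nat) \<Rightarrow> nat \<Rightarrow> nat" where
  "top_row l = (\<lambda>s. l (Top s))"

definition bot_row :: "(vertex \<Rightarrow> nat) \<Rightarrow> nat \<Rightarrow> nat" where
  "bot_row l = (\<lambda>s. l (Bot s))"

lemma row_label [simp]: "top_row (label i j) = i" "bot_row (label i j) = j"
  by (simp_all add: top_row_def bot_row_def)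

lemma label_rows [simp]: "label (top_row l) (bot_row l) = l"
proof
  fix v show "label (top_row l) (bot_row l) v = l v"
    by (cases v) (simp_all add: top_row_def bot_row_def)
qed

lemma label_upd [simp]:
  "(label i j)(Top s := a) = label (i(s := a)) j" "(label i j)(Bot s := a) = label i (j(s := a))"
proof -
  have "((label i j)(Top s := a)) v = label (i(s := a)) j v" for v by (cases v) auto
  then show "(label i j)(Top s := a) = label (i(s := a)) j" by blast
  have "((label i j)(Bot s := a)) v = label i (j(s := a)) v" for v by (cases v) auto
  then show "(label i j)(Bot s := a) = label i (j(s := a))" by blast
qed

definition transposed :: "kernel \<Rightarrow> kernel" where
  "transposed \<kappa> l = \<kappa> (label (bot_row l) (top_row l))"

lemma transposed_label [simp]: "transposed \<kappa> (label i j) = \<kappa> (label j i)"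
  by (simp add: transposed_def)

lemma transposed_transposed [simp]: "transposed (transposed \<kappa>) = \<kappa>"
  by (rule ext) (simp add: transposed_def)

locale tensor_setting =
  fixes n k :: nat
  assumes n_pos: "n > 0"
begin

abbreviation Idx :: "(nat \<Rightarrow> nat) set" where "Idx \<equiv> multi_indices n k"
abbreviation Wk :: "tensor set" where "Wk \<equiv> tensor_power k (permW n)"

lemma finite_Idx [simp]: "finite Idx"
  unfolding multi_indices_def by (intro finite_PiE) auto

lemma Idx_upd: "i \<in> Idx \<Longrightarrow> s \<in> {1..k} \<Longrightarrow> a \<in> {1..n} \<Longrightarrow> i(s := a) \<in> Idx"
  unfolding multi_indices_def by (auto simp: PiE_iff extensional_def)

lemma Idx_range: "i \<in> Idx \<Longrightarrow> s \<in> {1..k} \<Longrightarrow> i s \<in> {1..n}"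
  unfolding multi_indices_def by blast

lemma Idx_eqI: "i \<in> Idx \<Longrightarrow> j \<in> Idx \<Longrightarrow> (\<And>s. s \<in> {1..k} \<Longrightarrow> i s = j s) \<Longrightarrow> i = j"
  unfolding multi_indices_def by (rule PiE_ext)

text \<open>Overwriting slot \<open>s\<close> by every value hits each multi-index \<open>n\<close> times, because
\<open>(j, a) \<mapsto> (j(s := a), j s)\<close> is an involution.\<close>

lemma sum_Idx_slot:
  fixes f :: "(nat \<Rightarrow> nat) \<Rightarrow> complex"
  assumes s: "s \<in> {1..k}"
  shows "of_nat n * (\<Sum>j\<in>Idx. f j) = (\<Sum>j\<in>Idx. \<Sum>a=1..n. f (j(s := a)))"
proof -
  have "(\<Sum>j\<in>Idx. \<Sum>a=1..n. f (j(s := a))) = (\<Sum>(j, a)\<in>Idx \<times> {1..n}. f (j(s := a)))"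
    by (simp add: sum.cartesian_product)
  also have "\<dots> = (\<Sum>(j, a)\<in>Idx \<times> {1..n}. f j)"
    by (rule sum.reindex_bij_witness[where i = "\<lambda>(j, a). (j(s := a), j s)"
          and j = "\<lambda>(j, a). (j(s := a), j s)"])
      (use s Idx_upd Idx_range[of _ s] in force)+
  also have "\<dots> = (\<Sum>j\<in>Idx. \<Sum>a=1..n. f j)"
    by (rule sum.cartesian_product[symmetric])
  finally show ?thesis by (simp add: sum_distrib_left)
qed

text \<open>The labelings that index matrix entries. Kernels are compared on these only.\<close>

definition Lab :: "(vertex \<Rightarrow> nat) set" where
  "Lab = {l. top_row l \<in> Idx \<and> bot_row l \<in> Idx}"

lemma label_Lab [simp]: "label i j \<in> Lab \<longleftrightarrow> i \<in> Idx \<and> j \<in> Idx"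
  by (simp add: Lab_def)

lemma Lab_cases:
  assumes "l \<in> Lab" obtains i j where "i \<in> Idx" "j \<in> Idx" "l = label i j"
  using assms label_rows[of l] unfolding Lab_def by (metis mem_Collect_eq)

lemma Lab_upd:
  assumes "l \<in> Lab" "v \<in> vertices k" "a \<in> {1..n}" shows "l(v := a) \<in> Lab"
proof -
  obtain i j where ij: "i \<in> Idx" "j \<in> Idx" "l = label i j" using Lab_cases[OF assms(1)] .
  show ?thesis
  proof (cases v)
    case (Top s)
    then have "s \<in> {1..k}" using assms(2) by (auto simp: vertices_def)
    then show ?thesis using ij Top assms(3) Idx_upd[of i s a] by simp
  next
    case (Bot s)
    then have "s \<in> {1..k}" using assms(2) by (auto simp: vertices_def)
    then show ?thesis using ij Bot assms(3) Idx_upd[of j s a] by simp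
  qed
qed

lemma Lab_range:
  assumes "l \<in> Lab" "v \<in> vertices k" shows "l v \<in> {1..n}"
proof -
  obtain i j where ij: "i \<in> Idx" "j \<in> Idx" "l = label i j" using Lab_cases[OF assms(1)] .
  show ?thesis
    using ij assms(2) Idx_range[of i] Idx_range[of j] unfolding vertices_def by force
qed

definition act :: "kernel \<Rightarrow> tensor \<Rightarrow> tensor" where
  "act \<kappa> x = (\<lambda>i. if i \<in> Idx then \<Sum>j\<in>Idx. \<kappa> (label i j) * x j else 0)"

definition kmult :: "kernel \<Rightarrow> kernel \<Rightarrow> kernel" (infixl "**" 70) where
  "\<gamma> ** \<kappa> = (\<lambda>l. if l \<in> Lab
     then \<Sum>m\<in>Idx. \<gamma> (label (top_row l) m) * \<kappa> (label m (bot_row l)) else 0)"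

lemma act_kmult: "act (\<gamma> ** \<kappa>) x = act \<gamma> (act \<kappa> x)"
proof
  fix i
  show "act (\<gamma> ** \<kappa>) x i = act \<gamma> (act \<kappa> x) i"
  proof (cases "i \<in> Idx")
    case True
    then have "act (\<gamma> ** \<kappa>) x i
        = (\<Sum>j\<in>Idx. \<Sum>m\<in>Idx. \<gamma> (label i m) * \<kappa> (label m j) * x j)"
      by (simp add: act_def kmult_def sum_distrib_right)
    also have "\<dots> = (\<Sum>m\<in>Idx. \<Sum>j\<in>Idx. \<gamma> (label i m) * \<kappa> (label m j) * x j)"
      by (rule sum.swap)
    also have "\<dots> = act \<gamma> (act \<kappa> x) i"
      using True by (simp add: act_def sum_distrib_left mult.assoc)
    finally show ?thesis .
  qed (simp add: act_def)
qed

lemma kmult_assoc: "(\<alpha> ** \<beta>) ** \<gamma> = \<alpha> ** (\<beta> ** \<gamma>)"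
proof
  fix l
  show "((\<alpha> ** \<beta>) ** \<gamma>) l = (\<alpha> ** (\<beta> ** \<gamma>)) l"
  proof (cases "l \<in> Lab")
    case True
    then obtain i j where l: "i \<in> Idx" "j \<in> Idx" "l = label i j" by (rule Lab_cases)
    have "((\<alpha> ** \<beta>) ** \<gamma>) l
        = (\<Sum>m\<in>Idx. \<Sum>p\<in>Idx. \<alpha> (label i p) * \<beta> (label p m) * \<gamma> (label m j))"
      using l by (simp add: kmult_def sum_distrib_right)
    also have "\<dots> = (\<Sum>p\<in>Idx. \<Sum>m\<in>Idx. \<alpha> (label i p) * \<beta> (label p m) * \<gamma> (label m j))"
      by (rule sum.swap)
    also have "\<dots> = (\<alpha> ** (\<beta> ** \<gamma>)) l"
      using l by (simp add: kmult_def sum_distrib_left mult.assoc)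
    finally show ?thesis .
  qed (simp add: kmult_def)
qed

lemma transposed_kmult: "transposed (\<gamma> ** \<kappa>) = transposed \<kappa> ** transposed \<gamma>"
  by (rule ext) (auto simp: transposed_def kmult_def Lab_def mult.commute)

lemma kmult_add: "\<gamma> ** (\<lambda>l. \<kappa> l + \<kappa>' l) = (\<lambda>l. (\<gamma> ** \<kappa>) l + (\<gamma> ** \<kappa>') l)"
  and kmult_scale: "\<gamma> ** (\<lambda>l. c * \<kappa> l) = (\<lambda>l. c * (\<gamma> ** \<kappa>) l)"
  by (auto simp: kmult_def fun_eq_iff sum.distrib sum_distrib_left algebra_simps)

section \<open>The projection onto the tensor power of W\<close>

text \<open>The matrix of $\pi^{\otimes k}$; one factor has entries $\delta_{ab} - 1/n$.\<close>

definition proj_ker :: kernel where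
  "proj_ker = (\<lambda>l. if l \<in> Lab
     then \<Prod>s=1..k. of_bool (l (Top s) = l (Bot s)) - 1 / of_nat n else 0)"

lemma proj_ker_label:
  "i \<in> Idx \<Longrightarrow> j \<in> Idx \<Longrightarrow> proj_ker (label i j) = (\<Prod>s=1..k. of_bool (i s = j s) - 1 / of_nat n)"
  by (simp add: proj_ker_def)

lemma transposed_proj_ker [simp]: "transposed proj_ker = proj_ker"
proof
  fix l :: "vertex \<Rightarrow> nat"
  have "of_bool (l (Bot s) = l (Top s)) = (of_bool (l (Top s) = l (Bot s)) :: complex)" for s
    by auto
  then show "transposed proj_ker l = proj_ker l"
    by (auto simp: transposed_def proj_ker_def Lab_def) (auto simp: top_row_def bot_row_def)
qed

lemma proj_vbasis:
  assumes "a \<in> {1..n}"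
  shows "proj n (vbasis a) b = of_bool (b = a) - (if b \<in> {1..n} then 1 / of_nat n else 0)"
proof -
  have "proj n (vbasis a) = vbasis a - fscale (1 / of_nat n) (\<Sum>j=1..n. vbasis j)"
    unfolding proj_def vbasis_def[of a]
    using linear_extension_basis[of "{1..n}" a] assms by (simp add: vbasis_def)
  moreover have "(\<Sum>j=1..n. vbasis j) b = (if b \<in> {1..n} then 1 else 0)"
    by (simp add: vbasis_def sum_fun_apply)
  ultimately show ?thesis by (simp add: fscale_def vbasis_def)
qed

lemma tensor_map_apply:
  "tensor_map n k f x i = (\<Sum>j\<in>Idx. x j * pure_tensor k (\<lambda>s. f (vbasis (j s))) i)"
  by (simp add: tensor_map_def linear_extension_def sum_fun_apply fscale_def)

lemma Idx_D: "i \<in> Idx \<Longrightarrow> i \<in> extensional {1..k}"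
  by (simp add: multi_indices_def PiE_def)

lemma not_IdxE:
  assumes "i \<notin> Idx" "i \<in> extensional {1..k}"
  obtains s where "s \<in> {1..k}" "i s \<notin> {1..n}"
  using assms unfolding multi_indices_def PiE_iff by blast

text \<open>The matrix of $f^{\otimes k}$ is the product over the slots of the matrix \<open>g\<close> of $f$.\<close>

lemma tensor_map_eqI:
  fixes g :: "nat \<Rightarrow> nat \<Rightarrow> complex"
  assumes "\<And>a b. a \<in> {1..n} \<Longrightarrow> f (vbasis a) b = (if b \<in> {1..n} then g b a else 0)"
  shows "tensor_map n k f x = (\<lambda>i. if i \<in> Idx then \<Sum>j\<in>Idx. (\<Prod>s=1..k. g (i s) (j s)) * x j else 0)"
proof
  fix i
  have "pure_tensor k (\<lambda>s. f (vbasis (j s))) i = (if i \<in> Idx then \<Prod>s=1..k. g (i s) (j s) else 0)"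
    if j: "j \<in> Idx" for j
  proof (cases "i \<in> Idx")
    case True
    then have "i \<in> extensional {1..k}" by (rule Idx_D)
    then show ?thesis using True
      using assms[OF Idx_range[OF j]] Idx_range[OF \<open>i \<in> Idx\<close>]
      by (auto simp: pure_tensor_def intro!: prod.cong)
  next
    case False
    have "pure_tensor k (\<lambda>s. f (vbasis (j s))) i = 0"
    proof (cases "i \<in> extensional {1..k}")
      case True
      with False obtain s where "s \<in> {1..k}" "i s \<notin> {1..n}"
        by (rule not_IdxE)
      then have "f (vbasis (j s)) (i s) = 0"
        by (subst assms[OF Idx_range[OF j]]) auto
      then show ?thesis using \<open>s \<in> {1..k}\<close> by (auto simp: pure_tensor_def)
    qed (simp add: pure_tensor_def)
    then show ?thesis using False by simp
  qed
  then show "tensor_map n k f x i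
      = (if i \<in> Idx then \<Sum>j\<in>Idx. (\<Prod>s=1..k. g (i s) (j s)) * x j else 0)"
    by (simp add: tensor_map_apply mult.commute)
qed

lemma tensor_map_proj: "tensor_map n k (proj n) = act proj_ker"
proof
  fix x
  have "tensor_map n k (proj n) x = (\<lambda>i. if i \<in> Idx
      then \<Sum>j\<in>Idx. (\<Prod>s=1..k. of_bool (i s = j s) - 1 / of_nat n) * x j else 0)"
    by (rule tensor_map_eqI[where g = "\<lambda>b a. of_bool (b = a) - 1 / of_nat n"])
      (auto simp: proj_vbasis)
  also have "\<dots> = act proj_ker x"
    unfolding act_def by (intro ext if_cong refl sum.cong) (simp add: proj_ker_label)
  finally show "tensor_map n k (proj n) x = act proj_ker x" .
qed

lemma proj_vbasis_in_W:
  assumes "a \<in> {1..n}" shows "proj n (vbasis a) \<in> permW n"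
proof -
  let ?w = "\<lambda>j. vbasis j - vbasis 1"
  have w: "?w j \<in> permW n" if "j \<in> {1..n}" for j
  proof (cases "j = 1")
    case True then show ?thesis by (simp add: permW_def fun_space.span_zero)
  next
    case False then show ?thesis using that unfolding permW_def by (intro fun_space.span_base) auto
  qed
  have "proj n (vbasis a) = ?w a - fscale (1 / of_nat n) (\<Sum>j=1..n. ?w j)"
  proof
    fix b
    have "(\<Sum>j=1..n. vbasis j b) = (if b \<in> {1..n} then 1 else 0)" by (simp add: vbasis_def)
    then show "proj n (vbasis a) b = (?w a - fscale (1 / of_nat n) (\<Sum>j=1..n. ?w j)) b"
      using proj_vbasis[OF assms, of b] n_pos
      by (simp add: fscale_def sum_fun_apply sum_subtractf)
         (simp add: vbasis_def field_simps)
  qed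
  also have "\<dots> \<in> permW n"
    using w assms unfolding permW_def
    by (intro fun_space.span_diff[of "?w a"] fun_space.span_scale fun_space.span_sum) auto
  finally show ?thesis .
qed

lemma act_proj_ker_in_Wk: "act proj_ker x \<in> Wk"
proof -
  have "tensor_map n k (proj n) x \<in> Wk"
    unfolding tensor_map_def linear_extension_def tensor_power_def
    by (intro fun_space.span_sum fun_space.span_scale fun_space.span_base)
      (auto intro!: exI proj_vbasis_in_W dest: Idx_range)
  then show ?thesis by (simp add: tensor_map_proj)
qed

lemma permW_D:
  assumes "x \<in> permW n" shows "(\<Sum>a=1..n. x a) = 0 \<and> (\<forall>a. a \<notin> {1..n} \<longrightarrow> x a = 0)"
  using assms unfolding permW_def
proof (induction rule: fun_space.span_induct_alt)
  case base then show ?case by simp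
next
  case (step c x y)
  then obtain j where j: "j \<in> {2..n}" "x = vbasis j - vbasis 1" by blast
  have "(\<Sum>a=1..n. x a) = 0" using j by (simp add: vbasis_def sum_subtractf)
  moreover have "\<forall>a. a \<notin> {1..n} \<longrightarrow> x a = 0" using j by (auto simp: vbasis_def)
  ultimately show ?case
    using step by (simp add: fscale_def sum.distrib flip: sum_distrib_left)
qed

text \<open>On a pure tensor the sum defining the projection factors over the slots, and $\pi$ fixes every
vector whose coordinates add up to 0.\<close>

lemma act_proj_ker_Wk:
  assumes "x \<in> Wk" shows "act proj_ker x = x"
  using assms unfolding tensor_power_def
proof (induction rule: fun_space.span_induct_alt)
  case base then show ?case by (auto simp: act_def)
next
  case (step c x y)
  then obtain w where w: "x = pure_tensor k w" "\<forall>s\<in>{1..k}. w s \<in> permW n" by blast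
  have "act proj_ker x = x"
  proof
    fix i
    show "act proj_ker x i = x i"
    proof (cases "i \<in> Idx")
      case True
      have "act proj_ker x i
          = (\<Sum>j\<in>Idx. \<Prod>s=1..k. (of_bool (i s = j s) - 1 / of_nat n) * w s (j s))"
        unfolding act_def using True
        by (simp, intro sum.cong refl)
          (simp add: proj_ker_label w(1) pure_tensor_def Idx_D[simplified] prod.distrib)
      also have "\<dots> = (\<Prod>s=1..k. \<Sum>a=1..n. (of_bool (i s = a) - 1 / of_nat n) * w s a)"
        unfolding multi_indices_def by (rule prod_sum_PiE[symmetric]) auto
      also have "\<dots> = (\<Prod>s=1..k. w s (i s))"
      proof (rule prod.cong)
        fix s assume s: "s \<in> {1..k}"
        have "(\<Sum>a=1..n. (of_bool (i s = a) - 1 / of_nat n) * w s a)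
            = (\<Sum>a=1..n. of_bool (i s = a) * w s a) - (\<Sum>a=1..n. w s a) / of_nat n"
          by (simp add: algebra_simps sum_subtractf sum_divide_distrib)
        also have "(\<Sum>a=1..n. of_bool (i s = a) * w s a) = w s (i s)"
        proof -
          have "(\<Sum>a=1..n. of_bool (i s = a) * w s a)
              = (\<Sum>a=1..n. if i s = a then w s a else 0)"
            by (intro sum.cong) auto
          then show ?thesis using Idx_range[OF True s] by simp
        qed
        finally show "(\<Sum>a=1..n. (of_bool (i s = a) - 1 / of_nat n) * w s a) = w s (i s)"
          using permW_D[of "w s"] w(2) s by simp
      qed simp
      finally show ?thesis using Idx_D[OF True] by (simp add: w(1) pure_tensor_def)
    next
      case False
      have "x i = 0"
      proof (cases "i \<in> extensional {1..k}")
        case True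
        with False obtain s where "s \<in> {1..k}" "i s \<notin> {1..n}"
          by (rule not_IdxE)
        then show ?thesis using permW_D[of "w s"] w by (auto simp: pure_tensor_def)
      qed (simp add: w(1) pure_tensor_def)
      then show ?thesis using False by (simp add: act_def)
    qed
  qed
  moreover have "act proj_ker (fscale c x + y) = fscale c (act proj_ker x) + act proj_ker y"
    by (auto simp: act_def fscale_def sum.distrib sum_distrib_left algebra_simps)
  ultimately show ?case by (simp only: step(2))
qed

text \<open>This is the property of $W^{\otimes k}$ that annihilates kernels which ignore a bottom vertex.\<close>

lemma Wk_slot_sum:
  assumes "x \<in> Wk" "s \<in> {1..k}" "i \<in> Idx" shows "(\<Sum>a=1..n. x (i(s := a))) = 0"
  using assms(1) unfolding tensor_power_def
proof (induction rule: fun_space.span_induct_alt)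
  case base then show ?case by simp
next
  case (step c x y)
  then obtain w where w: "x = pure_tensor k w" "\<forall>s\<in>{1..k}. w s \<in> permW n" by blast
  have "x (i(s := a)) = (\<Prod>t\<in>{1..k}-{s}. w t (i t)) * w s a" for a
  proof -
    have "x (i(s := a)) = (\<Prod>t=1..k. w t ((i(s := a)) t))"
      using Idx_D[OF assms(3)] assms(2) by (auto simp: w(1) pure_tensor_def extensional_def)
    also have "\<dots> = w s a * (\<Prod>t\<in>{1..k}-{s}. w t ((i(s := a)) t))"
      using assms(2) by (subst prod.remove[of _ s]) auto
    also have "(\<Prod>t\<in>{1..k}-{s}. w t ((i(s := a)) t)) = (\<Prod>t\<in>{1..k}-{s}. w t (i t))"
      by (intro prod.cong) auto
    finally show ?thesis by (simp only: mult.commute)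
  qed
  then have "(\<Sum>a=1..n. x (i(s := a))) = 0"
    using permW_D[of "w s"] w(2) assms(2) by (simp flip: sum_distrib_left)
  moreover have "(\<Sum>a=1..n. y (i(s := a))) = 0" by (rule step)
  ultimately show ?case
    by (simp only: plus_fun_def fscale_def sum.distrib flip: sum_distrib_left) simp
qed

section \<open>Operators induced by kernels\<close>

text \<open>The compression of a kernel to $W^{\otimes k}$. For the kernel of a diagram $d$ it is $\bar d$.\<close>

definition kop :: "kernel \<Rightarrow> tensor \<Rightarrow> tensor" where
  "kop \<kappa> = restrict (\<lambda>x. act proj_ker (act \<kappa> x)) Wk"

lemma kop_cong: "(\<And>l. l \<in> Lab \<Longrightarrow> \<kappa> l = \<kappa>' l) \<Longrightarrow> kop \<kappa> = kop \<kappa>'"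
  unfolding kop_def act_def by (intro restrict_ext arg_cong[where f = "act proj_ker"] ext if_cong refl sum.cong) auto

lemma kop_in_Wk: "kop \<kappa> \<in> Wk \<rightarrow>\<^sub>E Wk"
  by (auto simp: kop_def act_proj_ker_in_Wk)

lemma act_add: "act (\<lambda>l. \<kappa> l + \<kappa>' l) x = act \<kappa> x + act \<kappa>' x"
  and act_scale: "act (\<lambda>l. c * \<kappa> l) x = fscale c (act \<kappa> x)"
  and act_add_right: "act \<kappa> (x + y) = act \<kappa> x + act \<kappa> y"
  and act_scale_right: "act \<kappa> (fscale c x) = fscale c (act \<kappa> x)"
  by (auto simp: act_def fun_eq_iff fscale_def sum.distrib sum_distrib_left algebra_simps)

text \<open>The inner factor \<open>proj_ker\<close> is the whole difference between multiplication of compressions and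
multiplication of kernels.\<close>

lemma kop_compose: "compose Wk (kop \<gamma>) (kop \<kappa>) = kop (\<gamma> ** (proj_ker ** \<kappa>))"
  by (rule ext) (auto simp: compose_def kop_def act_kmult act_proj_ker_in_Wk)

lemma kop_proj_mult: "kop (proj_ker ** \<kappa>) = kop \<kappa>"
  by (rule ext) (auto simp: kop_def act_kmult act_proj_ker_in_Wk act_proj_ker_Wk)

lemma kop_mult_proj: "kop (\<kappa> ** proj_ker) = kop \<kappa>"
  by (rule ext) (auto simp: kop_def act_kmult act_proj_ker_Wk)

text \<open>Averaging the label of a vertex: for a top vertex, $\pi$ in that slot is the identity minus this
operation.\<close>

definition avg :: "vertex \<Rightarrow> kernel \<Rightarrow> kernel" where
  "avg v \<kappa> = (\<lambda>l. if l \<in> Lab then (\<Sum>a=1..n. \<kappa> (l(v := a))) / of_nat n else 0)"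

text \<open>A sum against a function that ignores slot \<open>s\<close> only sees the slot sums of the other factor.\<close>

lemma sum_act_slot:
  assumes "s \<in> {1..k}" "\<And>j a. j \<in> Idx \<Longrightarrow> a \<in> {1..n} \<Longrightarrow> f (j(s := a)) = f j"
    and "\<And>j. j \<in> Idx \<Longrightarrow> (\<Sum>a=1..n. g (j(s := a))) = (0::complex)"
  shows "(\<Sum>j\<in>Idx. f j * g j) = 0"
proof -
  have "of_nat n * (\<Sum>j\<in>Idx. f j * g j) = (\<Sum>j\<in>Idx. \<Sum>a=1..n. f (j(s := a)) * g (j(s := a)))"
    by (rule sum_Idx_slot[OF assms(1)])
  also have "\<dots> = (\<Sum>j\<in>Idx. f j * (\<Sum>a=1..n. g (j(s := a))))"
    by (intro sum.cong refl) (simp add: sum_distrib_left assms(2))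
  also have "\<dots> = 0" by (intro sum.neutral ballI) (simp only: assms(3) mult_zero_right)
  finally show ?thesis using n_pos by simp
qed

lemma sum_proj_ker_slot:
  assumes "i \<in> Idx" "j \<in> Idx" "s \<in> {1..k}"
  shows "(\<Sum>a=1..n. proj_ker (label i (j(s := a)))) = 0"
proof -
  let ?g = "\<lambda>t b. of_bool (i t = b) - 1 / of_nat n :: complex"
  have "proj_ker (label i (j(s := a))) = ?g s a * (\<Prod>t\<in>{1..k}-{s}. ?g t (j t))"
    if a: "a \<in> {1..n}" for a
  proof -
    have "proj_ker (label i (j(s := a))) = (\<Prod>t=1..k. ?g t ((j(s := a)) t))"
      using assms a by (intro proj_ker_label Idx_upd) auto
    also have "\<dots> = ?g s a * (\<Prod>t\<in>{1..k}-{s}. ?g t ((j(s := a)) t))"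
      using assms(3) by (subst prod.remove[of _ s]) auto
    also have "(\<Prod>t\<in>{1..k}-{s}. ?g t ((j(s := a)) t)) = (\<Prod>t\<in>{1..k}-{s}. ?g t (j t))"
      by (intro prod.cong) auto
    finally show ?thesis .
  qed
  then have "(\<Sum>a=1..n. proj_ker (label i (j(s := a))))
      = (\<Sum>a=1..n. ?g s a) * (\<Prod>t\<in>{1..k}-{s}. ?g t (j t))"
    by (simp add: sum_distrib_right)
  also have "(\<Sum>a=1..n. ?g s a) = 0"
    using n_pos Idx_range[OF assms(1,3)] by (simp add: sum_subtractf of_bool_def)
  finally show ?thesis by (simp only: mult_zero_left)
qed

text \<open>A kernel that ignores a top vertex has its image killed by $\pi$ in that slot; a kernel that ignores
a bottom vertex kills tensors whose slot sums vanish. In particular a diagram with an isolated vertex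
acts as zero.\<close>

lemma kop_indep:
  assumes v: "v \<in> vertices k"
    and indep: "\<And>l a. l \<in> Lab \<Longrightarrow> a \<in> {1..n} \<Longrightarrow> \<kappa> (l(v := a)) = \<kappa> l"
    and x: "x \<in> Wk"
  shows "kop \<kappa> x = 0"
proof (cases v)
  case (Top s)
  then have s: "s \<in> {1..k}" using v by (auto simp: vertices_def)
  have "act proj_ker (act \<kappa> x) i = 0" for i
  proof (cases "i \<in> Idx")
    case True
    have "act \<kappa> x (j(s := a)) = act \<kappa> x j" if "j \<in> Idx" "a \<in> {1..n}" for j a
      using that Idx_upd[OF that(1) s that(2)] indep[of "label j _" a] Top
      by (auto simp: act_def intro!: sum.cong)
    then have "(\<Sum>j\<in>Idx. act \<kappa> x j * proj_ker (label i j)) = 0"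
      by (intro sum_act_slot[OF s] sum_proj_ker_slot True s) auto
    then show ?thesis using True by (simp add: act_def mult.commute)
  qed (simp add: act_def)
  then show ?thesis using x by (auto simp: kop_def)
next
  case (Bot s)
  then have s: "s \<in> {1..k}" using v by (auto simp: vertices_def)
  have "act \<kappa> x i = 0" for i
  proof (cases "i \<in> Idx")
    case True
    have "\<kappa> (label i (j(s := a))) = \<kappa> (label i j)" if "j \<in> Idx" "a \<in> {1..n}" for j a
      using indep[of "label i j" a] True that Bot by simp
    then have "(\<Sum>j\<in>Idx. \<kappa> (label i j) * x j) = 0"
      by (intro sum_act_slot[OF s] Wk_slot_sum[OF x s]) auto
    then show ?thesis using True by (simp add: act_def)
  qed (simp add: act_def)
  then show ?thesis using x by (auto simp: kop_def act_def[of proj_ker])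
qed

lemma avg_upd:
  assumes "v \<in> vertices k" "l \<in> Lab" "a \<in> {1..n}"
  shows "avg v \<kappa> (l(v := a)) = avg v \<kappa> l"
  using assms by (simp add: avg_def Lab_upd)

lemma avg_add: "avg v (\<lambda>l. \<kappa> l + \<kappa>' l) = (\<lambda>l. avg v \<kappa> l + avg v \<kappa>' l)"
  and avg_scale: "avg v (\<lambda>l. c * \<kappa> l) = (\<lambda>l. c * avg v \<kappa> l)"
  by (auto simp: avg_def fun_eq_iff sum.distrib sum_distrib_left add_divide_distrib)

lemma avg_commute:
  assumes "v \<in> vertices k" "w \<in> vertices k"
  shows "avg v (avg w \<kappa>) = avg w (avg v \<kappa>)"
proof (cases "v = w")
  case False
  have "avg v (avg w \<kappa>) l = avg w (avg v \<kappa>) l" for l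
  proof (cases "l \<in> Lab")
    case True
    have "(\<Sum>a=1..n. \<Sum>b=1..n. \<kappa> (l(v := a, w := b))) = (\<Sum>a=1..n. \<Sum>b=1..n. \<kappa> (l(w := b, v := a)))"
      using False by (simp add: fun_upd_twist)
    also have "\<dots> = (\<Sum>b=1..n. \<Sum>a=1..n. \<kappa> (l(w := b, v := a)))" by (rule sum.swap)
    finally show ?thesis using True assms by (simp add: avg_def Lab_upd flip: sum_divide_distrib)
  qed (simp add: avg_def)
  then show ?thesis by blast
qed simp

text \<open>The projection applied to the top row one slot after the other. This form gives access to the terms
in which some slots have been averaged.\<close>

fun proj_top :: "nat \<Rightarrow> kernel \<Rightarrow> kernel" where
  "proj_top 0 \<kappa> = \<kappa>"
| "proj_top (Suc m) \<kappa> = (\<lambda>l. proj_top m \<kappa> l - avg (Top (Suc m)) (proj_top m \<kappa>) l)"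

text \<open>The closed form after \<open>m\<close> slots: the remaining factors are still those of the identity matrix.\<close>

lemma proj_top_eq:
  assumes "m \<le> k" "i \<in> Idx" "j \<in> Idx"
  shows "proj_top m \<kappa> (label i j) =
    (\<Sum>p\<in>Idx. (\<Prod>s=1..k. of_bool (i s = p s) - (if s \<le> m then 1 / of_nat n else 0)) * \<kappa> (label p j))"
  using assms(1,2)
proof (induction m arbitrary: i)
  case 0
  have "(\<Prod>s=1..k. of_bool (i s = p s)) = (of_bool (p = i) :: complex)" if p: "p \<in> Idx" for p
  proof (cases "p = i")
    case False
    then obtain s where "s \<in> {1..k}" "p s \<noteq> i s" using Idx_eqI[OF p, of i] 0 by blast
    then show ?thesis using False by (auto intro!: prod_zero bexI[of _ s])
  qed simp
  moreover have "(\<Sum>p\<in>Idx. of_bool (p = i) * \<kappa> (label p j)) = (\<Sum>p\<in>Idx. if p = i then \<kappa> (label p j) else 0)"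
    by (intro sum.cong) auto
  ultimately show ?case using 0 by (auto intro!: sum.cong)
next
  case (Suc m)
  let ?s = "Suc m"
  have s: "?s \<in> {1..k}" using Suc.prems by auto
  let ?g = "\<lambda>m s a b. of_bool (a = b) - (if s \<le> m then 1 / of_nat n else 0) :: complex"
  let ?R = "\<lambda>p. \<Prod>s\<in>{1..k}-{?s}. ?g m s (i s) (p s)"
  have IH: "proj_top m \<kappa> (label (i(?s := a)) j) = (\<Sum>p\<in>Idx. of_bool (a = p ?s) * ?R p * \<kappa> (label p j))"
    if a: "a \<in> {1..n}" for a
  proof -
    have "(\<Prod>s=1..k. ?g m s ((i(?s := a)) s) (p s)) = of_bool (a = p ?s) * ?R p" for p
    proof -
      have "(\<Prod>s\<in>{1..k}-{?s}. ?g m s ((i(?s := a)) s) (p s)) = ?R p"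
        by (intro prod.cong) auto
      then show ?thesis using s by (subst prod.remove[of _ ?s]) auto
    qed
    then show ?thesis using Suc.IH[OF _ Idx_upd[OF Suc.prems(2) s a]] Suc.prems
      by (simp only: Suc_leD)
  qed
  have "(\<Sum>a=1..n. proj_top m \<kappa> (label (i(?s := a)) j))
      = (\<Sum>a=1..n. \<Sum>p\<in>Idx. of_bool (a = p ?s) * ?R p * \<kappa> (label p j))"
    by (intro sum.cong refl IH)
  also have "\<dots> = (\<Sum>p\<in>Idx. \<Sum>a=1..n. of_bool (a = p ?s) * ?R p * \<kappa> (label p j))"
    by (rule sum.swap)
  also have "\<dots> = (\<Sum>p\<in>Idx. ?R p * \<kappa> (label p j))"
  proof (intro sum.cong refl)
    fix p assume p: "p \<in> Idx"
    have "(\<Sum>a=1..n. of_bool (a = p ?s) * ?R p * \<kappa> (label p j))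
        = (\<Sum>a=1..n. if a = p ?s then ?R p * \<kappa> (label p j) else 0)"
      by (intro sum.cong) auto
    then show "(\<Sum>a=1..n. of_bool (a = p ?s) * ?R p * \<kappa> (label p j)) = ?R p * \<kappa> (label p j)"
      using Idx_range[OF p s] by simp
  qed
  finally have avg: "avg (Top ?s) (proj_top m \<kappa>) (label i j) = (\<Sum>p\<in>Idx. ?R p * \<kappa> (label p j)) / of_nat n"
    using Suc.prems assms(3) by (simp add: avg_def)
  have "i(?s := i ?s) = i" by simp
  with IH[of "i ?s"] Idx_range[OF Suc.prems(2) s]
  have main: "proj_top m \<kappa> (label i j) = (\<Sum>p\<in>Idx. of_bool (i ?s = p ?s) * ?R p * \<kappa> (label p j))"
    by simp
  have prods: "(\<Prod>s=1..k. ?g ?s s (i s) (p s)) = (of_bool (i ?s = p ?s) - 1 / of_nat n) * ?R p" for p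
  proof -
    have "(\<Prod>s\<in>{1..k}-{?s}. ?g ?s s (i s) (p s)) = ?R p" by (intro prod.cong) auto
    then show ?thesis using s by (subst prod.remove[of _ ?s]) auto
  qed
  then show ?case
    unfolding proj_top.simps main avg prods by (simp add: left_diff_distrib sum_subtractf sum_divide_distrib)
qed

lemma proj_ker_kmult: "l \<in> Lab \<Longrightarrow> (proj_ker ** \<kappa>) l = proj_top k \<kappa> l"
proof (erule Lab_cases)
  fix i j assume "i \<in> Idx" "j \<in> Idx" "l = label i j"
  then show ?thesis by (auto simp: kmult_def proj_ker_label proj_top_eq intro!: sum.cong)
qed

text \<open>Expanding the product, \<open>proj_top m\<close> minus the identity consists of terms with at least one
averaged slot. This bounds the error between \<open>\<gamma> ** (proj_ker ** \<kappa>)\<close> and \<open>\<gamma> ** \<kappa>\<close>; the set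
\<open>Q\<close> records what is known about averaged kernels.\<close>

lemma proj_top_minus_id:
  assumes Q: "fun_space.subspace Q"
    and avg: "\<And>\<kappa> s. \<kappa> \<in> Q \<Longrightarrow> s \<in> {1..k} \<Longrightarrow> avg (Top s) \<kappa> \<in> Q"
    and \<kappa>: "\<And>s. s \<in> {1..k} \<Longrightarrow> avg (Top s) \<kappa> \<in> Q"
    and "m \<le> k"
  shows "proj_top m \<kappa> - \<kappa> \<in> Q"
  using assms(4)
proof (induction m)
  case 0 then show ?case using fun_space.subspace_0[OF Q] by (simp add: fun_diff_def zero_fun_def)
next
  case (Suc m)
  let ?d = "proj_top m \<kappa> - \<kappa>"
  have "avg v (proj_top m \<kappa>) = (\<lambda>l. avg v ?d l + avg v \<kappa> l)" for v
    unfolding avg_add[symmetric] by simp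
  then have "proj_top (Suc m) \<kappa> - \<kappa> = ?d - avg (Top (Suc m)) ?d - avg (Top (Suc m)) \<kappa>"
    by (simp add: fun_eq_iff)
  also have "\<dots> \<in> Q"
  proof (rule fun_space.subspace_diff[OF Q], rule fun_space.subspace_diff[OF Q])
    show "?d \<in> Q" by (rule Suc.IH) (use Suc.prems in simp)
    then show "avg (Top (Suc m)) ?d \<in> Q" using Suc.prems by (intro avg) auto
    show "avg (Top (Suc m)) \<kappa> \<in> Q" using Suc.prems by (intro \<kappa>) auto
  qed
  finally show ?case .
qed

section \<open>Kernels in the generated algebra\<close>

definition diag_ker :: "diagram \<Rightarrow> kernel" where
  "diag_ker d l = of_bool (l \<in> Lab \<and> (\<forall>b\<in>d. \<forall>s\<in>b. \<forall>t\<in>b. l s = l t))"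

lemma diagram_action_eq: "diagram_action n k d = act (diag_ker d)"
proof (intro ext)
  fix x i
  have "diagram_action n k d x i
      = (\<Sum>j\<in>Idx. x j * (\<Sum>p\<in>{p \<in> Idx. compatible d p j}. basis_tensor k p i))"
    by (simp add: diagram_action_def linear_extension_def sum_fun_apply fscale_def)
  also have "\<dots> = act (diag_ker d) x i"
  proof -
    have "(\<Sum>p\<in>{p \<in> Idx. compatible d p j}. basis_tensor k p i)
        = of_bool (i \<in> Idx \<and> compatible d i j)" for j
    proof -
      have "(\<Sum>p\<in>{p \<in> Idx. compatible d p j}. basis_tensor k p i)
          = (\<Sum>p\<in>{p \<in> Idx. compatible d p j}. if i = p then 1 else 0)"
        by (intro sum.cong refl) (auto simp: basis_tensor_apply[where n = n])
      then show ?thesis by simp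
    qed
    then show ?thesis
      by (auto simp: act_def diag_ker_def compatible_def mult.commute intro!: sum.cong)
  qed
  finally show "diagram_action n k d x i = act (diag_ker d) x i" .
qed

lemma bar_eq_kop: "bar n k d = kop (diag_ker d)"
  by (simp add: bar_def kop_def tensor_map_proj diagram_action_eq o_def)

lemma kop_add: "kop (\<lambda>l. \<kappa> l + \<kappa>' l) = restrict (\<lambda>x. kop \<kappa> x + kop \<kappa>' x) Wk"
  unfolding kop_def by (intro restrict_ext) (simp only: restrict_apply' act_add act_add_right)

lemma kop_scale: "kop (\<lambda>l. c * \<kappa> l) = restrict (\<lambda>x. fscale c (kop \<kappa> x)) Wk"
  unfolding kop_def by (intro restrict_ext) (simp only: restrict_apply' act_scale act_scale_right)

abbreviation gen_alg :: "(tensor \<Rightarrow> tensor) set" where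
  "gen_alg \<equiv> generated_algebra Wk (bar n k ` generator_diagrams k)"

definition gen_kernels :: "kernel set" where "gen_kernels = {\<kappa>. kop \<kappa> \<in> gen_alg}"

text \<open>Asking for the transposed kernel as well makes this set stable under exchanging the two rows, so a
construction for the top row also serves for the bottom row.\<close>

definition gen_sym :: "kernel set" where "gen_sym = {\<kappa>. \<kappa> \<in> gen_kernels \<and> transposed \<kappa> \<in> gen_kernels}"

lemma gen_kernels_cong: "\<kappa> \<in> gen_kernels \<Longrightarrow> (\<And>l. l \<in> Lab \<Longrightarrow> \<kappa> l = \<kappa>' l) \<Longrightarrow> \<kappa>' \<in> gen_kernels"
  unfolding gen_kernels_def using kop_cong[of \<kappa> \<kappa>'] by simp

lemma gen_kernels_cong_rows: "\<kappa> \<in> gen_kernels \<Longrightarrow> (\<And>i j. i \<in> Idx \<Longrightarrow> j \<in> Idx \<Longrightarrow> \<kappa> (label i j) = \<kappa>' (label i j)) \<Longrightarrow> \<kappa>' \<in> gen_kernels"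
  by (erule gen_kernels_cong) (metis Lab_cases)

lemma gen_sym_cong: "\<kappa> \<in> gen_sym \<Longrightarrow> (\<And>l. l \<in> Lab \<Longrightarrow> \<kappa> l = \<kappa>' l) \<Longrightarrow> \<kappa>' \<in> gen_sym"
  unfolding gen_sym_def using gen_kernels_cong[of \<kappa> \<kappa>'] gen_kernels_cong[of "transposed \<kappa>" "transposed \<kappa>'"]
  by (auto simp: transposed_def Lab_def)

lemma gen_sym_transposed: "\<kappa> \<in> gen_sym \<Longrightarrow> transposed \<kappa> \<in> gen_sym"
  by (simp add: gen_sym_def)

lemma gen_kernels_add: "\<kappa> \<in> gen_kernels \<Longrightarrow> \<kappa>' \<in> gen_kernels \<Longrightarrow> (\<lambda>l. \<kappa> l + \<kappa>' l) \<in> gen_kernels"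
  unfolding gen_kernels_def by (simp add: kop_add generated_algebra.add)

lemma gen_kernels_scale: "\<kappa> \<in> gen_kernels \<Longrightarrow> (\<lambda>l. c * \<kappa> l) \<in> gen_kernels"
  unfolding gen_kernels_def by (simp add: kop_scale generated_algebra.scale)

lemma gen_kernels_zero:
  assumes "\<And>x. x \<in> Wk \<Longrightarrow> kop \<kappa> x = 0" shows "\<kappa> \<in> gen_kernels"
proof -
  have "kop \<kappa> = restrict (\<lambda>x. fscale 0 (restrict id Wk x)) Wk"
    using assms by (auto simp: fun_eq_iff fscale_def kop_def zero_fun_def)
  then show ?thesis unfolding gen_kernels_def
    by (simp only: mem_Collect_eq generated_algebra.scale generated_algebra.one)
qed

text \<open>Such kernels induce the zero operator, and so do their transposes.\<close>

lemma gen_sym_indep: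
  assumes v: "v \<in> vertices k"
    and indep: "\<And>l a. l \<in> Lab \<Longrightarrow> a \<in> {1..n} \<Longrightarrow> \<kappa> (l(v := a)) = \<kappa> l"
  shows "\<kappa> \<in> gen_sym"
proof -
  define v' where "v' = (case v of Top s \<Rightarrow> Bot s | Bot s \<Rightarrow> Top s)"
  have v': "v' \<in> vertices k" using v by (auto simp: v'_def vertices_def)
  have "transposed \<kappa> (l(v' := a)) = transposed \<kappa> l" if l: "l \<in> Lab" and a: "a \<in> {1..n}" for l a
  proof -
    obtain i j where ij: "i \<in> Idx" "j \<in> Idx" "l = label i j" using Lab_cases[OF l] .
    show ?thesis
      using ij indep[of "label j i" a] a by (cases v) (auto simp: v'_def)
  qed
  then show ?thesis unfolding gen_sym_def
    using kop_indep[OF v indep] kop_indep[OF v', of "transposed \<kappa>"] by (auto intro!: gen_kernels_zero)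
qed

lemma gen_sym_subspace: "fun_space.subspace gen_sym"
  unfolding fun_space.subspace_def
proof (intro conjI ballI allI)
  show "0 \<in> gen_sym" by (auto simp: gen_sym_def transposed_def kop_def act_def zero_fun_def intro!: gen_kernels_zero)
next
  fix x y assume "x \<in> gen_sym" "y \<in> gen_sym"
  then show "x + y \<in> gen_sym"
    using gen_kernels_add[of x y] gen_kernels_add[of "transposed x" "transposed y"]
    unfolding gen_sym_def transposed_def plus_fun_def by simp
next
  fix c x assume "x \<in> gen_sym"
  then show "fscale c x \<in> gen_sym"
    using gen_kernels_scale[of x c] gen_kernels_scale[of "transposed x" c]
    unfolding gen_sym_def transposed_def fscale_def by simp
qed

lemma gen_kernels_mult: "\<gamma> \<in> gen_kernels \<Longrightarrow> \<kappa> \<in> gen_kernels \<Longrightarrow> \<gamma> ** (proj_ker ** \<kappa>) \<in> gen_kernels"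
  unfolding gen_kernels_def using generated_algebra.comp[of "kop \<gamma>" Wk _ "kop \<kappa>"] by (simp add: kop_compose)

lemma gen_sym_mult: "\<gamma> \<in> gen_sym \<Longrightarrow> \<kappa> \<in> gen_sym \<Longrightarrow> \<gamma> ** (proj_ker ** \<kappa>) \<in> gen_sym"
  unfolding gen_sym_def
  using gen_kernels_mult[of \<gamma> \<kappa>] gen_kernels_mult[of "transposed \<kappa>" "transposed \<gamma>"]
  by (simp add: transposed_kmult kmult_assoc)

definition perm_ker :: "(nat \<Rightarrow> nat) \<Rightarrow> kernel" where
  "perm_ker \<sigma> l = of_bool (l \<in> Lab \<and> bot_row l = top_row l \<circ> \<sigma>)"

lemma Idx_perm:
  assumes "i \<in> Idx" "\<sigma> permutes {1..k}" shows "i \<circ> \<sigma> \<in> Idx"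
  using assms permutes_in_image[OF assms(2)] permutes_not_in[OF assms(2)]
  unfolding multi_indices_def by (auto simp: PiE_iff extensional_def)

lemma perm_ker_kmult:
  assumes "\<sigma> permutes {1..k}" "i \<in> Idx" "j \<in> Idx"
  shows "(perm_ker \<sigma> ** \<kappa>) (label i j) = \<kappa> (label (i \<circ> \<sigma>) j)"
proof -
  have "(perm_ker \<sigma> ** \<kappa>) (label i j) = (\<Sum>m\<in>Idx. if m = i \<circ> \<sigma> then \<kappa> (label m j) else 0)"
  proof -
    have "perm_ker \<sigma> (label i m) * \<kappa> (label m j) = (if m = i \<circ> \<sigma> then \<kappa> (label m j) else 0)"
      if "m \<in> Idx" for m
      using that assms by (simp add: perm_ker_def)
    then show ?thesis using assms by (simp add: kmult_def)
  qed
  then show ?thesis using Idx_perm[OF assms(2,1)] by (simp only: sum.delta finite_Idx if_True)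
qed

lemma transposed_perm_ker:
  assumes "\<sigma> permutes {1..k}" shows "transposed (perm_ker \<sigma>) = perm_ker (inv \<sigma>)"
proof -
  have "i = j \<circ> \<sigma> \<longleftrightarrow> j = i \<circ> inv \<sigma>" for i j :: "nat \<Rightarrow> nat"
    using permutes_inv_o[OF assms] by (metis comp_assoc comp_id)
  then show ?thesis
    by (auto simp: transposed_def perm_ker_def Lab_def fun_eq_iff[of "_ :: kernel"])
qed

lemma kmult_perm_ker:
  assumes \<sigma>: "\<sigma> permutes {1..k}" and "i \<in> Idx" "j \<in> Idx"
  shows "(\<kappa> ** perm_ker \<sigma>) (label i j) = \<kappa> (label i (j \<circ> inv \<sigma>))"
proof -
  have "\<kappa> ** perm_ker \<sigma> = transposed (perm_ker (inv \<sigma>) ** transposed \<kappa>)"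
    using permutes_inv[OF \<sigma>] permutes_inv_inv[OF \<sigma>]
    by (simp add: transposed_kmult transposed_perm_ker)
  then show ?thesis
    using assms perm_ker_kmult[OF permutes_inv[OF \<sigma>], of j i "transposed \<kappa>"] by simp
qed

text \<open>The projection treats all slots alike.\<close>

lemma proj_ker_perm_commute:
  assumes \<sigma>: "\<sigma> permutes {1..k}"
  shows "proj_ker ** perm_ker \<sigma> = perm_ker \<sigma> ** proj_ker"
proof
  fix l
  show "(proj_ker ** perm_ker \<sigma>) l = (perm_ker \<sigma> ** proj_ker) l"
  proof (cases "l \<in> Lab")
    case True
    then obtain i j where l: "i \<in> Idx" "j \<in> Idx" "l = label i j" by (rule Lab_cases)
    have "(\<Prod>s=1..k. of_bool (i s = j (inv \<sigma> s)) - 1 / of_nat n :: complex)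
        = (\<Prod>s=1..k. of_bool (i (\<sigma> s) = j s) - 1 / of_nat n)"
      by (subst prod.permute[OF \<sigma>]) (simp add: o_def permutes_inverses[OF \<sigma>])
    then show ?thesis
      using l \<sigma> permutes_inv[OF \<sigma>]
      by (simp add: perm_ker_kmult kmult_perm_ker proj_ker_label Idx_perm)
  qed (simp add: kmult_def)
qed

text \<open>A permutation commutes with the projection, so the inner projection moves to the outside, where it is
absorbed.\<close>

lemma gen_kernels_perm_mult:
  assumes "\<sigma> permutes {1..k}" "perm_ker \<sigma> \<in> gen_kernels" "\<kappa> \<in> gen_kernels"
  shows "perm_ker \<sigma> ** \<kappa> \<in> gen_kernels" "\<kappa> ** perm_ker \<sigma> \<in> gen_kernels"
proof -
  have "perm_ker \<sigma> ** (proj_ker ** \<kappa>) = proj_ker ** (perm_ker \<sigma> ** \<kappa>)"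
    using proj_ker_perm_commute[OF assms(1)] by (metis kmult_assoc)
  then show "perm_ker \<sigma> ** \<kappa> \<in> gen_kernels"
    using gen_kernels_mult[OF assms(2,3)] by (simp add: gen_kernels_def kop_proj_mult)
  have "\<kappa> ** (proj_ker ** perm_ker \<sigma>) = (\<kappa> ** perm_ker \<sigma>) ** proj_ker"
    using proj_ker_perm_commute[OF assms(1)] by (simp add: kmult_assoc)
  then show "\<kappa> ** perm_ker \<sigma> \<in> gen_kernels"
    using gen_kernels_mult[OF assms(3,2)] by (simp add: gen_kernels_def kop_mult_proj)
qed

lemma diag_ker_diagram_of:
  "diag_ker (diagram_of k B) l = of_bool (l \<in> Lab \<and> (\<forall>b\<in>B. \<forall>s\<in>b. \<forall>t\<in>b. l s = l t) \<and>
     (\<forall>s\<in>{1..k}. Top s \<notin> \<Union>B \<and> Bot s \<notin> \<Union>B \<longrightarrow> l (Top s) = l (Bot s)))"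
proof -
  define C where "C = (\<lambda>b. \<forall>s\<in>b. \<forall>t\<in>b. l s = l t)"
  have 1: "(\<forall>b\<in>diagram_of k B. C b) \<longleftrightarrow> (\<forall>b\<in>B. C b) \<and>
     (\<forall>s\<in>{1..k}. Top s \<notin> \<Union>B \<and> Bot s \<notin> \<Union>B \<longrightarrow> C {Top s, Bot s})"
    unfolding diagram_of_def by blast
  have 2: "C {Top s, Bot s} \<longleftrightarrow> l (Top s) = l (Bot s)" for s
    by (auto simp: C_def)
  have 3: "diag_ker (diagram_of k B) l = of_bool (l \<in> Lab \<and> (\<forall>b\<in>diagram_of k B. C b))"
    by (simp only: diag_ker_def C_def)
  show ?thesis unfolding 3 1 2 by (simp only: C_def)
qed

lemma row_eq_iff:
  assumes "i \<in> Idx" "j \<in> Idx" shows "j = i \<longleftrightarrow> (\<forall>s\<in>{1..k}. j s = i s)"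
  using Idx_eqI[OF assms(2,1)] by auto

lemma s_diag_ker:
  assumes "i \<in> {1..k - 1}" shows "diag_ker (s_diag k i) = perm_ker (Transposition.transpose i (i + 1))"
proof
  fix l
  let ?\<sigma> = "Transposition.transpose i (i + 1)"
  have \<sigma>: "?\<sigma> permutes {1..k}" using assms by (intro permutes_swap_id) auto
  show "diag_ker (s_diag k i) l = perm_ker ?\<sigma> l"
  proof (cases "l \<in> Lab")
    case True
    then have idx: "top_row l \<circ> ?\<sigma> \<in> Idx" "bot_row l \<in> Idx"
      using \<sigma> by (auto simp: Lab_def Idx_perm)
    have "(\<forall>s\<in>{1..k}. l (Bot s) = l (Top (?\<sigma> s))) \<longleftrightarrow> l (Top i) = l (Bot (i + 1)) \<and> l (Top (i + 1)) = l (Bot i)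
      \<and> (\<forall>s\<in>{1..k}. s \<noteq> i \<and> s \<noteq> i + 1 \<longrightarrow> l (Top s) = l (Bot s))" (is "?L = ?R")
    proof
      assume L: ?L
      have "l (Bot i) = l (Top (i + 1))" "l (Bot (i + 1)) = l (Top i)"
        using assms L[rule_format, of i] L[rule_format, of "i + 1"] by auto
      moreover have "l (Top s) = l (Bot s)" if "s \<in> {1..k}" "s \<noteq> i" "s \<noteq> i + 1" for s
        using L[rule_format, OF that(1)] that by (simp add: Transposition.transpose_def)
      ultimately show ?R by auto
    next
      assume ?R then show ?L by (auto simp: Transposition.transpose_def)
    qed
    then show ?thesis using True row_eq_iff[OF idx]
      by (simp add: s_diag_def diag_ker_diagram_of perm_ker_def) (auto simp: top_row_def bot_row_def)
  qed (simp add: diag_ker_def perm_ker_def)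
qed

lemma diag_ker_generated: "d \<in> generator_diagrams k \<Longrightarrow> diag_ker d \<in> gen_kernels"
  unfolding gen_kernels_def by (auto simp flip: bar_eq_kop intro: generated_algebra.gen)

lemma perm_ker_id: "perm_ker id \<in> gen_kernels"
proof -
  have "act (perm_ker id) x = (\<lambda>i. if i \<in> Idx then x i else 0)" for x
  proof
    fix i
    have "(\<Sum>j\<in>Idx. perm_ker id (label i j) * x j) = (\<Sum>j\<in>Idx. if j = i then x j else 0)" if "i \<in> Idx"
      using that by (intro sum.cong) (auto simp: perm_ker_def)
    then show "act (perm_ker id) x i = (if i \<in> Idx then x i else 0)" by (simp add: act_def)
  qed
  then have "act proj_ker (act (perm_ker id) x) = act proj_ker x" for x
    by (auto simp: act_def intro!: sum.cong)
  then have "kop (perm_ker id) = restrict id Wk"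
    by (auto simp: kop_def act_proj_ker_Wk intro!: restrict_ext)
  then show ?thesis by (simp add: gen_kernels_def generated_algebra.one)
qed

lemma perm_ker_comp:
  assumes "\<sigma> permutes {1..k}" "\<tau> permutes {1..k}" "perm_ker \<sigma> \<in> gen_kernels" "perm_ker \<tau> \<in> gen_kernels"
  shows "perm_ker (\<sigma> \<circ> \<tau>) \<in> gen_kernels"
proof (rule gen_kernels_cong_rows)
  show "perm_ker \<sigma> ** perm_ker \<tau> \<in> gen_kernels" using assms by (intro gen_kernels_perm_mult)
next
  fix i j assume "i \<in> Idx" "j \<in> Idx"
  then show "(perm_ker \<sigma> ** perm_ker \<tau>) (label i j) = perm_ker (\<sigma> \<circ> \<tau>) (label i j)"
    using assms(1) by (simp add: perm_ker_kmult) (simp add: perm_ker_def Idx_perm comp_assoc)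
qed

text \<open>Every transposition is a product of adjacent ones, which are the kernels of the diagrams $s_i$.\<close>

lemma transposition_generated:
  assumes "a < b" "a \<in> {1..k}" "b \<in> {1..k}"
  shows "perm_ker (Transposition.transpose a b) \<in> gen_kernels"
proof -
  have "perm_ker (apply_adj_transps xs) \<in> gen_kernels" if "set xs \<subseteq> {1..k - 1}" for xs
    using that
  proof (induction xs)
    case Nil then show ?case using perm_ker_id by (simp add: id_def)
  next
    case (Cons x xs)
    have "perm_ker (Transposition.transpose x (x + 1)) \<in> gen_kernels"
    proof -
      have x: "x \<in> {1..k - 1}" using Cons.prems by simp
      then have "s_diag k x \<in> generator_diagrams k" by (auto simp: generator_diagrams_def)
      then show ?thesis using diag_ker_generated s_diag_ker[OF x] by metis
    qed
    moreover have "Transposition.transpose x (x + 1) permutes {1..k}"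
      using Cons.prems by (intro permutes_swap_id) auto
    moreover have "apply_adj_transps xs permutes {1..k}"
    proof (intro permutes_apply_adj_transps ballI)
      fix y assume "y \<in> set xs"
      then have "y \<in> {1..k - 1}" using Cons.prems by auto
      then show "y \<in> {1..k} \<and> Suc y \<in> {1..k}" by auto
    qed
    ultimately have "perm_ker (Transposition.transpose x (x + 1) \<circ> apply_adj_transps xs) \<in> gen_kernels"
      using Cons by (intro perm_ker_comp) auto
    then show ?case by (simp add: o_def)
  qed
  moreover have "set (adj_transp_seq a b) \<subseteq> {1..k - 1}"
    using assms by (auto simp: set_adj_transp_seq)
  ultimately show ?thesis using adj_transp_seq_correct[OF assms(1)] by metis
qed

lemma perm_ker_generated:
  assumes "\<sigma> permutes {1..k}" shows "perm_ker \<sigma> \<in> gen_kernels"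
  using assms finite_atLeastAtMost
proof (induction rule: permutes_induct)
  case id then show ?case by (rule perm_ker_id)
next
  case (swap a b p)
  have "perm_ker (Transposition.transpose a b) \<in> gen_kernels"
    using swap transposition_generated[of a b] transposition_generated[of b a]
    by (cases a b rule: linorder_cases) (auto simp: transpose_commute)
  then show ?case using swap by (intro perm_ker_comp permutes_swap_id)
qed

lemma perm_ker_gen_sym: "\<sigma> permutes {1..k} \<Longrightarrow> perm_ker \<sigma> \<in> gen_sym"
  by (simp add: gen_sym_def perm_ker_generated transposed_perm_ker permutes_inv)

section \<open>Kernels of the generators\<close>

lemma conj_perm_ker:
  assumes "\<sigma> permutes {1..k}" "i \<in> Idx" "j \<in> Idx"
  shows "(perm_ker \<sigma> ** (\<kappa> ** perm_ker (inv \<sigma>))) (label i j) = \<kappa> (label (i \<circ> \<sigma>) (j \<circ> \<sigma>))"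
  using perm_ker_kmult[OF assms, of "\<kappa> ** perm_ker (inv \<sigma>)"]
    kmult_perm_ker[OF permutes_inv[OF assms(1)] Idx_perm[OF assms(2,1)] assms(3), of \<kappa>]
    permutes_inv_inv[OF assms(1)] by (simp only:)

text \<open>Conjugating by a permutation moves a generator to other slots.\<close>

lemma gen_kernels_conj:
  assumes "\<sigma> permutes {1..k}" "\<kappa> \<in> gen_kernels"
    and "\<And>i j. i \<in> Idx \<Longrightarrow> j \<in> Idx \<Longrightarrow> \<kappa>' (label i j) = \<kappa> (label (i \<circ> \<sigma>) (j \<circ> \<sigma>))"
  shows "\<kappa>' \<in> gen_kernels"
proof (rule gen_kernels_cong_rows)
  show "perm_ker \<sigma> ** (\<kappa> ** perm_ker (inv \<sigma>)) \<in> gen_kernels"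
    using assms(1,2) by (intro gen_kernels_perm_mult perm_ker_generated permutes_inv)
qed (simp only: conj_perm_ker[OF assms(1)] assms(3))

text \<open>The kernel of $t_1$ with the slots 1, 2, 3 replaced by \<open>x\<close>, \<open>y\<close>, \<open>z\<close>. The degenerate
case \<open>z = y\<close> is the kernel of $b_1$ at \<open>x\<close>, \<open>y\<close>, so that both generators can be treated
together.\<close>

definition fuse_ker :: "nat \<Rightarrow> nat \<Rightarrow> nat \<Rightarrow> kernel" where
  "fuse_ker x y z l = of_bool (l \<in> Lab \<and> l (Top x) = l (Top y) \<and> bot_row l = (top_row l)(y := l (Top z)))"

text \<open>One block on the top copy and one on the bottom copy of \<open>X\<close>: $e_1$ or $h_1$, moved to the
slots in \<open>X\<close>, according as \<open>X\<close> has two or three elements.\<close>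

definition cupcap_ker :: "nat set \<Rightarrow> kernel" where
  "cupcap_ker X l = of_bool (l \<in> Lab \<and> (\<forall>s\<in>X. \<forall>t\<in>X. l (Top s) = l (Top t)) \<and>
     (\<forall>s\<in>X. \<forall>t\<in>X. l (Bot s) = l (Bot t)) \<and> (\<forall>s\<in>{1..k} - X. l (Top s) = l (Bot s)))"

lemma fuse_ker_label:
  assumes "i \<in> Idx" "j \<in> Idx" "y \<in> {1..k}" "z \<in> {1..k}"
  shows "fuse_ker x y z (label i j) =
    of_bool (i x = i y \<and> (\<forall>s\<in>{1..k} - {y}. j s = i s) \<and> j y = i z)"
proof -
  have "i(y := i z) \<in> Idx" using assms by (intro Idx_upd Idx_range)
  then have "j = i(y := i z) \<longleftrightarrow> (\<forall>s\<in>{1..k}. j s = (i(y := i z)) s)"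
    using assms(2) by (intro row_eq_iff)
  also have "\<dots> \<longleftrightarrow> (\<forall>s\<in>{1..k} - {y}. j s = i s) \<and> j y = i z"
    using assms(3) by auto
  finally show ?thesis using assms(1,2) by (simp add: fuse_ker_def)
qed

lemma fuse_ker_conj:
  assumes \<sigma>: "\<sigma> permutes {1..k}" and "fuse_ker x y z \<in> gen_kernels" "y \<in> {1..k}" "z \<in> {1..k}"
  shows "fuse_ker (\<sigma> x) (\<sigma> y) (\<sigma> z) \<in> gen_kernels"
proof (rule gen_kernels_conj[OF assms(1,2)])
  fix i j assume ij: "i \<in> Idx" "j \<in> Idx"
  have mem: "\<sigma> y \<in> {1..k}" "\<sigma> z \<in> {1..k}" using assms permutes_in_image[OF \<sigma>] by blast+
  have "\<sigma> ` ({1..k} - {y}) = {1..k} - {\<sigma> y}"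
    using permutes_image[OF \<sigma>] permutes_inj[OF \<sigma>] by (simp add: image_set_diff)
  from this[symmetric] have "(\<forall>s\<in>{1..k} - {\<sigma> y}. j s = i s) \<longleftrightarrow> (\<forall>s\<in>{1..k} - {y}. j (\<sigma> s) = i (\<sigma> s))"
    by (simp only: ball_simps)
  then show "fuse_ker (\<sigma> x) (\<sigma> y) (\<sigma> z) (label i j) = fuse_ker x y z (label (i \<circ> \<sigma>) (j \<circ> \<sigma>))"
    using assms(3,4) mem ij \<sigma> by (simp add: fuse_ker_label Idx_perm)
qed

lemma cupcap_ker_conj:
  assumes \<sigma>: "\<sigma> permutes {1..k}" and "cupcap_ker X \<in> gen_kernels"
  shows "cupcap_ker (\<sigma> ` X) \<in> gen_kernels"
proof (rule gen_kernels_conj[OF assms(1,2)])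
  fix i j assume ij: "i \<in> Idx" "j \<in> Idx"
  have "\<sigma> ` ({1..k} - X) = {1..k} - \<sigma> ` X"
    using permutes_image[OF \<sigma>] permutes_inj[OF \<sigma>] by (simp add: image_set_diff)
  from this[symmetric] have "(\<forall>s\<in>{1..k} - \<sigma> ` X. i s = j s) \<longleftrightarrow> (\<forall>s\<in>{1..k} - X. i (\<sigma> s) = j (\<sigma> s))"
    by (simp only: ball_simps)
  then show "cupcap_ker (\<sigma> ` X) (label i j) = cupcap_ker X (label (i \<circ> \<sigma>) (j \<circ> \<sigma>))"
    using ij \<sigma> by (simp add: cupcap_ker_def Idx_perm)
qed

lemma generator_kernels:
  assumes "k \<ge> 3"
  shows "fuse_ker 1 2 2 \<in> gen_kernels" "fuse_ker 1 2 3 \<in> gen_kernels" "cupcap_ker {1, 2} \<in> gen_kernels" "cupcap_ker {1, 2, 3} \<in> gen_kernels"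
proof -
  have kk: "1 \<in> {1..k}" "2 \<in> {1..k}" "3 \<in> {1..k}" using assms by auto
  have ball: "(\<forall>s\<in>{1..k}. P s) \<longleftrightarrow> P 1 \<and> P 2 \<and> P 3 \<and> (\<forall>s\<in>{1..k} - {1,2,3}. P s)" for P
    using kk by auto
  have ball2: "(\<forall>s\<in>{1..k} - {2}. P s) \<longleftrightarrow> P 1 \<and> P 3 \<and> (\<forall>s\<in>{1..k} - {1,2,3}. P s)" for P
    using kk by auto
  have ball3: "(\<forall>s\<in>{1..k} - {1,2}. P s) \<longleftrightarrow> P 3 \<and> (\<forall>s\<in>{1..k} - {1,2,3}. P s)" for P
    using kk by auto
  show "fuse_ker 1 2 2 \<in> gen_kernels"
  proof (rule gen_kernels_cong_rows[OF diag_ker_generated[of "b1_diag k"]])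
    fix i j assume ij: "i \<in> Idx" "j \<in> Idx"
    show "diag_ker (b1_diag k) (label i j) = fuse_ker 1 2 2 (label i j)"
      by (simp only: b1_diag_def diag_ker_diagram_of fuse_ker_label[OF ij kk(2) kk(2)] ball ball2)
        (use ij in \<open>auto simp: eq_commute[of "j a" "i b" for a b]\<close>)
  qed (simp add: generator_diagrams_def)
  show "fuse_ker 1 2 3 \<in> gen_kernels"
  proof (rule gen_kernels_cong_rows[OF diag_ker_generated[of "t1_diag k"]])
    fix i j assume ij: "i \<in> Idx" "j \<in> Idx"
    show "diag_ker (t1_diag k) (label i j) = fuse_ker 1 2 3 (label i j)"
      by (simp only: t1_diag_def diag_ker_diagram_of fuse_ker_label[OF ij kk(2) kk(3)] ball ball2)
        (use ij in \<open>auto simp: eq_commute[of "j a" "i b" for a b]\<close>)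
  qed (simp add: generator_diagrams_def)
  show "cupcap_ker {1, 2} \<in> gen_kernels"
  proof (rule gen_kernels_cong_rows[OF diag_ker_generated[of "e1_diag k"]])
    fix i j assume ij: "i \<in> Idx" "j \<in> Idx"
    show "diag_ker (e1_diag k) (label i j) = cupcap_ker {1, 2} (label i j)"
      by (simp only: e1_diag_def diag_ker_diagram_of cupcap_ker_def ball ball3)
        (use ij in simp)
  qed (simp add: generator_diagrams_def)
  show "cupcap_ker {1, 2, 3} \<in> gen_kernels"
  proof (rule gen_kernels_cong_rows[OF diag_ker_generated[of "h1_diag k"]])
    fix i j assume ij: "i \<in> Idx" "j \<in> Idx"
    show "diag_ker (h1_diag k) (label i j) = cupcap_ker {1, 2, 3} (label i j)"
      by (simp only: h1_diag_def diag_ker_diagram_of cupcap_ker_def ball ball3)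
        (use ij in simp)
  qed (simp add: generator_diagrams_def)
qed

lemma fuse_ker_generated:
  assumes "k \<ge> 3" "x \<in> {1..k}" "y \<in> {1..k}" "z \<in> {1..k}" "x \<noteq> y" "x \<noteq> z"
  shows "fuse_ker x y z \<in> gen_kernels"
proof -
  define f where "f = (\<lambda>a::nat. if a = 1 then x else if a = 2 then y else z)"
  show ?thesis
  proof (cases "y = z")
    case True
    have "inj_on f {1, 2}" "f ` {1, 2} \<subseteq> {1..k}" "{1, 2} \<subseteq> {1..k}"
      using assms by (auto simp: f_def inj_on_def)
    then obtain \<sigma> where \<sigma>: "\<sigma> permutes {1..k}" "\<And>a. a \<in> {1, 2} \<Longrightarrow> \<sigma> a = f a"
      using permutes_extend[of "{1..k}" "{1, 2}" f] by blast
    show ?thesis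
      using fuse_ker_conj[OF \<sigma>(1) generator_kernels(1)] assms \<sigma>(2)[of 1] \<sigma>(2)[of 2] True
      by (simp add: f_def)
  next
    case False
    have "inj_on f {1, 2, 3}" "f ` {1, 2, 3} \<subseteq> {1..k}" "{1, 2, 3} \<subseteq> {1..k}"
      using assms False by (auto simp: f_def inj_on_def)
    then obtain \<sigma> where \<sigma>: "\<sigma> permutes {1..k}" "\<And>a. a \<in> {1, 2, 3} \<Longrightarrow> \<sigma> a = f a"
      using permutes_extend[of "{1..k}" "{1, 2, 3}" f] by blast
    show ?thesis
      using fuse_ker_conj[OF \<sigma>(1) generator_kernels(2)] assms \<sigma>(2)[of 1] \<sigma>(2)[of 2] \<sigma>(2)[of 3]
      by (simp add: f_def)
  qed
qed

text \<open>Transposing exchanges \<open>x\<close> and \<open>z\<close> in $t_1$ and fixes $b_1$.\<close>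

lemma fuse_ker_gen_sym:
  assumes "k \<ge> 3" "x \<in> {1..k}" "y \<in> {1..k}" "z \<in> {1..k}" "x \<noteq> y" "x \<noteq> z"
  shows "fuse_ker x y z \<in> gen_sym"
proof -
  have "transposed (fuse_ker x y z) \<in> gen_kernels"
  proof (cases "y = z")
    case True
    show ?thesis
    proof (rule gen_kernels_cong_rows[OF fuse_ker_generated[OF assms]])
      fix i j assume "i \<in> Idx" "j \<in> Idx"
      moreover have "(i x = i z \<and> (\<forall>s\<in>{1..k} - {z}. j s = i s) \<and> j z = i z) =
          (j x = j z \<and> (\<forall>s\<in>{1..k} - {z}. i s = j s) \<and> i z = j z)"
        using assms by (metis Diff_iff singletonD)
      ultimately show "fuse_ker x y z (label i j) = transposed (fuse_ker x y z) (label i j)"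
        using True assms by (simp only: fuse_ker_label transposed_label)
    qed
  next
    case False
    show ?thesis
    proof (rule gen_kernels_cong_rows)
      show "fuse_ker z y x \<in> gen_kernels" using fuse_ker_generated[of z y x] assms False by auto
    next
      fix i j assume "i \<in> Idx" "j \<in> Idx"
      moreover have "(i z = i y \<and> (\<forall>s\<in>{1..k} - {y}. j s = i s) \<and> j y = i x) =
          (j x = j y \<and> (\<forall>s\<in>{1..k} - {y}. i s = j s) \<and> i y = j z)"
        using False assms by (metis Diff_iff singletonD)
      ultimately show "fuse_ker z y x (label i j) = transposed (fuse_ker x y z) (label i j)"
        using False assms by (simp only: fuse_ker_label transposed_label)
    qed
  qed
  then show ?thesis using fuse_ker_generated[OF assms] by (simp add: gen_sym_def)
qed

lemma cupcap_ker_gen_sym: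
  assumes "k \<ge> 3" "X \<subseteq> {1..k}" "card X = 2 \<or> card X = 3"
  shows "cupcap_ker X \<in> gen_sym"
proof -
  have X: "cupcap_ker {1..card X} \<in> gen_kernels"
  proof -
    have "{1..2::nat} = {1, 2}" "{1..3::nat} = {1, 2, 3}" by auto
    then show ?thesis using generator_kernels(3,4)[OF assms(1)] assms(3) by auto
  qed
  have "finite X" using assms(2) finite_subset by blast
  then obtain f where f: "bij_betw f {1..card X} X"
    using finite_same_card_bij[of "{1..card X}" X] by auto
  have "{1..card X} \<subseteq> {1..k}" using assms by auto
  then obtain \<sigma> where \<sigma>: "\<sigma> permutes {1..k}" "\<And>a. a \<in> {1..card X} \<Longrightarrow> \<sigma> a = f a"
    using permutes_extend[of "{1..k}" "{1..card X}" f] f assms(2) by (auto simp: bij_betw_def)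
  have "\<sigma> ` {1..card X} = X" using f \<sigma>(2) by (auto simp: bij_betw_def)
  then have "cupcap_ker X \<in> gen_kernels" using cupcap_ker_conj[OF \<sigma>(1) X] by simp
  moreover have "transposed (cupcap_ker X) = cupcap_ker X"
  proof
    fix l :: "vertex \<Rightarrow> nat"
    have "(\<forall>s\<in>{1..k} - X. l (Bot s) = l (Top s)) \<longleftrightarrow> (\<forall>s\<in>{1..k} - X. l (Top s) = l (Bot s))"
      by metis
    then show "transposed (cupcap_ker X) l = cupcap_ker X l"
      unfolding transposed_def cupcap_ker_def Lab_def by (simp add: top_row_def bot_row_def conj_ac)
  qed
  ultimately show ?thesis by (simp add: gen_sym_def)
qed

lemma kmult_cong:
  assumes "\<And>l. l \<in> Lab \<Longrightarrow> \<kappa> l = \<kappa>' l" shows "\<gamma> ** \<kappa> = \<gamma> ** \<kappa>'"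
  using assms by (auto simp: kmult_def Lab_def intro!: ext sum.cong)

text \<open>The product evaluates the kernel after replacing the label of \<open>y\<close> by that of \<open>z\<close>, and the freed
vertex \<open>y\<close> is tied to \<open>x\<close>.\<close>

lemma fuse_ker_kmult:
  assumes "l \<in> Lab" "y \<in> {1..k}" "z \<in> {1..k}"
  shows "(fuse_ker x y z ** \<kappa>) l = of_bool (l (Top x) = l (Top y)) * \<kappa> (l(Top y := l (Top z)))"
proof -
  obtain i j where l: "i \<in> Idx" "j \<in> Idx" "l = label i j" using Lab_cases[OF assms(1)] .
  let ?m = "i(y := i z)"
  have m: "?m \<in> Idx" using l assms by (intro Idx_upd Idx_range)
  have "fuse_ker x y z (label i m) * \<kappa> (label m j)
      = (if m = ?m then of_bool (i x = i y) * \<kappa> (label m j) else 0)" if "m \<in> Idx" for m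
    using that l by (simp add: fuse_ker_def)
  then have "(fuse_ker x y z ** \<kappa>) l = (\<Sum>m\<in>Idx. if m = ?m then of_bool (i x = i y) * \<kappa> (label m j) else 0)"
    using l by (simp add: kmult_def)
  also have "\<dots> = of_bool (i x = i y) * \<kappa> (label ?m j)"
    using m by (simp only: sum.delta finite_Idx if_True)
  finally show ?thesis using l by (simp only: label.simps label_upd)
qed

lemma cupcap_ker_kmult:
  assumes l: "i \<in> Idx" "j \<in> Idx" and X: "X \<subseteq> {1..k}" "X \<noteq> {}"
  shows "(cupcap_ker X ** \<kappa>) (label i j) = of_bool (\<forall>s\<in>X. \<forall>t\<in>X. i s = i t) *
    (\<Sum>a=1..n. \<kappa> (label (\<lambda>s. if s \<in> X then a else i s) j))"
proof -
  let ?m = "\<lambda>a s. if s \<in> X then a else i s"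
  obtain x where x: "x \<in> X" using X by blast
  have m: "?m a \<in> Idx" if "a \<in> {1..n}" for a
    using l(1) X(1) that unfolding multi_indices_def by (auto simp: PiE_iff extensional_def)
  have inj: "inj_on ?m {1..n}"
  proof (rule inj_onI)
    fix a b assume "?m a = ?m b"
    then have "?m a x = ?m b x" by (rule fun_cong)
    then show "a = b" using x by simp
  qed
  have "(cupcap_ker X ** \<kappa>) (label i j) = (\<Sum>m\<in>Idx. cupcap_ker X (label i m) * \<kappa> (label m j))"
    using l by (simp add: kmult_def)
  also have "\<dots> = (\<Sum>m\<in>?m ` {1..n}. cupcap_ker X (label i m) * \<kappa> (label m j))"
  proof (rule sum.mono_neutral_right)
    show "\<forall>p\<in>Idx - ?m ` {1..n}. cupcap_ker X (label i p) * \<kappa> (label p j) = 0"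
    proof
      fix p assume p: "p \<in> Idx - ?m ` {1..n}"
      have "cupcap_ker X (label i p) = 0"
      proof (rule ccontr)
        assume "cupcap_ker X (label i p) \<noteq> 0"
        then have h: "\<forall>s\<in>X. \<forall>t\<in>X. p s = p t" "\<forall>s\<in>{1..k} - X. i s = p s"
          unfolding cupcap_ker_def of_bool_eq_0_iff not_not label.simps by blast+
        have px: "p x \<in> {1..n}" by (rule Idx_range) (use p x X in auto)
        have "p = ?m (p x)"
        proof (rule Idx_eqI)
          fix s assume "s \<in> {1..k}"
          then show "p s = ?m (p x) s" using h(1)[rule_format, of s x] h(2) x by (cases "s \<in> X") auto
        qed (use p m[OF px] in simp_all)
        then show False using p px by blast
      qed
      then show "cupcap_ker X (label i p) * \<kappa> (label p j) = 0" by simp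
    qed
  qed (use m in auto)
  also have "\<dots> = (\<Sum>a=1..n. cupcap_ker X (label i (?m a)) * \<kappa> (label (?m a) j))"
    by (rule sum.reindex_cong[OF inj refl refl])
  also have "\<dots> = (\<Sum>a=1..n. of_bool (\<forall>s\<in>X. \<forall>t\<in>X. i s = i t) * \<kappa> (label (?m a) j))"
    using l m by (intro sum.cong refl arg_cong2[where f = "(*)"]) (auto simp: cupcap_ker_def)
  finally show ?thesis by (simp add: sum_distrib_left)
qed

section \<open>Partition kernels\<close>

abbreviation V :: "vertex set" where "V \<equiv> vertices k"

lemma finite_V [simp]: "finite V" by (simp add: vertices_def)
lemma Top_V [simp]: "Top s \<in> V \<longleftrightarrow> s \<in> {1..k}" and Bot_V [simp]: "Bot s \<in> V \<longleftrightarrow> s \<in> {1..k}"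
  by (auto simp: vertices_def)

text \<open>The kernel of the partition diagram whose blocks are the fibres of \<open>c\<close>. Describing partitions by
colourings turns moving a vertex to another block into a function update.\<close>

definition part_ker :: "(vertex \<Rightarrow> nat) \<Rightarrow> kernel" where
  "part_ker c l = of_bool (l \<in> Lab \<and> (\<forall>u\<in>V. \<forall>v\<in>V. c u = c v \<longrightarrow> l u = l v))"

definition num_blocks :: "(vertex \<Rightarrow> nat) \<Rightarrow> nat" where "num_blocks c = card (c ` V)"

lemma part_ker_cong: "(\<And>v. v \<in> V \<Longrightarrow> c v = c' v) \<Longrightarrow> part_ker c = part_ker c'"
  by (auto simp: part_ker_def fun_eq_iff)

lemma obtain_fresh:
  fixes c :: "vertex \<Rightarrow> nat" obtains F where "F \<notin> c ` V"
  using ex_new_if_finite[OF infinite_UNIV_nat, of "c ` V"] by auto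

lemma avg_part_ker_single:
  assumes v: "v \<in> V" and single: "\<And>u. u \<in> V \<Longrightarrow> u \<noteq> v \<Longrightarrow> c u \<noteq> c v"
  shows "avg v (part_ker c) = part_ker c"
proof
  fix l
  show "avg v (part_ker c) l = part_ker c l"
  proof (cases "l \<in> Lab")
    case True
    have "(c u = c w \<longrightarrow> (l(v := a)) u = (l(v := a)) w) \<longleftrightarrow> (c u = c w \<longrightarrow> l u = l w)"
      if "u \<in> V" "w \<in> V" for u w a
      using single[of u] single[of w] that by (cases "u = v"; cases "w = v") auto
    then have "part_ker c (l(v := a)) = part_ker c l" if "a \<in> {1..n}" for a
      unfolding part_ker_def using True Lab_upd[OF True v that] by (simp only: simp_thms cong: ball_cong)
    then show ?thesis using True n_pos by (simp add: avg_def)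
  qed (simp add: avg_def part_ker_def)
qed

text \<open>Exactly one value of the label of \<open>v\<close> is compatible with the rest of its block, so averaging
releases \<open>v\<close> from the block at the cost of a factor $1/n$.\<close>

lemma avg_part_ker_isolate:
  assumes v: "v \<in> V" and u: "u \<in> V" "u \<noteq> v" "c u = c v" and F: "F \<notin> c ` V"
  shows "avg v (part_ker c) = fscale (1 / of_nat n) (part_ker (c(v := F)))"
proof
  fix l
  show "avg v (part_ker c) l = fscale (1 / of_nat n) (part_ker (c(v := F))) l"
  proof (cases "l \<in> Lab")
    case True
    have "part_ker c (l(v := a)) = (if a = l u then part_ker (c(v := F)) l else 0)" if a: "a \<in> {1..n}" for a
    proof (cases "a = l u")
      case False
      have "\<not> (\<forall>x\<in>V. \<forall>y\<in>V. c x = c y \<longrightarrow> (l(v := a)) x = (l(v := a)) y)"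
      proof
        assume "\<forall>x\<in>V. \<forall>y\<in>V. c x = c y \<longrightarrow> (l(v := a)) x = (l(v := a)) y"
        then have "(l(v := a)) u = (l(v := a)) v" using u v by blast
        then show False using u False by simp
      qed
      then have "part_ker c (l(v := a)) = 0" unfolding part_ker_def by simp
      then show ?thesis using False by simp
    next
      case True
      have "(\<forall>x\<in>V. \<forall>y\<in>V. c x = c y \<longrightarrow> (l(v := a)) x = (l(v := a)) y) \<longleftrightarrow>
            (\<forall>x\<in>V. \<forall>y\<in>V. (c(v := F)) x = (c(v := F)) y \<longrightarrow> l x = l y)" (is "?L \<longleftrightarrow> ?R")
      proof
        assume L: ?L
        show ?R
        proof (intro ballI impI)
          fix x y assume xy: "x \<in> V" "y \<in> V" "(c(v := F)) x = (c(v := F)) y"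
          have "x = v \<longleftrightarrow> y = v" using xy F by (metis fun_upd_apply image_eqI)
          then show "l x = l y" using L[rule_format, of x y] xy by (cases "x = v") simp_all
        qed
      next
        assume R: ?R
        have *: "l x = l u" if "x \<in> V" "x \<noteq> v" "c x = c v" for x
          using R[rule_format, of x u] that u v by auto
        show ?L
        proof (intro ballI impI)
          fix x y assume xy: "x \<in> V" "y \<in> V" "c x = c y"
          then show "(l(v := a)) x = (l(v := a)) y"
            using R[rule_format, of x y] *[of x] *[of y] True by auto
        qed
      qed
      then show ?thesis using True \<open>l \<in> Lab\<close> Lab_upd[OF \<open>l \<in> Lab\<close> v a] by (simp add: part_ker_def)
    qed
    then have "(\<Sum>a=1..n. part_ker c (l(v := a))) = (\<Sum>a=1..n. if a = l u then part_ker (c(v := F)) l else 0)"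
      by (intro sum.cong) auto
    also have "\<dots> = part_ker (c(v := F)) l"
      using Lab_range[OF True u(1)] by simp
    finally show ?thesis using True by (simp add: avg_def fscale_def)
  qed (simp add: avg_def part_ker_def fscale_def)
qed

lemma num_blocks_isolate:
  assumes v: "v \<in> V" and u: "u \<in> V" "u \<noteq> v" "c u = c v" and F: "F \<notin> c ` V"
  shows "num_blocks (c(v := F)) = num_blocks c + 1"
proof -
  have "(c(v := F)) ` V = insert F (c ` V)"
  proof -
    have "c ` (V - {v}) = c ` V"
      using u by (auto simp: image_iff) (metis DiffI singletonD)
    then show ?thesis using v by (simp only: fun_upd_image if_True)
  qed
  then show ?thesis using F by (simp add: num_blocks_def)
qed

definition many_blocks :: "nat \<Rightarrow> kernel set" where
  "many_blocks m = fun_space.span {part_ker c | c. m \<le> num_blocks c}"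

lemma part_ker_many_blocks: "m \<le> num_blocks c \<Longrightarrow> part_ker c \<in> many_blocks m"
  unfolding many_blocks_def by (rule fun_space.span_base) auto

lemma span_linear_image:
  fixes \<Phi> :: "kernel \<Rightarrow> kernel"
  assumes add: "\<And>x y. \<Phi> (\<lambda>l. x l + y l) = (\<lambda>l. \<Phi> x l + \<Phi> y l)"
    and scale: "\<And>a x. \<Phi> (\<lambda>l. a * x l) = (\<lambda>l. a * \<Phi> x l)"
    and sub: "fun_space.subspace Q" and base: "\<And>b. b \<in> B \<Longrightarrow> \<Phi> b \<in> Q"
    and x: "x \<in> fun_space.span B"
  shows "\<Phi> x \<in> Q"
  using x
proof (induction rule: fun_space.span_induct_alt)
  case base
  have "\<Phi> 0 = 0" using scale[of 0 0] by (simp add: fun_eq_iff zero_fun_def)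
  then show ?case using fun_space.subspace_0[OF sub] by (simp only:)
next
  case (step a b y)
  have "\<Phi> (fscale a b + y) = fscale a (\<Phi> b) + \<Phi> y"
    unfolding plus_fun_def fscale_def by (simp only: add scale)
  then show ?case
    using step assms(4) fun_space.subspace_add[OF sub] fun_space.subspace_scale[OF sub] by metis
qed

lemma avg_part_ker_many_blocks: "v \<in> V \<Longrightarrow> m \<le> num_blocks c \<Longrightarrow> avg v (part_ker c) \<in> many_blocks m"
proof (cases "\<exists>u\<in>V. u \<noteq> v \<and> c u = c v")
  case True
  assume v: "v \<in> V" "m \<le> num_blocks c"
  obtain F where F: "F \<notin> c ` V" by (rule obtain_fresh)
  obtain u where u: "u \<in> V" "u \<noteq> v" "c u = c v" using True by blast
  show ?thesis unfolding avg_part_ker_isolate[OF v(1) u F]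
    using num_blocks_isolate[OF v(1) u F] v(2) part_ker_many_blocks[of m] unfolding many_blocks_def
    by (intro fun_space.span_scale) auto
next
  case False
  assume "v \<in> V" "m \<le> num_blocks c"
  then show ?thesis using False by (subst avg_part_ker_single) (auto intro: part_ker_many_blocks)
qed

lemma avg_part_ker_many_blocks_Suc:
  assumes "v \<in> V" "u \<in> V" "u \<noteq> v" "c u = c v" shows "avg v (part_ker c) \<in> many_blocks (num_blocks c + 1)"
proof -
  obtain F where F: "F \<notin> c ` V" by (rule obtain_fresh)
  show ?thesis unfolding avg_part_ker_isolate[OF assms F]
    using num_blocks_isolate[OF assms F] part_ker_many_blocks[of "num_blocks c + 1"] unfolding many_blocks_def
    by (intro fun_space.span_scale) auto
qed

lemma avg_many_blocks: "v \<in> V \<Longrightarrow> \<kappa> \<in> many_blocks m \<Longrightarrow> avg v \<kappa> \<in> many_blocks m"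
proof -
  assume v: "v \<in> V" and \<kappa>: "\<kappa> \<in> many_blocks m"
  show ?thesis
  proof (rule span_linear_image[where \<Phi> = "avg v" and B = "{part_ker c | c. m \<le> num_blocks c}"])
    show "fun_space.subspace (many_blocks m)" unfolding many_blocks_def by (rule fun_space.subspace_span)
    show "\<kappa> \<in> fun_space.span {part_ker c | c. m \<le> num_blocks c}" using \<kappa> by (simp add: many_blocks_def)
  qed (use v in \<open>auto simp: avg_add avg_scale avg_part_ker_many_blocks\<close>)
qed

section \<open>Fusing two blocks\<close>

text \<open>The block of \<open>y\<close> is united with that of \<open>z\<close>, and then \<open>y\<close> alone is moved to the block
of \<open>x\<close>. For \<open>z = y\<close> this degenerates to uniting the blocks of \<open>x\<close> and \<open>y\<close>.\<close>

definition fuse_col :: "nat \<Rightarrow> nat \<Rightarrow> nat \<Rightarrow> (vertex \<Rightarrow> nat) \<Rightarrow> vertex \<Rightarrow> nat" where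
  "fuse_col x y z c =
    (let c1 = (\<lambda>v. if c v = c (Top y) then c (Top (if z = y then x else z)) else c v)
     in c1(Top y := c1 (Top x)))"

text \<open>The factor \<open>l (Top x) = l (Top y)\<close> accounts for the new place of \<open>y\<close>; in the remaining
constraints \<open>y\<close> carries the label of \<open>z\<close>, so its old block is tied to \<open>z\<close>.\<close>

lemma fuse_ker_part_ker:
  assumes k: "x \<in> {1..k}" "y \<in> {1..k}" "z \<in> {1..k}" and ne: "x \<noteq> y" "x \<noteq> z"
  shows "fuse_ker x y z ** part_ker c = part_ker (fuse_col x y z c)"
proof
  fix l
  show "(fuse_ker x y z ** part_ker c) l = part_ker (fuse_col x y z c) l"
  proof (cases "l \<in> Lab")
    case True
    \<comment> \<open>A vertex other than \<open>y\<close> that carries the label of \<open>z\<close> whenever \<open>x\<close> and \<open>y\<close> have the same label.\<close>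
    define z' where "z' = (if z = y then x else z)"
    define c1 where "c1 = (\<lambda>v. if c v = c (Top y) then c (Top z') else c v)"
    define d where "d = c1(Top y := c1 (Top x))"
    define l' where "l' = l(Top y := l (Top z))"
    have d: "fuse_col x y z c = d" by (simp only: fuse_col_def d_def c1_def z'_def Let_def)
    have l': "l' \<in> Lab" unfolding l'_def by (intro Lab_upd Lab_range True) (use k in auto)
    have z': "z' \<noteq> y" "Top z' \<in> V" using ne k by (auto simp: z'_def)
    have lz: "l (Top z) = l (Top z')" if "l (Top x) = l (Top y)" using that by (simp add: z'_def)
    have l'_ne: "l' w = l w" if "w \<noteq> Top y" for w using that by (simp add: l'_def)
    have l'_y: "l' (Top y) = l (Top z)" by (simp add: l'_def)
    have d_ne: "d w = c1 w" if "w \<noteq> Top y" for w using that by (simp add: d_def)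
    have "l (Top x) = l (Top y) \<and> (\<forall>u\<in>V. \<forall>v\<in>V. c u = c v \<longrightarrow> l' u = l' v) \<longleftrightarrow>
        (\<forall>u\<in>V. \<forall>v\<in>V. d u = d v \<longrightarrow> l u = l v)" (is "?L \<longleftrightarrow> ?R")
    proof
      assume L: ?L
      have A: "l w = l (Top z')" if "w \<in> V" "w \<noteq> Top y" "c w = c (Top y)" for w
        using L that k l'_ne[of w] l'_y lz by (metis Top_V)
      have B: "l u = l v" if uv: "u \<in> V" "v \<in> V" "u \<noteq> Top y" "v \<noteq> Top y" "c1 u = c1 v" for u v
      proof -
        have B1: "l u = l (Top z')" if "u \<in> V" "u \<noteq> Top y" "c u = c (Top z')" for u
        proof -
          have "l' u = l' (Top z')" using L that z' by blast
          then show ?thesis using l'_ne[OF that(2)] l'_ne[of "Top z'"] z' by simp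
        qed
        show ?thesis
        proof (cases "c u = c (Top y)"; cases "c v = c (Top y)")
          assume "c u \<noteq> c (Top y)" "c v \<noteq> c (Top y)"
          then have "c u = c v" using uv by (simp add: c1_def)
          then show ?thesis using L uv l'_ne by metis
        next
          assume h: "c u = c (Top y)" "c v \<noteq> c (Top y)"
          then have "c v = c (Top z')" using uv by (simp add: c1_def)
          then show ?thesis using A[OF uv(1,3) h(1)] B1[OF uv(2,4)] by simp
        next
          assume h: "c u \<noteq> c (Top y)" "c v = c (Top y)"
          then have "c u = c (Top z')" using uv by (simp add: c1_def)
          then show ?thesis using A[OF uv(2,4) h(2)] B1[OF uv(1,3)] by simp
        next
          assume "c u = c (Top y)" "c v = c (Top y)"
          then show ?thesis using A[OF uv(1,3)] A[OF uv(2,4)] by simp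
        qed
      qed
      define r where "r = (\<lambda>u. if u = Top y then Top x else u)"
      have r: "r u \<in> V" "r u \<noteq> Top y" "d u = c1 (r u)" "l u = l (r u)" if "u \<in> V" for u
        using that k ne L by (auto simp: r_def d_def)
      show ?R using B r by metis
    next
      assume R: ?R
      have xy: "l (Top x) = l (Top y)"
        using R[rule_format, of "Top x" "Top y"] k ne by (simp add: d_def)
      have C: "l w = l (Top z')" if "w \<in> V" "w \<noteq> Top y" "c w = c (Top y)" for w
      proof -
        have "d w = d (Top z')" using that z' by (simp add: d_def c1_def)
        then show ?thesis using R that z' by blast
      qed
      have "l' u = l' v" if "u \<in> V" "v \<in> V" "c u = c v" for u v
      proof (cases "u = Top y"; cases "v = Top y")
        assume "u \<noteq> Top y" "v \<noteq> Top y"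
        moreover from this have "d u = d v" using that by (simp add: d_def c1_def)
        ultimately show ?thesis using R that l'_ne by metis
      qed (use C that xy lz l'_ne l'_y in auto)
      then show ?L using xy by blast
    qed
    moreover have "(fuse_ker x y z ** part_ker c) l = of_bool (l (Top x) = l (Top y)) * part_ker c l'"
      by (simp only: fuse_ker_kmult[OF True k(2,3)] l'_def)
    ultimately show ?thesis
      unfolding d part_ker_def using True l' by (simp only: simp_thms flip: of_bool_conj)
  qed (simp add: kmult_def part_ker_def)
qed

text \<open>The colour of \<open>y\<close> is the only one that can disappear.\<close>

lemma num_blocks_fuse_col: "num_blocks c \<le> num_blocks (fuse_col x y z c) + 1"
proof -
  have "c ` V - {c (Top y)} \<subseteq> fuse_col x y z c ` V"
  proof
    fix a assume "a \<in> c ` V - {c (Top y)}"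
    then obtain v where "v \<in> V" "a = c v" "c v \<noteq> c (Top y)" by auto
    then show "a \<in> fuse_col x y z c ` V" by (intro image_eqI[of _ _ v]) (auto simp: fuse_col_def Let_def)
  qed
  then have "card (c ` V - {c (Top y)}) \<le> num_blocks (fuse_col x y z c)"
    unfolding num_blocks_def by (intro card_mono) auto
  then show ?thesis unfolding num_blocks_def by (simp add: card_Diff_singleton_if split: if_splits)
qed

lemma kmult_proj_diff:
  "\<gamma> ** \<kappa> = (\<lambda>l. (\<gamma> ** (proj_ker ** \<kappa>)) l + (- 1) * (\<gamma> ** (proj_top k \<kappa> - \<kappa>)) l)"
proof -
  have "\<gamma> ** \<kappa> = \<gamma> ** (\<lambda>l. (proj_ker ** \<kappa>) l + (- 1) * (proj_top k \<kappa> - \<kappa>) l)"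
    by (rule kmult_cong) (simp add: proj_ker_kmult)
  then show ?thesis by (simp only: kmult_add kmult_scale)
qed

text \<open>Products with the projection in between are available in the algebra; this trades them for plain
products once the error term is known to be in the set.\<close>

lemma gen_sym_unproject:
  assumes "\<gamma> ** (proj_ker ** \<kappa>) \<in> gen_sym" "\<gamma> ** (proj_top k \<kappa> - \<kappa>) \<in> gen_sym"
  shows "\<gamma> ** \<kappa> \<in> gen_sym"
proof -
  have "\<gamma> ** (proj_ker ** \<kappa>) + fscale (- 1) (\<gamma> ** (proj_top k \<kappa> - \<kappa>)) \<in> gen_sym"
    using assms by (intro fun_space.subspace_add[OF gen_sym_subspace] fun_space.subspace_scale[OF gen_sym_subspace])
  then show ?thesis
    using kmult_proj_diff[of \<gamma> \<kappa>] by (simp only: plus_fun_def fscale_def)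
qed

text \<open>No top vertex of \<open>c\<close> is isolated, so the terms by which the projection changes \<open>part_ker c\<close> have at
least one block more than \<open>c\<close>. Fusing loses at most one block, hence the error terms have at least
as many blocks as \<open>c\<close>.\<close>

lemma fuse_step:
  assumes k: "k \<ge> 3" "x \<in> {1..k}" "y \<in> {1..k}" "z \<in> {1..k}" "x \<noteq> y" "x \<noteq> z"
    and top: "\<And>s. s \<in> {1..k} \<Longrightarrow> \<exists>u\<in>V. u \<noteq> Top s \<and> c u = c (Top s)"
    and IH: "\<And>c'. num_blocks c \<le> num_blocks c' \<Longrightarrow> part_ker c' \<in> gen_sym"
  shows "part_ker (fuse_col x y z c) \<in> gen_sym"
proof -
  have sub: "many_blocks (num_blocks c) \<subseteq> gen_sym"
    unfolding many_blocks_def by (rule fun_space.span_minimal[OF _ gen_sym_subspace]) (auto intro: IH)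
  have "proj_top k (part_ker c) - part_ker c \<in> many_blocks (num_blocks c + 1)"
  proof (rule proj_top_minus_id)
    show "fun_space.subspace (many_blocks (num_blocks c + 1))" unfolding many_blocks_def by (rule fun_space.subspace_span)
    fix s assume s: "s \<in> {1..k}"
    show "avg (Top s) (part_ker c) \<in> many_blocks (num_blocks c + 1)"
    proof -
      obtain u where u: "u \<in> V" "u \<noteq> Top s" "c u = c (Top s)" using top[OF s] by blast
      show ?thesis by (rule avg_part_ker_many_blocks_Suc[OF _ u]) (use s in simp)
    qed
    show "avg (Top s) \<kappa> \<in> many_blocks (num_blocks c + 1)" if "\<kappa> \<in> many_blocks (num_blocks c + 1)" for \<kappa>
      using s that by (auto intro: avg_many_blocks)
  qed simp
  then have "fuse_ker x y z ** (proj_top k (part_ker c) - part_ker c) \<in> many_blocks (num_blocks c)"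
    unfolding many_blocks_def[of "num_blocks c + 1"]
  proof (rule span_linear_image[rotated -1])
    show "fun_space.subspace (many_blocks (num_blocks c))" unfolding many_blocks_def by (rule fun_space.subspace_span)
    show "fuse_ker x y z ** b \<in> many_blocks (num_blocks c)" if "b \<in> {part_ker c' |c'. num_blocks c + 1 \<le> num_blocks c'}" for b
      using that by (auto simp: fuse_ker_part_ker[OF k(2-6)] intro!: part_ker_many_blocks)
        (metis num_blocks_fuse_col add_le_cancel_right le_trans Suc_eq_plus1)
  qed (rule kmult_add kmult_scale)+
  then have "fuse_ker x y z ** part_ker c \<in> gen_sym"
    using sub by (intro gen_sym_unproject[OF gen_sym_mult[OF fuse_ker_gen_sym[OF k] IH[OF order_refl]]]) blast
  then show ?thesis by (simp only: fuse_ker_part_ker[OF k(2-6)])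
qed

section \<open>Creating one block inside each row\<close>

lemma kmult_avg_Bot_gen_sym:
  assumes "t \<in> {1..k}" shows "\<gamma> ** avg (Bot t) \<kappa> \<in> gen_sym"
proof (rule gen_sym_indep[of "Bot t"])
  fix l a assume l: "l \<in> Lab" and a: "a \<in> {1..n}"
  obtain i j where ij: "i \<in> Idx" "j \<in> Idx" "l = label i j" using Lab_cases[OF l] .
  have j: "j(t := a) \<in> Idx" using ij assms a by (intro Idx_upd)
  have "avg (Bot t) \<kappa> (label m (j(t := a))) = avg (Bot t) \<kappa> (label m j)" if "m \<in> Idx" for m
    using avg_upd[of "Bot t" "label m j" a \<kappa>] that ij assms a by simp
  then show "(\<gamma> ** avg (Bot t) \<kappa>) (l(Bot t := a)) = (\<gamma> ** avg (Bot t) \<kappa>) l"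
    using ij j by (simp add: kmult_def)
qed (use assms in simp)

lemma cupcap_avg_Top_gen_sym:
  assumes X: "X \<subseteq> {1..k}" "X \<noteq> {}" and s: "s \<in> {1..k} - X"
  shows "cupcap_ker X ** avg (Top s) \<kappa> \<in> gen_sym"
proof (rule gen_sym_indep[of "Top s"])
  fix l b assume l: "l \<in> Lab" and b: "b \<in> {1..n}"
  obtain i j where ij: "i \<in> Idx" "j \<in> Idx" "l = label i j" using Lab_cases[OF l] .
  have i: "i(s := b) \<in> Idx" using ij s b by (intro Idx_upd) auto
  let ?m = "\<lambda>i a t. if t \<in> X then a else i t :: nat"
  have "avg (Top s) \<kappa> (label (?m (i(s := b)) a) j) = avg (Top s) \<kappa> (label (?m i a) j)"
    if a: "a \<in> {1..n}" for a
  proof -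
    have "?m (i(s := b)) a = (?m i a)(s := b)" using s by (auto simp: fun_eq_iff)
    moreover have "?m i a \<in> Idx"
      using ij(1) X(1) a unfolding multi_indices_def by (auto simp: PiE_iff extensional_def)
    ultimately show ?thesis
      using avg_upd[of "Top s" "label (?m i a) j" b \<kappa>] ij s b by (simp only: label_upd label_Lab Top_V) auto
  qed
  moreover have "(\<forall>u\<in>X. \<forall>t\<in>X. (i(s := b)) u = (i(s := b)) t) \<longleftrightarrow> (\<forall>u\<in>X. \<forall>t\<in>X. i u = i t)"
    using s by auto
  ultimately show "(cupcap_ker X ** avg (Top s) \<kappa>) (l(Top s := b)) = (cupcap_ker X ** avg (Top s) \<kappa>) l"
    unfolding ij(3) label_upd cupcap_ker_kmult[OF i ij(2) X] cupcap_ker_kmult[OF ij(1,2) X]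
    by (intro arg_cong2[where f = "(*)"] sum.cong refl) auto
qed (use s in simp)

text \<open>Here the error terms act as zero. Averaging a top vertex outside \<open>X\<close> leaves a product that ignores
this vertex, and averaging a top vertex of \<open>X\<close> isolates its only partner, a bottom vertex, which the
product then ignores too.\<close>

lemma cupcap_step:
  assumes k: "k \<ge> 3" and X: "X \<subseteq> {1..k}" "card X = 2 \<or> card X = 3"
    and partner: "\<And>x. x \<in> X \<Longrightarrow> \<exists>t\<in>{1..k}. \<forall>u\<in>V. c u = c (Top x) \<longleftrightarrow> u = Top x \<or> u = Bot t"
    and c: "part_ker c \<in> gen_sym"
  shows "cupcap_ker X ** part_ker c \<in> gen_sym"
proof -
  have ne: "X \<noteq> {}" using X by auto
  \<comment> \<open>A product of \<open>cupcap_ker X\<close> with one of these kernels ignores the averaged vertex.\<close>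
  let ?B = "{avg v \<kappa> | v \<kappa>. v \<in> Top ` ({1..k} - X) \<union> Bot ` {1..k}}"
  let ?Q = "fun_space.span ?B"
  have base: "avg v \<kappa> \<in> ?Q" if "v \<in> Top ` ({1..k} - X) \<union> Bot ` {1..k}" for v \<kappa>
    by (rule fun_space.span_base) (use that in blast)
  have "proj_top k (part_ker c) - part_ker c \<in> ?Q"
  proof (rule proj_top_minus_id)
    show "fun_space.subspace ?Q" by (rule fun_space.subspace_span)
    fix s assume s: "s \<in> {1..k}"
    show "avg (Top s) \<kappa> \<in> ?Q" if "\<kappa> \<in> ?Q" for \<kappa>
    proof (rule span_linear_image[where \<Phi> = "avg (Top s)" and B = ?B])
      fix b assume "b \<in> ?B"
      then obtain v \<kappa>' where b: "b = avg v \<kappa>'" "v \<in> Top ` ({1..k} - X) \<union> Bot ` {1..k}" by blast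
      have "avg (Top s) b = avg v (avg (Top s) \<kappa>')"
        unfolding b(1) by (rule avg_commute) (use s b(2) in \<open>auto simp: vertices_def\<close>)
      then show "avg (Top s) b \<in> ?Q" using base[OF b(2)] by simp
    qed (use that in \<open>auto simp: avg_add avg_scale fun_space.subspace_span\<close>)
    show "avg (Top s) (part_ker c) \<in> ?Q"
    proof (cases "s \<in> X")
      case False then show ?thesis using s by (intro base) auto
    next
      case True
      obtain t where t: "t \<in> {1..k}" "\<And>u. u \<in> V \<Longrightarrow> c u = c (Top s) \<longleftrightarrow> u = Top s \<or> u = Bot t"
        using partner[OF True] by blast
      obtain F where F: "F \<notin> c ` V" by (rule obtain_fresh)
      let ?c = "c(Top s := F)"
      have "avg (Top s) (part_ker c) = fscale (1 / of_nat n) (part_ker ?c)"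
        by (rule avg_part_ker_isolate[OF _ _ _ _ F, of _ "Bot t"]) (use s t(1) t(2)[of "Bot t"] in auto)
      also have "part_ker ?c = avg (Bot t) (part_ker ?c)"
      proof (rule avg_part_ker_single[symmetric])
        fix u assume u: "u \<in> V" "u \<noteq> Bot t"
        show "?c u \<noteq> ?c (Bot t)"
          using t(1) t(2)[OF u(1)] t(2)[of "Bot t"] u F by (auto simp: image_iff)
      qed (use t in simp)
      also have "fscale (1 / of_nat n) (avg (Bot t) (part_ker ?c)) \<in> ?Q"
        by (intro fun_space.span_scale base) (use t in auto)
      finally show ?thesis .
    qed
  qed simp
  then have "cupcap_ker X ** (proj_top k (part_ker c) - part_ker c) \<in> gen_sym"
  proof (rule span_linear_image[rotated -1])
    fix b assume "b \<in> ?B"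
    then show "cupcap_ker X ** b \<in> gen_sym" using kmult_avg_Bot_gen_sym cupcap_avg_Top_gen_sym[OF X(1) ne] by auto
  qed (rule kmult_add kmult_scale gen_sym_subspace)+
  then show ?thesis
    by (rule gen_sym_unproject[OF gen_sym_mult[OF cupcap_ker_gen_sym[OF k X] c]])
qed

text \<open>The block \<open>X\<close> of the top row and the block \<open>Y\<close> of the bottom row are replaced by edges
from \<open>\<psi> t\<close> to \<open>t\<close>, for \<open>t\<close> in \<open>Y\<close>. If all colours in use are below \<open>N\<close>, the new ones are fresh.\<close>

definition split_col :: "nat set \<Rightarrow> nat set \<Rightarrow> (nat \<Rightarrow> nat) \<Rightarrow> nat \<Rightarrow> (vertex \<Rightarrow> nat) \<Rightarrow> vertex \<Rightarrow> nat" where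
  "split_col X Y \<psi> N c = (\<lambda>v. case v of
     Top s \<Rightarrow> if s \<in> X then N + s else c v | Bot t \<Rightarrow> if t \<in> Y then N + \<psi> t else c v)"

lemma split_col_simps:
  "s \<in> X \<Longrightarrow> split_col X Y \<psi> N c (Top s) = N + s"
  "t \<in> Y \<Longrightarrow> split_col X Y \<psi> N c (Bot t) = N + \<psi> t"
  "v \<notin> Top ` X \<union> Bot ` Y \<Longrightarrow> split_col X Y \<psi> N c v = c v"
  by (auto simp: split_col_def split: vertex.splits)

text \<open>In the following block \<open>X\<close> is a block of \<open>c\<close> inside the top row and \<open>Y\<close> a block of the same
size inside the bottom row.\<close>

context
  fixes c :: "vertex \<Rightarrow> nat" and X Y :: "nat set" and \<psi> :: "nat \<Rightarrow> nat" and N \<alpha> \<beta> :: nat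
  assumes X: "X \<subseteq> {1..k}" "X \<noteq> {}" and Y: "Y \<subseteq> {1..k}"
    and X_class: "\<And>v. v \<in> V \<Longrightarrow> c v = \<alpha> \<longleftrightarrow> v \<in> Top ` X"
    and Y_class: "\<And>v. v \<in> V \<Longrightarrow> c v = \<beta> \<longleftrightarrow> v \<in> Bot ` Y"
    and \<psi>: "bij_betw \<psi> Y X" and N: "\<And>v. v \<in> V \<Longrightarrow> c v < N"
begin

abbreviation "rest_V \<equiv> V - Top ` X - Bot ` Y"
abbreviation "split_c \<equiv> split_col X Y \<psi> N c"

lemma Y_nonempty: "Y \<noteq> {}" using \<psi> X(2) by (auto simp: bij_betw_def)

lemma split_rest: "v \<in> rest_V \<Longrightarrow> split_c v = c v" "v \<in> rest_V \<Longrightarrow> split_c v < N"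
  using split_col_simps(3)[of v X Y \<psi> N c] N[of v] by auto

lemma split_bound: "v \<in> V \<Longrightarrow> split_c v < N \<longleftrightarrow> v \<in> rest_V"
  using split_rest by (cases "v \<in> rest_V") (auto simp: split_col_simps)

lemma split_partner:
  assumes "x \<in> X"
  shows "\<exists>t\<in>Y. \<psi> t = x \<and> (\<forall>u\<in>V. split_c u = split_c (Top x) \<longleftrightarrow> u = Top x \<or> u = Bot t)"
proof -
  obtain t where t: "t \<in> Y" "\<psi> t = x" using \<psi> assms by (auto simp: bij_betw_def)
  have "u = Top x \<or> u = Bot t" if u: "u \<in> V" "split_c u = split_c (Top x)" for u
  proof -
    have "u \<notin> rest_V" using split_rest(2)[of u] u(2) assms by (auto simp: split_col_simps)
    then consider s where "s \<in> X" "u = Top s" | t' where "t' \<in> Y" "u = Bot t'" using u(1) by blast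
    then show ?thesis
    proof cases
      case 1 then show ?thesis using u(2) assms by (simp add: split_col_simps)
    next
      case 2
      then have "\<psi> t' = \<psi> t" using u(2) assms t by (simp add: split_col_simps)
      then have "t' = t" using \<psi> 2 t by (auto simp: bij_betw_def inj_on_def)
      then show ?thesis using 2 by simp
    qed
  qed
  then show ?thesis using t assms by (intro bexI[of _ t]) (auto simp: split_col_simps)
qed

lemma split_rest_class:
  assumes "v \<in> rest_V" shows "{u \<in> V. split_c u = split_c v} = {u \<in> V. c u = c v}"
proof -
  have 1: "c v \<noteq> \<alpha>" "c v \<noteq> \<beta>" using assms X_class[of v] Y_class[of v] by auto
  have "split_c u = split_c v \<longleftrightarrow> c u = c v" if "u \<in> V" for u
  proof (cases "u \<in> rest_V")
    case True then show ?thesis using assms split_rest by simp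
  next
    case False
    then have "split_c u \<noteq> split_c v" using split_bound[OF that] split_rest(2)[OF assms] by auto
    moreover have "c u = \<alpha> \<or> c u = \<beta>" using False that X_class[OF that] Y_class[OF that] by blast
    ultimately show ?thesis using 1 by auto
  qed
  then show ?thesis by auto
qed

text \<open>Labels of \<open>X\<close> and \<open>Y\<close> agree along the edges; summing over the common label of \<open>X\<close> leaves the
condition that \<open>Y\<close> is labelled constantly, and the new constraint on \<open>X\<close> comes from the other
half of the diagram.\<close>

lemma cupcap_split: "cupcap_ker X ** part_ker split_c = part_ker c"
proof
  fix l
  show "(cupcap_ker X ** part_ker split_c) l = part_ker c l"
  proof (cases "l \<in> Lab")
    case True
    then obtain i j where ij: "i \<in> Idx" "j \<in> Idx" "l = label i j" by (rule Lab_cases)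
    obtain t0 where t0: "t0 \<in> Y" using Y_nonempty by blast
    let ?R = "\<forall>u\<in>rest_V. \<forall>v\<in>rest_V. c u = c v \<longrightarrow> l u = l v"
    let ?m = "\<lambda>a s. if s \<in> X then a else i s :: nat"
    let ?CY = "\<forall>s\<in>Y. \<forall>t\<in>Y. j s = j t"
    let ?CX = "\<forall>s\<in>X. \<forall>t\<in>X. i s = i t"
    have split: "part_ker split_c (label (?m a) j) = (if a = j t0 then of_bool (?CY \<and> ?R) else 0)"
      if a: "a \<in> {1..n}" for a
    proof -
      let ?l = "label (?m a) j"
      have l_rest: "?l u = l u" if "u \<in> rest_V" for u using that ij(3) by (cases u) auto
      have "?m a \<in> Idx"
        using ij(1) X(1) a unfolding multi_indices_def by (auto simp: PiE_iff extensional_def)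
      then have lab: "?l \<in> Lab" using ij by simp
      have "(\<forall>u\<in>V. \<forall>v\<in>V. split_c u = split_c v \<longrightarrow> ?l u = ?l v) \<longleftrightarrow> (\<forall>t\<in>Y. j t = a) \<and> ?R" (is "?L \<longleftrightarrow> _")
      proof (intro iffI conjI ballI impI)
        fix t assume L: ?L and t: "t \<in> Y"
        have "\<psi> t \<in> X" using \<psi> t by (auto simp: bij_betw_def)
        then have "?l (Top (\<psi> t)) = ?l (Bot t)"
        proof -
          have "\<psi> t \<in> {1..k}" "t \<in> {1..k}" using \<open>\<psi> t \<in> X\<close> t X Y by blast+
          then show ?thesis
            using L[rule_format, of "Top (\<psi> t)" "Bot t"] t \<open>\<psi> t \<in> X\<close> by (simp add: split_col_simps)
        qed
        then show "j t = a" using \<open>\<psi> t \<in> X\<close> by simp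
      next
        fix u v assume L: ?L and uv: "u \<in> rest_V" "v \<in> rest_V" "c u = c v"
        then have "?l u = ?l v" using L[rule_format, of u v] split_rest by auto
        then show "l u = l v" using l_rest uv by simp
      next
        fix u v assume R: "(\<forall>t\<in>Y. j t = a) \<and> ?R" and uv: "u \<in> V" "v \<in> V" "split_c u = split_c v"
        have A: "?l w = a" if "w \<in> V" "w \<notin> rest_V" for w
          using that R by auto
        show "?l u = ?l v"
        proof (cases "u \<in> rest_V")
          case True
          then have "v \<in> rest_V" using uv split_bound by metis
          then show ?thesis using True R uv split_rest(1) l_rest by metis
        next
          case False
          then have "v \<notin> rest_V" using uv split_bound by metis
          then show ?thesis using A uv False by metis
        qed
      qed
      moreover have "(\<forall>t\<in>Y. j t = a) \<longleftrightarrow> a = j t0 \<and> ?CY" using t0 by metis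
      ultimately show ?thesis using lab by (simp add: part_ker_def)
    qed
    have "(\<Sum>a=1..n. part_ker split_c (label (?m a) j)) = (\<Sum>a=1..n. if a = j t0 then of_bool (?CY \<and> ?R) else 0)"
      by (intro sum.cong refl split)
    also have "\<dots> = of_bool (?CY \<and> ?R)" using Idx_range[OF ij(2), of t0] t0 Y by (auto simp: subset_iff)
    finally have "(cupcap_ker X ** part_ker split_c) l = of_bool (?CX \<and> ?CY \<and> ?R)"
      unfolding ij(3) cupcap_ker_kmult[OF ij(1,2) X] by (simp only: of_bool_conj)
    moreover have "(\<forall>u\<in>V. \<forall>v\<in>V. c u = c v \<longrightarrow> l u = l v) \<longleftrightarrow> ?CX \<and> ?CY \<and> ?R" (is "?L \<longleftrightarrow> _")
    proof (intro iffI conjI ballI impI)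
      fix s t assume L: ?L and st: "s \<in> X" "t \<in> X"
      have "c (Top s) = \<alpha>" "c (Top t) = \<alpha>" using st X X_class[of "Top s"] X_class[of "Top t"] by auto
      moreover have "s \<in> {1..k}" "t \<in> {1..k}" using st X by blast+
      ultimately show "i s = i t" using L[rule_format, of "Top s" "Top t"] ij(3) by simp
    next
      fix s t assume L: ?L and st: "s \<in> Y" "t \<in> Y"
      have "c (Bot s) = \<beta>" "c (Bot t) = \<beta>" using st Y Y_class[of "Bot s"] Y_class[of "Bot t"] by auto
      moreover have "s \<in> {1..k}" "t \<in> {1..k}" using st Y by blast+
      ultimately show "j s = j t" using L[rule_format, of "Bot s" "Bot t"] ij(3) by simp
    next
      fix u v assume R: "?CX \<and> ?CY \<and> ?R" and uv: "u \<in> V" "v \<in> V" "c u = c v"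
      consider "c u = \<alpha>" | "c u = \<beta>" | "c u \<noteq> \<alpha>" "c u \<noteq> \<beta>" by blast
      then show "l u = l v"
      proof cases
        case 1
        then have "c v = \<alpha>" using uv by simp
        then obtain s t where st: "s \<in> X" "t \<in> X" "u = Top s" "v = Top t"
          using 1 X_class[OF uv(1)] X_class[OF uv(2)] by blast
        then have "i s = i t" using R by blast
        then show ?thesis by (simp only: st ij(3) label.simps)
      next
        case 2
        then have "c v = \<beta>" using uv by simp
        then obtain s t where st: "s \<in> Y" "t \<in> Y" "u = Bot s" "v = Bot t"
          using 2 Y_class[OF uv(1)] Y_class[OF uv(2)] by blast
        then have "j s = j t" using R by blast
        then show ?thesis by (simp only: st ij(3) label.simps)
      next
        case 3
        then have "u \<in> rest_V" "v \<in> rest_V" using uv X_class[of u] X_class[of v] Y_class[of u] Y_class[of v] by auto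
        then show ?thesis using R uv by blast
      qed
    qed blast
    ultimately show ?thesis using True by (simp only: part_ker_def simp_thms)
  qed (simp add: kmult_def part_ker_def)
qed

lemma num_blocks_split: "num_blocks split_c + 2 = num_blocks c + card X"
proof -
  have fin: "finite X" "finite rest_V" using X finite_subset by auto
  have V: "V = rest_V \<union> Top ` X \<union> Bot ` Y" using X Y by (auto simp: vertices_def)
  have "c ` V = insert \<alpha> (insert \<beta> (c ` rest_V))"
  proof -
    have "c (Top x) = \<alpha>" if "x \<in> X" for x using X_class[of "Top x"] X(1) that by auto
    then have "c ` Top ` X = {\<alpha>}" using X(2) by auto
    moreover have "c (Bot x) = \<beta>" if "x \<in> Y" for x using Y_class[of "Bot x"] Y that by auto
    then have "c ` Bot ` Y = {\<beta>}" using Y_nonempty by auto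
    ultimately
    show ?thesis by (subst V) (simp add: image_Un Un_commute)
  qed
  moreover have "\<alpha> \<notin> c ` rest_V" "\<beta> \<notin> c ` rest_V" using X_class Y_class by auto
  moreover have "\<alpha> \<noteq> \<beta>"
  proof -
    obtain x where "x \<in> X" using X by blast
    then show ?thesis using X_class[of "Top x"] Y_class[of "Top x"] X by auto
  qed
  ultimately have 1: "num_blocks c = card (c ` rest_V) + 2" using fin by (simp add: num_blocks_def)
  have "split_c ` V = c ` rest_V \<union> (+) N ` X"
  proof -
    have "split_c ` Top ` X = (+) N ` X" by (auto simp: split_col_simps image_iff)
    moreover have "split_c ` Bot ` Y = (+) N ` X"
    proof -
      have "split_c ` Bot ` Y = (+) N ` (\<psi> ` Y)" by (auto simp: split_col_simps image_iff)
      then show ?thesis using \<psi> by (simp add: bij_betw_def)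
    qed
    moreover have "split_c ` rest_V = c ` rest_V" using split_rest by (intro image_cong) auto
    ultimately show ?thesis by (subst V) (simp only: image_Un Un_assoc Un_absorb)
  qed
  moreover have "c ` rest_V \<inter> (+) N ` X = {}" using N by force
  ultimately have "num_blocks split_c = card (c ` rest_V) + card X"
    using fin by (simp add: num_blocks_def card_Un_disjoint card_image)
  then show ?thesis using 1 by simp
qed

lemma split_step:
  assumes "k \<ge> 3" "card X = 2 \<or> card X = 3" "part_ker split_c \<in> gen_sym"
  shows "part_ker c \<in> gen_sym"
proof -
  have "cupcap_ker X ** part_ker split_c \<in> gen_sym"
    using assms X(1)
  proof (intro cupcap_step)
    fix x assume "x \<in> X"
    from split_partner[OF this] show "\<exists>t\<in>{1..k}. \<forall>u\<in>V. split_c u = split_c (Top x) \<longleftrightarrow> u = Top x \<or> u = Bot t"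
      using Y by blast
  qed auto
  then show ?thesis by (simp add: cupcap_split)
qed

end

section \<open>Generation of all partition kernels\<close>

abbreviation class_of :: "(vertex \<Rightarrow> nat) \<Rightarrow> vertex \<Rightarrow> vertex set" where
  "class_of c v \<equiv> {u \<in> V. c u = c v}"

lemma card_V: "card V = 2 * k"
proof -
  have "card V = card (Top ` {1..k}) + card (Bot ` {1..k})"
    unfolding vertices_def by (rule card_Un_disjoint) auto
  then show ?thesis by (simp add: card_image inj_on_def)
qed

lemma num_blocks_le: "num_blocks c \<le> 2 * k"
  unfolding num_blocks_def card_V[symmetric] by (rule card_image_le) simp

lemma sum_class_sizes: "(\<Sum>a\<in>c ` V. card {u \<in> V. c u = a}) = 2 * k"
  using sum.image_gen[of V "\<lambda>_. 1::nat" c] by (simp add: card_V)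

lemma card_class_split:
  "card {u \<in> V. c u = a} = card {s \<in> {1..k}. c (Top s) = a} + card {s \<in> {1..k}. c (Bot s) = a}"
proof -
  have "{u \<in> V. c u = a} = Top ` {s \<in> {1..k}. c (Top s) = a} \<union> Bot ` {s \<in> {1..k}. c (Bot s) = a}"
    unfolding vertices_def by blast
  also have "card \<dots> = card (Top ` {s \<in> {1..k}. c (Top s) = a}) + card (Bot ` {s \<in> {1..k}. c (Bot s) = a})"
    by (rule card_Un_disjoint) auto
  finally show ?thesis by (simp add: card_image inj_on_def)
qed

lemma singleton_block_generated:
  assumes v: "v \<in> V" "\<And>u. u \<in> V \<Longrightarrow> u \<noteq> v \<Longrightarrow> c u \<noteq> c v" shows "part_ker c \<in> gen_sym"
  using avg_upd[OF v(1), of _ _ "part_ker c"] avg_part_ker_single[where c = c, OF v] by (intro gen_sym_indep[OF v(1)]) simp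

text \<open>If all blocks are pairs and none lies in the top row, every block is an edge between the rows and the diagram
is a permutation.\<close>

lemma vertical_pairs_generated:
  assumes sizes: "\<And>v. v \<in> V \<Longrightarrow> card (class_of c v) = 2" and inj: "inj_on (\<lambda>s. c (Top s)) {1..k}"
  shows "part_ker c \<in> gen_sym"
proof -
  have "\<exists>t\<in>{1..k}. c (Bot t) = c (Top s)" if s: "s \<in> {1..k}" for s
  proof -
    have "{t \<in> {1..k}. c (Top t) = c (Top s)} = {s}"
    proof (intro equalityI subsetI)
      fix t assume "t \<in> {t \<in> {1..k}. c (Top t) = c (Top s)}"
      then show "t \<in> {s}" using inj_onD[OF inj, of t s] s by simp
    qed (use s in simp)
    then have "card {t \<in> {1..k}. c (Bot t) = c (Top s)} = 1"
      using sizes[of "Top s"] s by (simp add: card_class_split)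
    then have "{t \<in> {1..k}. c (Bot t) = c (Top s)} \<noteq> {}" by (metis card.empty zero_neq_one)
    then show ?thesis by blast
  qed
  then obtain f where f: "\<And>s. s \<in> {1..k} \<Longrightarrow> f s \<in> {1..k} \<and> c (Bot (f s)) = c (Top s)" by metis
  have "inj_on f {1..k}" using inj f by (metis (mono_tags, lifting) inj_on_def)
  then obtain \<sigma> where \<sigma>: "\<sigma> permutes {1..k}" "\<And>s. s \<in> {1..k} \<Longrightarrow> \<sigma> s = f s"
  proof -
    have "f ` {1..k} \<subseteq> {1..k}" using f by blast
    then show thesis
      using permutes_extend[OF finite_atLeastAtMost subset_refl \<open>inj_on f {1..k}\<close>] that by blast
  qed
  have c_\<sigma>: "c (Bot (\<sigma> s)) = c (Top s)" if "s \<in> {1..k}" for s using f \<sigma> that by simp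
  have "perm_ker (inv \<sigma>) \<in> gen_sym" by (intro perm_ker_gen_sym permutes_inv \<sigma>)
  then show ?thesis
  proof (rule gen_sym_cong)
    fix l assume l: "l \<in> Lab"
    then obtain i j where ij: "i \<in> Idx" "j \<in> Idx" "l = label i j" by (rule Lab_cases)
    have "j = i \<circ> inv \<sigma> \<longleftrightarrow> i = j \<circ> \<sigma>"
      using permutes_inv_o[OF \<sigma>(1)] by (metis comp_assoc comp_id)
    also have "\<dots> \<longleftrightarrow> (\<forall>s\<in>{1..k}. i s = j (\<sigma> s))"
      using row_eq_iff[OF Idx_perm[OF ij(2) \<sigma>(1)] ij(1)] by simp
    also have "\<dots> \<longleftrightarrow> (\<forall>u\<in>V. \<forall>v\<in>V. c u = c v \<longrightarrow> l u = l v)"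
    proof
      assume R: "\<forall>u\<in>V. \<forall>v\<in>V. c u = c v \<longrightarrow> l u = l v"
      show "\<forall>s\<in>{1..k}. i s = j (\<sigma> s)"
        using R c_\<sigma> permutes_in_image[OF \<sigma>(1)] ij(3) by (metis Bot_V Top_V label.simps)
    next
      assume L: "\<forall>s\<in>{1..k}. i s = j (\<sigma> s)"
      have rep: "\<exists>s\<in>{1..k}. c u = c (Top s) \<and> l u = i s" if "u \<in> V" for u
      proof (cases u)
        case (Top s) then show ?thesis using that ij by auto
      next
        case (Bot t)
        then have t: "t \<in> {1..k}" using that by simp
        then obtain s where "s \<in> {1..k}" "t = \<sigma> s" using permutes_image[OF \<sigma>(1)] by blast
        then show ?thesis using Bot L c_\<sigma>[of s] ij by auto
      qed
      show "\<forall>u\<in>V. \<forall>v\<in>V. c u = c v \<longrightarrow> l u = l v"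
      proof (intro ballI impI)
        fix u v assume "u \<in> V" "v \<in> V" "c u = c v"
        then show "l u = l v" using rep[of u] rep[of v] inj by (metis (mono_tags, lifting) inj_on_def)
      qed
    qed
    finally show "perm_ker (inv \<sigma>) l = part_ker c l"
      using ij by (simp add: perm_ker_def part_ker_def)
  qed
qed

lemma obtain_bound:
  fixes c :: "vertex \<Rightarrow> nat" obtains N where "\<And>v. v \<in> V \<Longrightarrow> c v < N"
proof
  fix v assume "v \<in> V"
  then show "c v < Suc (Max (c ` V))" by (simp add: less_Suc_eq_le)
qed

lemma class_eq_pure_top:
  assumes "\<And>t. t \<in> {1..k} \<Longrightarrow> c (Bot t) \<noteq> a" "v \<in> V"
  shows "c v = a \<longleftrightarrow> v \<in> Top ` {s \<in> {1..k}. c (Top s) = a}"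
  using assms by (cases v) auto

lemma class_eq_pure_bot:
  assumes "\<And>t. t \<in> {1..k} \<Longrightarrow> c (Top t) \<noteq> a" "v \<in> V"
  shows "c v = a \<longleftrightarrow> v \<in> Bot ` {s \<in> {1..k}. c (Bot s) = a}"
  using assms by (cases v) auto

text \<open>A pair inside the top row forces one inside the bottom row, by counting. Splitting both with the help
of $e_1$ keeps all blocks pairs and leaves fewer pairs in the top row.\<close>

lemma all_pairs_generated:
  assumes "k \<ge> 3" and sizes: "\<And>v. v \<in> V \<Longrightarrow> card (class_of c v) = 2"
  shows "part_ker c \<in> gen_sym"
  using sizes
proof (induction "card {s \<in> {1..k}. \<exists>t\<in>{1..k}. t \<noteq> s \<and> c (Top t) = c (Top s)}"
    arbitrary: c rule: less_induct)
  case less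
  let ?cups = "\<lambda>c. {s \<in> {1..k}. \<exists>t\<in>{1..k}. t \<noteq> s \<and> c (Top t) = c (Top s)}"
  show ?case
  proof (cases "inj_on (\<lambda>s. c (Top s)) {1..k}")
    case True
    then show ?thesis using less.prems by (intro vertical_pairs_generated)
  next
    case False
    then obtain x y where xy: "x \<in> {1..k}" "y \<in> {1..k}" "x \<noteq> y" "c (Top x) = c (Top y)"
      by (auto simp: inj_on_def)
    define \<alpha> where "\<alpha> = c (Top x)"
    define X where "X = {s \<in> {1..k}. c (Top s) = \<alpha>}"
    have "card {x, y} \<le> card X" unfolding X_def by (rule card_mono) (use xy in \<open>auto simp: \<alpha>_def\<close>)
    moreover have "card X + card {s \<in> {1..k}. c (Bot s) = \<alpha>} = 2"
      unfolding X_def card_class_split[symmetric] \<alpha>_def by (rule less.prems) (use xy in simp)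
    ultimately have cardX: "card X = 2" and "card {s \<in> {1..k}. c (Bot s) = \<alpha>} = 0"
    proof -
      assume *: "card {x, y} \<le> card X" "card X + card {s \<in> {1..k}. c (Bot s) = \<alpha>} = 2"
      have "card {x, y} = 2" using xy(3) by simp
      then show "card X = 2" "card {s \<in> {1..k}. c (Bot s) = \<alpha>} = 0" using * by linarith+
    qed
    then have no_bot: "c (Bot t) \<noteq> \<alpha>" if "t \<in> {1..k}" for t using that by auto
    have "2 * num_blocks c = 2 * k"
    proof -
      have "(\<Sum>a\<in>c ` V. card {u \<in> V. c u = a}) = (\<Sum>a\<in>c ` V. 2)"
        by (rule sum.cong) (auto simp: less.prems)
      then show ?thesis using sum_class_sizes[of c] by (simp add: num_blocks_def)
    qed
    then have num_blocks: "num_blocks c = k" by simp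
    \<comment> \<open>Otherwise the bottom vertices would meet all blocks, including the one inside the top row.\<close>
    have "\<not> inj_on (\<lambda>s. c (Bot s)) {1..k}"
    proof
      assume inj: "inj_on (\<lambda>s. c (Bot s)) {1..k}"
      have "card ((\<lambda>s. c (Bot s)) ` {1..k}) = card (c ` V)"
        using card_image[OF inj] num_blocks by (simp add: num_blocks_def)
      moreover have "(\<lambda>s. c (Bot s)) ` {1..k} \<subseteq> c ` V" by auto
      ultimately have "(\<lambda>s. c (Bot s)) ` {1..k} = c ` V" by (intro card_subset_eq) auto
      moreover have "\<alpha> \<in> c ` V" using xy by (auto simp: \<alpha>_def)
      ultimately obtain t where "t \<in> {1..k}" "\<alpha> = c (Bot t)" by blast
      then show False using no_bot[of t] by simp
    qed
    then obtain p q where pq: "p \<in> {1..k}" "q \<in> {1..k}" "p \<noteq> q" "c (Bot p) = c (Bot q)"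
      by (auto simp: inj_on_def)
    define \<beta> where "\<beta> = c (Bot p)"
    define Y where "Y = {s \<in> {1..k}. c (Bot s) = \<beta>}"
    have "card {p, q} \<le> card Y" unfolding Y_def by (rule card_mono) (use pq in \<open>auto simp: \<beta>_def\<close>)
    moreover have "card {s \<in> {1..k}. c (Top s) = \<beta>} + card Y = 2"
      unfolding Y_def card_class_split[symmetric] \<beta>_def by (rule less.prems) (use pq in simp)
    ultimately have cardY: "card Y = 2" and "card {s \<in> {1..k}. c (Top s) = \<beta>} = 0"
    proof -
      assume *: "card {p, q} \<le> card Y" "card {s \<in> {1..k}. c (Top s) = \<beta>} + card Y = 2"
      have "card {p, q} = 2" using pq(3) by simp
      then show "card Y = 2" "card {s \<in> {1..k}. c (Top s) = \<beta>} = 0" using * by linarith+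
    qed
    then have no_top: "c (Top t) \<noteq> \<beta>" if "t \<in> {1..k}" for t using that by auto
    have "finite X" "finite Y" by (auto simp: X_def Y_def)
    then obtain \<psi> where \<psi>: "bij_betw \<psi> Y X"
      using finite_same_card_bij[of Y X] cardX cardY by auto
    obtain N where N: "\<And>v. v \<in> V \<Longrightarrow> c v < N" using obtain_bound[of c] by blast
    have "X \<noteq> {}" using cardX by (metis card.empty zero_neq_numeral)
    then have XY: "X \<subseteq> {1..k}" "X \<noteq> {}" "Y \<subseteq> {1..k}" by (auto simp: X_def Y_def)
    note ctx = XY class_eq_pure_top[of c \<alpha>, OF no_bot, folded X_def]
      class_eq_pure_bot[of c \<beta>, OF no_top, folded Y_def] \<psi> N
    define d where "d = split_col X Y \<psi> N c"
    have rest: "class_of d v = class_of c v" if "v \<in> V - Top ` X - Bot ` Y" for v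
      unfolding d_def by (rule split_rest_class[OF ctx that])
    have partner: "\<exists>t\<in>Y. \<psi> t = s \<and> (\<forall>u\<in>V. d u = d (Top s) \<longleftrightarrow> u = Top s \<or> u = Bot t)" if "s \<in> X" for s
      unfolding d_def by (rule split_partner[OF ctx that])
    have partner_card: "card (class_of d (Top s)) = 2" if s: "s \<in> X" for s
    proof -
      obtain t where "t \<in> Y" "\<forall>u\<in>V. d u = d (Top s) \<longleftrightarrow> u = Top s \<or> u = Bot t" using partner[OF s] by blast
      then have "class_of d (Top s) = {Top s, Bot t}" using s XY by auto
      then show ?thesis by simp
    qed
    have "part_ker d \<in> gen_sym"
    proof (rule less.hyps)
      have "?cups d \<subseteq> ?cups c - X"
      proof
        fix s assume "s \<in> ?cups d"
        then obtain t where st: "s \<in> {1..k}" "t \<in> {1..k}" "t \<noteq> s" "d (Top t) = d (Top s)" by blast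
        have "s \<notin> X"
        proof
          assume "s \<in> X"
          then obtain r where "\<forall>u\<in>V. d u = d (Top s) \<longleftrightarrow> u = Top s \<or> u = Bot r" using partner by blast
          then show False using st by auto
        qed
        then have "Top s \<in> V - Top ` X - Bot ` Y" using st by auto
        from rest[OF this] have "Top t \<in> class_of c (Top s)" using st Top_V[of t] by blast
        then have "c (Top t) = c (Top s)" by simp
        then show "s \<in> ?cups c - X" using st \<open>s \<notin> X\<close> by blast
      qed
      moreover have "x \<in> ?cups c" "x \<in> X" using xy by (auto simp: X_def \<alpha>_def)
      ultimately have "?cups d \<subset> ?cups c" by blast
      then show "card (?cups d) < card (?cups c)" by (intro psubset_card_mono) auto
    next
      fix v assume v: "v \<in> V"
      consider "v \<in> V - Top ` X - Bot ` Y" | s where "s \<in> X" "v = Top s" | t where "t \<in> Y" "v = Bot t"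
        using v by blast
      then show "card (class_of d v) = 2"
      proof cases
        case 1 then show ?thesis using rest[OF 1] less.prems[OF v] by simp
      next
        case 2 then show ?thesis using partner_card by simp
      next
        case 3
        then have "\<psi> t \<in> X" using \<psi> by (auto simp: bij_betw_def)
        moreover have "d v = d (Top (\<psi> t))"
          using 3 \<open>\<psi> t \<in> X\<close> by (simp add: d_def split_col_simps)
        ultimately show ?thesis using partner_card[of "\<psi> t"] by simp
      qed
    qed
    then show ?thesis unfolding d_def
      by (intro split_step[OF ctx assms(1)]) (use cardX in auto)
  qed
qed

fun flip :: "vertex \<Rightarrow> vertex" where "flip (Top s) = Bot s" | "flip (Bot s) = Top s"

lemma flip_flip [simp]: "flip (flip v) = v" by (cases v) auto
lemma flip_V [simp]: "flip v \<in> V \<longleftrightarrow> v \<in> V" by (cases v) auto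

lemma flip_image_V: "flip ` V = V"
  by (metis flip_V flip_flip image_eqI image_subsetI subsetI subset_antisym)

lemma transposed_part_ker: "transposed (part_ker c) = part_ker (c \<circ> flip)"
proof
  fix l
  let ?l = "label (bot_row l) (top_row l)"
  have l: "?l v = l (flip v)" for v by (cases v) (auto simp: top_row_def bot_row_def)
  have "(\<forall>u\<in>V. \<forall>v\<in>V. c u = c v \<longrightarrow> l (flip u) = l (flip v)) \<longleftrightarrow>
    (\<forall>u\<in>V. \<forall>v\<in>V. c (flip u) = c (flip v) \<longrightarrow> l u = l v)"
    by (metis flip_V flip_flip)
  moreover have "?l \<in> Lab \<longleftrightarrow> l \<in> Lab" by (auto simp: Lab_def)
  ultimately show "transposed (part_ker c) l = part_ker (c \<circ> flip) l"
    by (simp only: transposed_def part_ker_def l o_apply)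
qed

lemma part_ker_flip: "part_ker (c \<circ> flip) \<in> gen_sym \<Longrightarrow> part_ker c \<in> gen_sym"
  using gen_sym_transposed[of "part_ker (c \<circ> flip)"] by (simp flip: transposed_part_ker)

lemma num_blocks_flip: "num_blocks (c \<circ> flip) = num_blocks c"
  unfolding num_blocks_def image_comp[symmetric] flip_image_V ..

lemma card_class_of_flip: "card {u \<in> V. (c \<circ> flip) u = a} = card {u \<in> V. c u = a}"
proof -
  have "{u \<in> V. c u = a} = flip ` {u \<in> V. (c \<circ> flip) u = a}"
    by (auto simp: image_iff) (metis flip_V flip_flip)
  moreover have "inj_on flip {u \<in> V. (c \<circ> flip) u = a}" by (metis flip_flip inj_onI)
  ultimately show ?thesis by (simp add: card_image)
qed

text \<open>The diagram \<open>c\<close> is obtained by fusing from the diagram in which \<open>y\<close> and a further vertex \<open>r\<close>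
of the block of \<open>z\<close> form a block of their own. That diagram has one block more, and hypothesis
\<open>two\<close> says that removing \<open>y\<close> and \<open>r\<close> leaves no vertex isolated.\<close>

lemma block_fusion_step:
  assumes "k \<ge> 3"
    and IH: "\<And>c'. num_blocks c < num_blocks c' \<Longrightarrow> part_ker c' \<in> gen_sym"
    and xyz: "x \<in> {1..k}" "y \<in> {1..k}" "z \<in> {1..k}" "x \<noteq> y" "x \<noteq> z" "c (Top x) = c (Top y)"
    and r: "r \<in> V" "r \<notin> {Top x, Top y, Top z}" "c r = c (Top z)"
    and two: "\<And>v. v \<in> V - {Top y, r} \<Longrightarrow> card (class_of c v - {Top y, r}) \<ge> 2"
  shows "part_ker c \<in> gen_sym"
proof -
  obtain F where F: "F \<notin> c ` V" by (rule obtain_fresh)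
  define c' where "c' = c(Top y := F, r := F)"
  have c'_yr: "c' (Top y) = F" "c' r = F" by (auto simp: c'_def)
  have c'_ne: "c' v = c v" if "v \<noteq> Top y" "v \<noteq> r" for v using that by (simp add: c'_def)
  have neF: "c v \<noteq> F" if "v \<in> V" for v using F that by auto
  have xV: "Top x \<in> V - {Top y, r}" using xyz r by auto
  have "c ` (V - {Top y, r}) = c ` V"
  proof -
    have "c v \<in> c ` (V - {Top y, r})" if "v \<in> V" for v
    proof (cases "v = Top y \<or> v = r")
      case True
      have "c (Top y) \<in> c ` (V - {Top y, r})" using xV xyz by (metis image_eqI)
      moreover have "c r \<in> c ` (V - {Top y, r})"
        using \<open>c (Top y) \<in> _\<close> r xyz by (cases "z = y") (auto simp: image_iff)
      ultimately show ?thesis using True by auto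
    qed (use that in auto)
    then show ?thesis by auto
  qed
  moreover have "c' ` V = insert F (c ` (V - {Top y, r}))"
  proof -
    have "V = insert (Top y) (insert r (V - {Top y, r}))" using xyz r by auto
    then have "c' ` V = insert F (c' ` (V - {Top y, r}))" using c'_yr by (metis image_insert insert_absorb2)
    also have "c' ` (V - {Top y, r}) = c ` (V - {Top y, r})" by (intro image_cong) (auto simp: c'_ne)
    finally show ?thesis .
  qed
  ultimately have num_blocks: "num_blocks c' = num_blocks c + 1" using F by (simp add: num_blocks_def)
  have "part_ker (fuse_col x y z c') \<in> gen_sym"
  proof (rule fuse_step[OF assms(1) xyz(1-5)])
    fix s assume s: "s \<in> {1..k}"
    consider "Top s = Top y" | "Top s = r" | "Top s \<in> V - {Top y, r}" using s by auto
    then show "\<exists>u\<in>V. u \<noteq> Top s \<and> c' u = c' (Top s)"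
    proof cases
      case 1 then show ?thesis using r c'_yr by (intro bexI[of _ r]) auto
    next
      case 2 then show ?thesis using r xyz c'_yr by (intro bexI[of _ "Top y"]) auto
    next
      case 3
      obtain a b where ab: "a \<in> class_of c (Top s) - {Top y, r}" "b \<in> class_of c (Top s) - {Top y, r}" "a \<noteq> b"
        using two_elements[OF two[OF 3]] by blast
      then obtain u where u: "u \<in> class_of c (Top s) - {Top y, r}" "u \<noteq> Top s" by metis
      then have "c' u = c' (Top s)" using c'_ne[of u] c'_ne[of "Top s"] 3 by auto
      then show ?thesis using u by blast
    qed
  qed (use num_blocks IH in auto)
  moreover have "part_ker (fuse_col x y z c') = part_ker c"
  proof (rule part_ker_cong)
    fix v assume v: "v \<in> V"
    define z' where "z' = (if z = y then x else z)"
    have z': "c' (Top z') = c (Top z)"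
    proof -
      have "Top z' \<noteq> Top y" "Top z' \<noteq> r" using xyz(4) r(2) by (auto simp: z'_def)
      from c'_ne[OF this] show ?thesis by (simp add: z'_def xyz(6))
    qed
    have cx: "c' (Top x) = c (Top x)" "c' (Top x) \<noteq> F"
      using xV c'_ne[of "Top x"] neF[of "Top x"] by auto
    consider "v = Top y" | "v = r" "v \<noteq> Top y" | "v \<noteq> Top y" "v \<noteq> r" by blast
    then show "fuse_col x y z c' v = c v"
    proof cases
      case 1 then show ?thesis using cx xyz c'_yr by (simp add: fuse_col_def Let_def)
    next
      case 2
      then show ?thesis using z' r c'_yr unfolding fuse_col_def Let_def z'_def[symmetric] by simp
    next
      case 3
      then show ?thesis using c'_ne[OF 3] neF[OF v] c'_yr by (simp add: fuse_col_def Let_def)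
    qed
  qed
  ultimately show ?thesis by simp
qed

text \<open>The situations on the top row in which such \<open>x\<close>, \<open>y\<close>, \<open>z\<close>, \<open>r\<close> exist: in a block with at
least four elements one takes \<open>z = y\<close> and uses $b_1$, for two blocks with at least three elements
one uses $t_1$.\<close>

definition fusible :: "(vertex \<Rightarrow> nat) \<Rightarrow> bool" where
  "fusible c \<longleftrightarrow> (\<exists>x\<in>{1..k}. \<exists>y\<in>{1..k}. x \<noteq> y \<and> c (Top x) = c (Top y) \<and>
     (card (class_of c (Top x)) \<ge> 4 \<or>
      (\<exists>z\<in>{1..k}. c (Top z) \<noteq> c (Top x) \<and> card (class_of c (Top x)) \<ge> 3 \<and> card (class_of c (Top z)) \<ge> 3)))"

lemma fusibleI:
  assumes "x \<in> {1..k}" "y \<in> {1..k}" "x \<noteq> y" "c (Top x) = a" "c (Top y) = a"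
    and "card {u \<in> V. c u = a} \<ge> 4 \<or> (\<exists>z\<in>{1..k}. c (Top z) \<noteq> a \<and>
      card {u \<in> V. c u = a} \<ge> 3 \<and> card {u \<in> V. c u = c (Top z)} \<ge> 3)"
  shows "fusible c"
  unfolding fusible_def using assms by (intro bexI[of _ x] bexI[of _ y]) simp_all

lemma fusible_step:
  assumes "k \<ge> 3" and IH: "\<And>c'. num_blocks c < num_blocks c' \<Longrightarrow> part_ker c' \<in> gen_sym"
    and sizes: "\<And>v. v \<in> V \<Longrightarrow> card (class_of c v) \<ge> 2" and "fusible c"
  shows "part_ker c \<in> gen_sym"
proof -
  obtain x y where xy: "x \<in> {1..k}" "y \<in> {1..k}" "x \<noteq> y" "c (Top x) = c (Top y)"
    and cond: "card (class_of c (Top x)) \<ge> 4 \<or>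
      (\<exists>z\<in>{1..k}. c (Top z) \<noteq> c (Top x) \<and> card (class_of c (Top x)) \<ge> 3 \<and> card (class_of c (Top z)) \<ge> 3)"
    using assms(4) unfolding fusible_def by blast
  have diff: "card A - card B \<le> card (A - B)" if "finite B" for A B :: "vertex set"
    using diff_card_le_card_Diff[OF that] .
  from cond show ?thesis
  proof
    assume big: "card (class_of c (Top x)) \<ge> 4"
    have "card (class_of c (Top x) - {Top x, Top y}) \<ge> 2"
      using big diff[of "{Top x, Top y}" "class_of c (Top x)"] xy by simp
    then obtain r where r: "r \<in> class_of c (Top x) - {Top x, Top y}" by (rule two_elements)
    show ?thesis
    proof (rule block_fusion_step[OF assms(1) IH xy(1,2,2,3,3,4)])
      show "r \<in> V" "r \<notin> {Top x, Top y, Top y}" "c r = c (Top y)" using r xy by auto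
      fix v assume v: "v \<in> V - {Top y, r}"
      show "card (class_of c v - {Top y, r}) \<ge> 2"
      proof (cases "c v = c (Top x)")
        case True
        moreover have "card {Top y, r} = 2" using r by (intro card_2_iff[THEN iffD2] exI conjI) auto
        ultimately show ?thesis using big diff[of "{Top y, r}" "class_of c v"] by simp
      next
        case False
        then have "class_of c v - {Top y, r} = class_of c v" using r xy by auto
        then show ?thesis using sizes[of v] v by simp
      qed
    qed
  next
    assume "\<exists>z\<in>{1..k}. c (Top z) \<noteq> c (Top x) \<and> card (class_of c (Top x)) \<ge> 3 \<and> card (class_of c (Top z)) \<ge> 3"
    then obtain z where z: "z \<in> {1..k}" "c (Top z) \<noteq> c (Top x)" "card (class_of c (Top x)) \<ge> 3"
      "card (class_of c (Top z)) \<ge> 3" by blast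
    have "card (class_of c (Top z) - {Top z}) \<ge> 2"
      using z diff[of "{Top z}" "class_of c (Top z)"] by simp
    then obtain r where r: "r \<in> class_of c (Top z) - {Top z}" by (rule two_elements)
    have "x \<noteq> z" using z by auto
    show ?thesis
    proof (rule block_fusion_step[OF assms(1) IH xy(1,2) z(1) xy(3) \<open>x \<noteq> z\<close> xy(4)])
      show "r \<in> V" "r \<notin> {Top x, Top y, Top z}" "c r = c (Top z)" using r xy z by auto
      fix v assume v: "v \<in> V - {Top y, r}"
      consider "c v = c (Top x)" | "c v = c (Top z)" | "c v \<noteq> c (Top x)" "c v \<noteq> c (Top z)" by blast
      then show "card (class_of c v - {Top y, r}) \<ge> 2"
      proof cases
        case 1
        then have "class_of c v - {Top y, r} = class_of c v - {Top y}" using r z by auto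
        then show ?thesis using 1 z diff[of "{Top y}" "class_of c v"] by simp
      next
        case 2
        then have "class_of c v - {Top y, r} = class_of c v - {r}" using xy z by auto
        then show ?thesis using 2 z diff[of "{r}" "class_of c v"] by simp
      next
        case 3
        then have "class_of c v - {Top y, r} = class_of c v" using r xy by auto
        then show ?thesis using sizes[of v] v by simp
      qed
    qed
  qed
qed

lemma fusible_flip_step:
  assumes "k \<ge> 3" and IH: "\<And>c'. num_blocks c < num_blocks c' \<Longrightarrow> part_ker c' \<in> gen_sym"
    and sizes: "\<And>v. v \<in> V \<Longrightarrow> card (class_of c v) \<ge> 2" and "fusible (c \<circ> flip)"
  shows "part_ker c \<in> gen_sym"
proof (rule part_ker_flip, rule fusible_step[OF assms(1) _ _ assms(4)])
  show "num_blocks (c \<circ> flip) < num_blocks c' \<Longrightarrow> part_ker c' \<in> gen_sym" for c' using IH by (simp add: num_blocks_flip)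
  fix v assume "v \<in> V"
  then show "card (class_of (c \<circ> flip) v) \<ge> 2"
    using sizes[of "flip v"] card_class_of_flip[of c "c (flip v)"] by simp
qed

text \<open>Two blocks of size three, one in each row, become three edges after splitting, which makes one block
more. This is the place where $h_1$ is used.\<close>

lemma triple_cup_cap_step:
  assumes "k \<ge> 3" and IH: "\<And>c'. num_blocks c < num_blocks c' \<Longrightarrow> part_ker c' \<in> gen_sym"
    and top: "card {s \<in> {1..k}. c (Top s) = \<alpha>} = 3" "card {s \<in> {1..k}. c (Bot s) = \<alpha>} = 0"
    and bot: "card {s \<in> {1..k}. c (Bot s) = \<beta>} = 3" "card {s \<in> {1..k}. c (Top s) = \<beta>} = 0"
  shows "part_ker c \<in> gen_sym"
proof -
  define X where "X = {s \<in> {1..k}. c (Top s) = \<alpha>}"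
  define Y where "Y = {s \<in> {1..k}. c (Bot s) = \<beta>}"
  have no_bot: "c (Bot t) \<noteq> \<alpha>" if "t \<in> {1..k}" for t using top(2) that by auto
  have no_top: "c (Top t) \<noteq> \<beta>" if "t \<in> {1..k}" for t using bot(2) that by auto
  have "finite X" "finite Y" by (auto simp: X_def Y_def)
  then obtain \<psi> where \<psi>: "bij_betw \<psi> Y X"
    using finite_same_card_bij[of Y X] top bot by (auto simp: X_def Y_def)
  obtain N where N: "\<And>v. v \<in> V \<Longrightarrow> c v < N" using obtain_bound[of c] by blast
  have "X \<noteq> {}" using top(1) unfolding X_def by (metis card.empty zero_neq_numeral)
  then have XY: "X \<subseteq> {1..k}" "X \<noteq> {}" "Y \<subseteq> {1..k}" by (auto simp: X_def Y_def)
  note ctx = XY class_eq_pure_top[of c \<alpha>, OF no_bot, folded X_def]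
    class_eq_pure_bot[of c \<beta>, OF no_top, folded Y_def] \<psi> N
  have X3: "card X = 3" using top by (simp add: X_def)
  show ?thesis
    by (rule split_step[OF ctx assms(1)]) (use X3 num_blocks_split[OF ctx] in \<open>auto intro: IH\<close>)
qed

text \<open>Downward induction on the number of blocks. A singleton block gives the zero operator. A block with
at least four elements has two of them in one row, so it can be fused from smaller blocks there. If
all blocks have two or three elements, those of size three occur in pairs because there are $2k$
vertices. Two blocks of size three can be fused in the top or in the bottom row, unless they lie
inside opposite rows, which is the case for $h_1$. What remains are diagrams
all of whose blocks are pairs.\<close>

lemma part_ker_generated:
  assumes k: "k \<ge> 3" shows "part_ker c \<in> gen_sym"
proof (induction "2 * k - num_blocks c" arbitrary: c rule: less_induct)
  case less
  have IH: "part_ker c' \<in> gen_sym" if "num_blocks c < num_blocks c'" for c'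
    using less[of c'] that num_blocks_le[of c'] by simp
  let ?T = "\<lambda>a. {s \<in> {1..k}. c (Top s) = a}" and ?B = "\<lambda>a. {s \<in> {1..k}. c (Bot s) = a}"
  have card_class_of: "card (class_of c v) = card (?T (c v)) + card (?B (c v))" for v
    by (rule card_class_split)
  have two_tops: "\<exists>x\<in>{1..k}. \<exists>y\<in>{1..k}. x \<noteq> y \<and> c (Top x) = a \<and> c (Top y) = a" if "card (?T a) \<ge> 2" for a
    using two_elements[OF that] by blast
  have two_bots: "\<exists>x\<in>{1..k}. \<exists>y\<in>{1..k}. x \<noteq> y \<and> c (Bot x) = a \<and> c (Bot y) = a" if "card (?B a) \<ge> 2" for a
    using two_elements[OF that] by blast
  have ex_top: "\<exists>x\<in>{1..k}. c (Top x) = a" if "card (?T a) \<ge> 1" for a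
    using that by (metis (mono_tags, lifting) Collect_empty_eq card.empty not_one_le_zero)
  have ex_bot: "\<exists>x\<in>{1..k}. c (Bot x) = a" if "card (?B a) \<ge> 1" for a
    using that by (metis (mono_tags, lifting) Collect_empty_eq card.empty not_one_le_zero)
  show ?case
  proof (cases "\<exists>v\<in>V. \<forall>u\<in>V. u \<noteq> v \<longrightarrow> c u \<noteq> c v")
    case True then show ?thesis using singleton_block_generated by blast
  next
    case False
    have sizes: "card (class_of c v) \<ge> 2" if v: "v \<in> V" for v
    proof -
      obtain u where u: "u \<in> V" "u \<noteq> v" "c u = c v" using False v by blast
      have "card {u, v} \<le> card (class_of c v)" by (rule card_mono) (use u v in auto)
      then show ?thesis using u by simp
    qed
    consider v where "v \<in> V" "card (class_of c v) \<ge> 4"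
      | "\<forall>v\<in>V. card (class_of c v) = 2"
      | v where "v \<in> V" "card (class_of c v) = 3" "\<forall>v\<in>V. card (class_of c v) = 2 \<or> card (class_of c v) = 3"
    proof -
      have "card (class_of c v) \<ge> 4 \<or> card (class_of c v) = 2 \<or> card (class_of c v) = 3" if "v \<in> V" for v
        using sizes[OF that] by linarith
      then show thesis using that by blast
    qed
    then show ?thesis
    proof cases
      case 1
      have "card (?T (c v)) \<ge> 2 \<or> card (?B (c v)) \<ge> 2" using 1 card_class_of[of v] by linarith
      then show ?thesis
      proof
        assume "card (?T (c v)) \<ge> 2"
        then obtain x y where "x \<in> {1..k}" "y \<in> {1..k}" "x \<noteq> y" "c (Top x) = c v" "c (Top y) = c v"
          using two_tops by blast
        then have "fusible c" by (rule fusibleI) (use 1 in simp)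
        then show ?thesis using fusible_step[OF k IH sizes] by blast
      next
        assume "card (?B (c v)) \<ge> 2"
        then obtain x y where xy: "x \<in> {1..k}" "y \<in> {1..k}" "x \<noteq> y" "c (Bot x) = c v" "c (Bot y) = c v"
          using two_bots by blast
        have "fusible (c \<circ> flip)"
          by (rule fusibleI[OF xy(1-3), of _ "c v"], unfold card_class_of_flip) (use 1 xy in simp_all)
        then show ?thesis using fusible_flip_step[OF k IH sizes] by blast
      qed
    next
      case 2 then show ?thesis using all_pairs_generated[OF k] by blast
    next
      case 3
      \<comment> \<open>The block sizes add up to an even number, so there is a second block of size three.\<close>
      have "\<exists>w\<in>V. c w \<noteq> c v \<and> card (class_of c w) = 3"
      proof (rule ccontr)
        assume "\<not> ?thesis"
        then have other: "card (class_of c w) = 2" if "w \<in> V" "c w \<noteq> c v" for w using that 3 by blast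
        have "2 * k = card (class_of c v) + (\<Sum>a\<in>c ` V - {c v}. card {u \<in> V. c u = a})"
          unfolding sum_class_sizes[of c, symmetric] by (rule sum.remove) (use 3 in auto)
        also have "(\<Sum>a\<in>c ` V - {c v}. card {u \<in> V. c u = a}) = (\<Sum>a\<in>c ` V - {c v}. 2)"
          by (rule sum.cong) (use other in auto)
        finally have "2 * k = 3 + 2 * card (c ` V - {c v})" using 3 by simp
        then show False by presburger
      qed
      then obtain w where w: "w \<in> V" "c w \<noteq> c v" "card (class_of c w) = 3" by blast
      have fuse_top: ?thesis if h: "u \<in> V" "u' \<in> V" "c u \<noteq> c u'" "card (class_of c u) = 3" "card (class_of c u') = 3"
        "card (?T (c u)) \<ge> 2" "card (?T (c u')) \<ge> 1" for u u'
      proof -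
        obtain x y z where xyz: "x \<in> {1..k}" "y \<in> {1..k}" "x \<noteq> y"
          "c (Top x) = c u" "c (Top y) = c u" "z \<in> {1..k}" "c (Top z) = c u'"
          using two_tops[OF h(6)] ex_top[OF h(7)] by blast
        have "fusible c"
          by (rule fusibleI[OF xyz(1-5)], rule disjI2, rule bexI[OF _ xyz(6)]) (use xyz(7) h in simp)
        then show ?thesis using fusible_step[OF k IH sizes] by blast
      qed
      have fuse_bot: ?thesis if h: "u \<in> V" "u' \<in> V" "c u \<noteq> c u'" "card (class_of c u) = 3" "card (class_of c u') = 3"
        "card (?B (c u)) \<ge> 2" "card (?B (c u')) \<ge> 1" for u u'
      proof -
        obtain x y z where xyz: "x \<in> {1..k}" "y \<in> {1..k}" "x \<noteq> y"
          "c (Bot x) = c u" "c (Bot y) = c u" "z \<in> {1..k}" "c (Bot z) = c u'"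
          using two_bots[OF h(6)] ex_bot[OF h(7)] by blast
        have "fusible (c \<circ> flip)"
        proof (rule fusibleI[OF xyz(1-3), of _ "c u"], unfold card_class_of_flip, goal_cases)
          case 3
          show ?case
            by (rule disjI2, rule bexI[OF _ xyz(6)]) (use xyz(7) h in simp)
        qed (use xyz in simp_all)
        then show ?thesis using fusible_flip_step[OF k IH sizes] by blast
      qed
      have tv: "card (?T (c v)) + card (?B (c v)) = 3" and tw: "card (?T (c w)) + card (?B (c w)) = 3"
        using card_class_of[of v] card_class_of[of w] 3 w by auto
      note vw = 3(1) w(1) w(2)[symmetric] 3(2) w(3) and wv = w(1) 3(1) w(2) w(3) 3(2)
      consider "card (?T (c v)) \<ge> 2" "card (?T (c w)) \<ge> 1"
        | "card (?T (c w)) \<ge> 2" "card (?T (c v)) \<ge> 1"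
        | "card (?B (c v)) \<ge> 2" "card (?B (c w)) \<ge> 1"
        | "card (?B (c w)) \<ge> 2" "card (?B (c v)) \<ge> 1"
        | "card (?T (c v)) = 3" "card (?B (c v)) = 0" "card (?B (c w)) = 3" "card (?T (c w)) = 0"
        | "card (?T (c w)) = 3" "card (?B (c w)) = 0" "card (?B (c v)) = 3" "card (?T (c v)) = 0"
        using tv tw by linarith
      then show ?thesis
      proof cases
        case 1 then show ?thesis by (rule fuse_top[OF vw])
      next
        case 2 then show ?thesis by (rule fuse_top[OF wv])
      next
        case 3 then show ?thesis by (rule fuse_bot[OF vw])
      next
        case 4 then show ?thesis by (rule fuse_bot[OF wv])
      next
        case 5 show ?thesis
          by (rule triple_cup_cap_step[where c = c and \<alpha> = "c v" and \<beta> = "c w"]) (fact k 5 | erule IH)+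
      next
        case 6 show ?thesis
          by (rule triple_cup_cap_step[where c = c and \<alpha> = "c w" and \<beta> = "c v"]) (fact k 6 | erule IH)+
      qed
    qed
  qed
qed

section \<open>Equivariant operators\<close>

definition relabel :: "(nat \<Rightarrow> nat) \<Rightarrow> (nat \<Rightarrow> nat) \<Rightarrow> nat \<Rightarrow> nat" where
  "relabel \<sigma> i = restrict (\<sigma> \<circ> i) {1..k}"

lemma relabel_Idx: "\<sigma> permutes {1..n} \<Longrightarrow> i \<in> Idx \<Longrightarrow> relabel \<sigma> i \<in> Idx"
  using permutes_in_image[of \<sigma> "{1..n}"] unfolding relabel_def multi_indices_def
  by (auto simp: PiE_iff)

lemma relabel_relabel:
  assumes "\<sigma> permutes {1..n}" "i \<in> Idx"
  shows "relabel (inv \<sigma>) (relabel \<sigma> i) = i" "relabel \<sigma> (relabel (inv \<sigma>) i) = i"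
proof -
  note inv = permutes_inv[OF assms(1)] permutes_inverses[OF assms(1)]
  show "relabel (inv \<sigma>) (relabel \<sigma> i) = i"
    by (rule Idx_eqI) (use inv assms in \<open>simp_all only: relabel_Idx\<close>, simp_all add: relabel_def)
  show "relabel \<sigma> (relabel (inv \<sigma>) i) = i"
    by (rule Idx_eqI) (use inv assms in \<open>simp_all only: relabel_Idx\<close>, simp_all add: relabel_def)
qed

abbreviation perm_tensor :: "(nat \<Rightarrow> nat) \<Rightarrow> tensor \<Rightarrow> tensor" where
  "perm_tensor \<sigma> \<equiv> tensor_map n k (perm_rep n \<sigma>)"

lemma perm_tensor_apply:
  assumes \<sigma>: "\<sigma> permutes {1..n}"
  shows "perm_tensor \<sigma> x = (\<lambda>i. if i \<in> Idx then x (relabel (inv \<sigma>) i) else 0)"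
proof -
  have rep: "perm_rep n \<sigma> (vbasis a) b = (if b \<in> {1..n} then of_bool (b = \<sigma> a) else 0)"
    if a: "a \<in> {1..n}" for a b
  proof -
    have "perm_rep n \<sigma> (vbasis a) = vbasis (\<sigma> a)"
      unfolding perm_rep_def vbasis_def[of a]
      using linear_extension_basis[of "{1..n}" a "\<lambda>i. vbasis (\<sigma> i)"] a by simp
    moreover have "\<sigma> a \<in> {1..n}" using permutes_in_image[OF \<sigma>] a by blast
    ultimately show ?thesis by (auto simp: vbasis_def)
  qed
  have "(\<Sum>j\<in>Idx. (\<Prod>s=1..k. of_bool (i s = \<sigma> (j s))) * x j) = x (relabel (inv \<sigma>) i)"
    if i: "i \<in> Idx" for i
  proof -
    have m: "relabel (inv \<sigma>) i \<in> Idx" using i \<sigma> by (intro relabel_Idx permutes_inv)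
    have "(\<Prod>s=1..k. of_bool (i s = \<sigma> (j s))) * x j = (if j = relabel (inv \<sigma>) i then x j else 0)"
      if j: "j \<in> Idx" for j
    proof (cases "j = relabel (inv \<sigma>) i")
      case True
      then show ?thesis using permutes_inverses[OF \<sigma>] by (simp add: relabel_def)
    next
      case False
      then obtain s where s: "s \<in> {1..k}" "j s \<noteq> relabel (inv \<sigma>) i s"
        using Idx_eqI[OF j m] by blast
      then have "i s \<noteq> \<sigma> (j s)" using permutes_inverses[OF \<sigma>] by (auto simp: relabel_def)
      then have "(\<Prod>s=1..k. of_bool (i s = \<sigma> (j s))) = (0::complex)" using s by (auto intro!: prod_zero)
      then show ?thesis using False by simp
    qed
    then have "(\<Sum>j\<in>Idx. (\<Prod>s=1..k. of_bool (i s = \<sigma> (j s))) * x j)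
        = (\<Sum>j\<in>Idx. if j = relabel (inv \<sigma>) i then x j else 0)" by (intro sum.cong) auto
    then show ?thesis using m by (simp only: sum.delta finite_Idx if_True)
  qed
  then show ?thesis
    using tensor_map_eqI[of "perm_rep n \<sigma>" "\<lambda>b a. of_bool (b = \<sigma> a)" x, OF rep] by auto
qed

definition invariant :: "kernel \<Rightarrow> bool" where
  "invariant \<kappa> \<longleftrightarrow> (\<forall>\<sigma> i j. \<sigma> permutes {1..n} \<longrightarrow> i \<in> Idx \<longrightarrow> j \<in> Idx \<longrightarrow>
     \<kappa> (label (relabel \<sigma> i) (relabel \<sigma> j)) = \<kappa> (label i j))"

lemma invariant_shift:
  assumes "invariant \<kappa>" "\<sigma> permutes {1..n}" "i \<in> Idx" "j \<in> Idx"
  shows "\<kappa> (label i (relabel \<sigma> j)) = \<kappa> (label (relabel (inv \<sigma>) i) j)"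
  using assms relabel_relabel[of \<sigma>] relabel_Idx[OF permutes_inv[OF assms(2)] assms(3)]
  unfolding invariant_def by metis

text \<open>Reindex the sum by \<open>relabel \<sigma>\<close>.\<close>

lemma act_perm_tensor:
  assumes "invariant \<kappa>" and \<sigma>: "\<sigma> permutes {1..n}"
  shows "act \<kappa> (perm_tensor \<sigma> x) = perm_tensor \<sigma> (act \<kappa> x)"
proof
  fix i
  show "act \<kappa> (perm_tensor \<sigma> x) i = perm_tensor \<sigma> (act \<kappa> x) i"
  proof (cases "i \<in> Idx")
    case True
    have "act \<kappa> (perm_tensor \<sigma> x) i = (\<Sum>j\<in>Idx. \<kappa> (label i j) * x (relabel (inv \<sigma>) j))"
      using True by (simp add: act_def perm_tensor_apply[OF \<sigma>])
    also have "\<dots> = (\<Sum>p\<in>Idx. \<kappa> (label (relabel (inv \<sigma>) i) p) * x p)"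
      by (rule sum.reindex_bij_witness[where i = "relabel \<sigma>" and j = "relabel (inv \<sigma>)"])
        (use assms True invariant_shift[OF assms True] permutes_inv[OF \<sigma>] in
          \<open>auto simp: relabel_relabel relabel_Idx simp flip: invariant_shift\<close>)
    also have "\<dots> = perm_tensor \<sigma> (act \<kappa> x) i"
      using True relabel_Idx[OF permutes_inv[OF \<sigma>] True] by (simp add: perm_tensor_apply[OF \<sigma>] act_def)
    finally show ?thesis .
  qed (simp add: act_def perm_tensor_apply[OF \<sigma>])
qed

lemma label_relabel:
  "v \<in> V \<Longrightarrow> label (relabel \<sigma> i) (relabel \<sigma> j) v = \<sigma> (label i j v)"
  by (cases v) (auto simp: relabel_def)

lemma invariant_proj_ker: "invariant proj_ker"
  unfolding invariant_def
proof (intro allI impI)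
  fix \<sigma> i j assume \<sigma>: "\<sigma> permutes {1..n}" and ij: "i \<in> Idx" "j \<in> Idx"
  then show "proj_ker (label (relabel \<sigma> i) (relabel \<sigma> j)) = proj_ker (label i j)"
    unfolding proj_ker_label[OF ij] proj_ker_label[OF relabel_Idx[OF \<sigma> ij(1)] relabel_Idx[OF \<sigma> ij(2)]]
    by (intro prod.cong refl) (simp add: relabel_def inj_eq[OF permutes_inj[OF \<sigma>]])
qed

lemma invariant_diag_ker:
  assumes "d \<in> partition_diagrams k" shows "invariant (diag_ker d)"
  unfolding invariant_def
proof (intro allI impI)
  fix \<sigma> i j assume \<sigma>: "\<sigma> permutes {1..n}" and ij: "i \<in> Idx" "j \<in> Idx"
  have "b \<subseteq> V" if "b \<in> d" for b
    using assms that by (auto simp: partition_diagrams_def partition_on_def)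
  then have "(\<forall>s\<in>b. \<forall>t\<in>b. label (relabel \<sigma> i) (relabel \<sigma> j) s = label (relabel \<sigma> i) (relabel \<sigma> j) t)
      \<longleftrightarrow> (\<forall>s\<in>b. \<forall>t\<in>b. label i j s = label i j t)" if "b \<in> d" for b
    using that inj_eq[OF permutes_inj[OF \<sigma>]] by (intro ball_cong refl) (auto simp: label_relabel subset_iff)
  then show "diag_ker d (label (relabel \<sigma> i) (relabel \<sigma> j)) = diag_ker d (label i j)"
    unfolding diag_ker_def using ij relabel_Idx[OF \<sigma>] by (simp cong: ball_cong)
qed

lemma Wk_add: "x \<in> Wk \<Longrightarrow> y \<in> Wk \<Longrightarrow> x + y \<in> Wk"
  unfolding tensor_power_def by (rule fun_space.span_add)

lemma Wk_scale: "x \<in> Wk \<Longrightarrow> fscale c x \<in> Wk"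
  unfolding tensor_power_def by (rule fun_space.span_scale)

lemma perm_tensor_Wk: "\<sigma> permutes {1..n} \<Longrightarrow> x \<in> Wk \<Longrightarrow> perm_tensor \<sigma> x \<in> Wk"
  using act_perm_tensor[OF invariant_proj_ker, of \<sigma> x] act_proj_ker_Wk[of x] act_proj_ker_in_Wk[of "perm_tensor \<sigma> x"] by simp

lemma perm_tensor_add: "\<sigma> permutes {1..n} \<Longrightarrow> perm_tensor \<sigma> (x + y) = perm_tensor \<sigma> x + perm_tensor \<sigma> y"
  and perm_tensor_scale: "\<sigma> permutes {1..n} \<Longrightarrow> perm_tensor \<sigma> (fscale c x) = fscale c (perm_tensor \<sigma> x)"
  by (auto simp: perm_tensor_apply fscale_def fun_eq_iff)

lemma QP_iff: "f \<in> QP k n \<longleftrightarrow> f \<in> Wk \<rightarrow>\<^sub>E Wk \<and>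
    (\<forall>x\<in>Wk. \<forall>y\<in>Wk. f (x + y) = f x + f y) \<and> (\<forall>c. \<forall>x\<in>Wk. f (fscale c x) = fscale c (f x)) \<and>
    (\<forall>\<sigma>. \<sigma> permutes {1..n} \<longrightarrow> (\<forall>x\<in>Wk. f (perm_tensor \<sigma> x) = perm_tensor \<sigma> (f x)))"
  unfolding QP_def endomorphisms_def by blast

lemma kop_invariant_QP:
  assumes "invariant \<kappa>" shows "kop \<kappa> \<in> QP k n"
  unfolding QP_iff
proof (intro conjI ballI allI impI)
  show "kop \<kappa> \<in> Wk \<rightarrow>\<^sub>E Wk" by (rule kop_in_Wk)
qed (simp_all add: kop_def Wk_add Wk_scale perm_tensor_Wk act_perm_tensor[OF assms] act_perm_tensor[OF invariant_proj_ker]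
      act_add_right act_scale_right del: plus_fun_apply)

lemma generated_subset_QP:
  assumes "k \<ge> 3" "f \<in> gen_alg" shows "f \<in> QP k n"
  using assms(2)
proof (induction rule: generated_algebra.induct)
  case (gen f)
  then obtain d where "d \<in> generator_diagrams k" "f = kop (diag_ker d)" by (auto simp: bar_eq_kop)
  then show ?case using generator_diagrams_subset[OF assms(1)] by (auto intro: kop_invariant_QP invariant_diag_ker)
next
  case one
  show ?case unfolding QP_iff by (auto simp: Wk_add Wk_scale perm_tensor_Wk simp del: plus_fun_apply)
next
  case (add f g)
  have fW: "f x \<in> Wk" "g x \<in> Wk" if "x \<in> Wk" for x using add that unfolding QP_iff by blast+
  show ?case unfolding QP_iff
  proof (intro conjI ballI allI impI)
    show "restrict (\<lambda>x. f x + g x) Wk \<in> Wk \<rightarrow>\<^sub>E Wk" using fW by (auto intro: Wk_add)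
  next
    fix x y assume "x \<in> Wk" "y \<in> Wk"
    moreover from this have "f (x + y) = f x + f y" "g (x + y) = g x + g y" using add unfolding QP_iff by blast+
    ultimately show "restrict (\<lambda>x. f x + g x) Wk (x + y) = restrict (\<lambda>x. f x + g x) Wk x + restrict (\<lambda>x. f x + g x) Wk y"
      by (simp only: restrict_apply' Wk_add ac_simps)
  next
    fix c x assume "x \<in> Wk"
    moreover from this have "f (fscale c x) = fscale c (f x)" "g (fscale c x) = fscale c (g x)"
      using add unfolding QP_iff by blast+
    ultimately show "restrict (\<lambda>x. f x + g x) Wk (fscale c x) = fscale c (restrict (\<lambda>x. f x + g x) Wk x)"
      by (simp only: restrict_apply' Wk_scale fun_space.scale_right_distrib)
  next
    fix \<sigma> x assume "\<sigma> permutes {1..n}" "x \<in> Wk"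
    moreover from this have "f (perm_tensor \<sigma> x) = perm_tensor \<sigma> (f x)" "g (perm_tensor \<sigma> x) = perm_tensor \<sigma> (g x)"
      using add unfolding QP_iff by blast+
    ultimately show "restrict (\<lambda>x. f x + g x) Wk (perm_tensor \<sigma> x) = perm_tensor \<sigma> (restrict (\<lambda>x. f x + g x) Wk x)"
      by (simp only: restrict_apply' perm_tensor_Wk perm_tensor_add)
  qed
next
  case (scale f a)
  have fW: "f x \<in> Wk" if "x \<in> Wk" for x using scale that unfolding QP_iff by blast
  show ?case unfolding QP_iff
  proof (intro conjI ballI allI impI)
    show "restrict (\<lambda>x. fscale a (f x)) Wk \<in> Wk \<rightarrow>\<^sub>E Wk" using fW by (auto intro: Wk_scale)
  next
    fix x y assume "x \<in> Wk" "y \<in> Wk"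
    moreover from this have "f (x + y) = f x + f y" using scale unfolding QP_iff by blast+
    ultimately show "restrict (\<lambda>x. fscale a (f x)) Wk (x + y) = restrict (\<lambda>x. fscale a (f x)) Wk x + restrict (\<lambda>x. fscale a (f x)) Wk y"
      by (simp only: restrict_apply' Wk_add fun_space.scale_right_distrib)
  next
    fix c x assume "x \<in> Wk"
    moreover from this have "f (fscale c x) = fscale c (f x)"
      using scale unfolding QP_iff by blast+
    ultimately show "restrict (\<lambda>x. fscale a (f x)) Wk (fscale c x) = fscale c (restrict (\<lambda>x. fscale a (f x)) Wk x)"
      by (simp only: restrict_apply' Wk_scale fun_space.scale_scale mult.commute)
  next
    fix \<sigma> x assume "\<sigma> permutes {1..n}" "x \<in> Wk"
    moreover from this have "f (perm_tensor \<sigma> x) = perm_tensor \<sigma> (f x)"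
      using scale unfolding QP_iff by blast+
    ultimately show "restrict (\<lambda>x. fscale a (f x)) Wk (perm_tensor \<sigma> x) = perm_tensor \<sigma> (restrict (\<lambda>x. fscale a (f x)) Wk x)"
      by (simp only: restrict_apply' perm_tensor_Wk perm_tensor_scale)
  qed
next
  case (comp f g)
  have fW: "f x \<in> Wk" "g x \<in> Wk" if "x \<in> Wk" for x using comp that unfolding QP_iff by blast+
  show ?case unfolding QP_iff
  proof (intro conjI ballI allI impI)
    show "compose Wk f g \<in> Wk \<rightarrow>\<^sub>E Wk" using fW by (auto simp: compose_def)
  qed (use comp fW in \<open>simp_all add: QP_iff compose_def Wk_add Wk_scale perm_tensor_Wk del: plus_fun_apply\<close>)
qed

lemma QP_sum:
  assumes f: "f \<in> QP k n" and w: "\<And>j. j \<in> A \<Longrightarrow> w j \<in> Wk" and "finite A"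
  shows "(\<Sum>j\<in>A. fscale (c j) (w j)) \<in> Wk \<and>
    f (\<Sum>j\<in>A. fscale (c j) (w j)) = (\<Sum>j\<in>A. fscale (c j) (f (w j)))"
  using assms(3) w
proof (induction A rule: finite_induct)
  case empty
  have 0: "(0 :: tensor) \<in> Wk" unfolding tensor_power_def by (rule fun_space.span_zero)
  have "f (fscale 0 0) = fscale 0 (f 0)" using f 0 unfolding QP_iff by blast
  then have "f 0 = 0" by (simp only: fun_space.scale_zero_left)
  then show ?case using 0 by (simp only: sum.empty simp_thms)
next
  case (insert a A)
  let ?S = "\<Sum>j\<in>A. fscale (c j) (w j)"
  have IH: "?S \<in> Wk" "f ?S = (\<Sum>j\<in>A. fscale (c j) (f (w j)))" using insert by auto
  have a: "w a \<in> Wk" "fscale (c a) (w a) \<in> Wk" using insert Wk_scale by auto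
  have "f (fscale (c a) (w a) + ?S) = f (fscale (c a) (w a)) + f ?S"
    using f a IH unfolding QP_iff by blast
  moreover have "f (fscale (c a) (w a)) = fscale (c a) (f (w a))" using f a unfolding QP_iff by blast
  ultimately show ?case using IH a insert(1,2) Wk_add by (simp only: sum.insert[OF insert(1,2)] simp_thms)
qed

text \<open>Extend \<open>f\<close> by the projection to all of $V^{\otimes k}$. The matrix of the extension is invariant, and
compressing it gives \<open>f\<close> back since the projection fixes $W^{\otimes k}$.\<close>

lemma QP_kernel:
  assumes f: "f \<in> QP k n" obtains \<kappa> where "invariant \<kappa>" "f = kop \<kappa>"
proof -
  \<comment> \<open>\<open>p j\<close> is the image of the basis tensor with index \<open>j\<close> under the projection.\<close>
  define p where "p j = (\<lambda>i. if i \<in> Idx then proj_ker (label i j) else 0)" for j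
  have p_act: "p j = act proj_ker (\<lambda>i. if i = j then 1 else 0)" if "j \<in> Idx" for j
  proof
    fix i
    have "(\<Sum>m\<in>Idx. proj_ker (label i m) * (if m = j then 1 else 0))
        = (\<Sum>m\<in>Idx. if m = j then proj_ker (label i m) else 0)" by (intro sum.cong) auto
    also have "\<dots> = proj_ker (label i j)" using that by (simp only: sum.delta finite_Idx if_True)
    finally show "p j i = act proj_ker (\<lambda>i. if i = j then 1 else 0) i" by (simp only: p_def act_def)
  qed
  have pW: "p j \<in> Wk" if "j \<in> Idx" for j using p_act[OF that] act_proj_ker_in_Wk by simp
  have fW: "f x \<in> Wk" if "x \<in> Wk" for x using f that unfolding QP_iff by blast
  have off: "x i = 0" if "x \<in> Wk" "i \<notin> Idx" for x i
    using act_proj_ker_Wk[OF that(1)] that(2) by (metis act_def)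
  define \<kappa> where "\<kappa> l = f (p (bot_row l)) (top_row l)" for l
  have act_\<kappa>: "act \<kappa> x = f x" if x: "x \<in> Wk" for x
  proof -
    have x_eq: "x = (\<Sum>j\<in>Idx. fscale (x j) (p j))"
    proof
      fix i
      have "x i = act proj_ker x i" using act_proj_ker_Wk[OF x] by simp
      then show "x i = (\<Sum>j\<in>Idx. fscale (x j) (p j)) i"
        by (simp only: act_def p_def sum_fun_apply fscale_def mult.commute) (cases "i \<in> Idx"; simp)
    qed
    have "f (\<Sum>j\<in>Idx. fscale (x j) (p j)) = (\<Sum>j\<in>Idx. fscale (x j) (f (p j)))"
      using QP_sum[OF f, of Idx p x] pW finite_Idx by blast
    then have fx: "f x = (\<Sum>j\<in>Idx. fscale (x j) (f (p j)))" unfolding x_eq[symmetric] .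
    show ?thesis
    proof
      fix i
      show "act \<kappa> x i = f x i"
      proof (cases "i \<in> Idx")
        case True
        then have "act \<kappa> x i = (\<Sum>j\<in>Idx. fscale (x j) (f (p j))) i"
          by (simp add: act_def \<kappa>_def sum_fun_apply fscale_def mult.commute)
        then show ?thesis by (simp only: fx)
      qed (simp add: act_def off[OF fW[OF x]])
    qed
  qed
  have "kop \<kappa> = f"
  proof
    fix x show "kop \<kappa> x = f x"
    proof (cases "x \<in> Wk")
      case True then show ?thesis by (simp add: kop_def act_\<kappa> act_proj_ker_Wk fW)
    next
      case False
      then have "f x = undefined" using f unfolding QP_iff by (meson PiE_arb)
      then show ?thesis using False by (simp add: kop_def)
    qed
  qed
  moreover have "invariant \<kappa>"
    unfolding invariant_def
  proof (intro allI impI)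
    fix \<sigma> i j assume \<sigma>: "\<sigma> permutes {1..n}" and ij: "i \<in> Idx" "j \<in> Idx"
    have "p (relabel \<sigma> j) = perm_tensor \<sigma> (p j)"
      using invariant_shift[OF invariant_proj_ker \<sigma> _ ij(2)] relabel_Idx[OF permutes_inv[OF \<sigma>]]
      by (auto simp: perm_tensor_apply[OF \<sigma>] p_def)
    then have "f (p (relabel \<sigma> j)) = perm_tensor \<sigma> (f (p j))" using f \<sigma> pW[OF ij(2)] unfolding QP_iff by metis
    then show "\<kappa> (label (relabel \<sigma> i) (relabel \<sigma> j)) = \<kappa> (label i j)"
      using relabel_Idx[OF \<sigma> ij(1)] relabel_relabel(1)[OF \<sigma> ij(1)]
      by (simp add: \<kappa>_def perm_tensor_apply[OF \<sigma>])
  qed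
  ultimately show thesis using that by blast
qed

definition equality_type :: "(vertex \<Rightarrow> nat) \<Rightarrow> (vertex \<Rightarrow> nat) \<Rightarrow> bool" where
  "equality_type l0 l \<longleftrightarrow> (\<forall>u\<in>V. \<forall>v\<in>V. l u = l v \<longleftrightarrow> l0 u = l0 v)"

text \<open>Labelings of the same equality type are related by a bijection between the labels they use, and this
bijection extends to a permutation of all labels.\<close>

lemma invariant_equality_type:
  assumes "invariant \<kappa>" "l0 \<in> Lab" "l \<in> Lab" "equality_type l0 l"
  shows "\<kappa> l = \<kappa> l0"
proof -
  define f where "f a = l (inv_into V l0 a)" for a
  have f: "f (l0 v) = l v" if "v \<in> V" for v
  proof -
    have "inv_into V l0 (l0 v) \<in> V" "l0 (inv_into V l0 (l0 v)) = l0 v"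
      using that by (auto intro: inv_into_into f_inv_into_f)
    then show ?thesis using assms(4) that unfolding f_def equality_type_def by blast
  qed
  have sub: "l0 ` V \<subseteq> {1..n}" "f ` l0 ` V \<subseteq> {1..n}"
    using Lab_range[OF assms(2)] Lab_range[OF assms(3)] f by auto
  have "inj_on f (l0 ` V)"
    using f assms(4) unfolding equality_type_def inj_on_def by auto
  then obtain \<sigma> where \<sigma>: "\<sigma> permutes {1..n}" "\<And>a. a \<in> l0 ` V \<Longrightarrow> \<sigma> a = f a"
    using permutes_extend[OF finite_atLeastAtMost sub(1) _ sub(2)] by blast
  obtain i0 j0 where l0: "i0 \<in> Idx" "j0 \<in> Idx" "l0 = label i0 j0" using Lab_cases[OF assms(2)] .
  obtain i j where l: "i \<in> Idx" "j \<in> Idx" "l = label i j" using Lab_cases[OF assms(3)] .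
  have \<sigma>v: "\<sigma> (l0 v) = l v" if "v \<in> V" for v using \<sigma>(2)[of "l0 v"] f[OF that] that by simp
  have "i = relabel \<sigma> i0"
    by (rule Idx_eqI[OF l(1) relabel_Idx[OF \<sigma>(1) l0(1)]])
      (use \<sigma>v[of "Top _"] l l0 in \<open>simp add: relabel_def\<close>)
  moreover have "j = relabel \<sigma> j0"
    by (rule Idx_eqI[OF l(2) relabel_Idx[OF \<sigma>(1) l0(2)]])
      (use \<sigma>v[of "Bot _"] l l0 in \<open>simp add: relabel_def\<close>)
  ultimately show ?thesis using assms(1) \<sigma>(1) l0 l unfolding invariant_def by blast
qed

abbreviation part_span :: "kernel set" where "part_span \<equiv> fun_space.span (range part_ker)"

text \<open>The factor unites the blocks of \<open>u\<close> and \<open>v\<close>.\<close>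

lemma part_span_mult:
  assumes "u \<in> V" "v \<in> V" "x \<in> part_span"
  shows "(\<lambda>l. of_bool (l u = l v) * x l) \<in> part_span"
proof (rule span_linear_image[where \<Phi> = "\<lambda>x l. of_bool (l u = l v) * x l", OF _ _ _ _ assms(3)])
  fix b assume "b \<in> range part_ker"
  then obtain c where b: "b = part_ker c" by blast
  define c' where "c' = (\<lambda>w. if c w = c u then c v else c w)"
  have "of_bool (l u = l v) * part_ker c l = part_ker c' l" for l
  proof -
    have "l u = l v \<and> (\<forall>p\<in>V. \<forall>q\<in>V. c p = c q \<longrightarrow> l p = l q) \<longleftrightarrow>
        (\<forall>p\<in>V. \<forall>q\<in>V. c' p = c' q \<longrightarrow> l p = l q)" (is "?L \<longleftrightarrow> ?R")
    proof
      assume L: ?L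
      show ?R
      proof (intro ballI impI)
        fix p q assume pq: "p \<in> V" "q \<in> V" "c' p = c' q"
        have A: "l w = l u" if "w \<in> V" "c w = c u \<or> c w = c v" for w
          using L assms(1,2) that by metis
        show "l p = l q"
        proof (cases "c p = c q")
          case True then show ?thesis using L pq by blast
        next
          case False
          then have "(c p = c u \<or> c p = c v) \<and> (c q = c u \<or> c q = c v)"
            using pq(3) by (auto simp: c'_def split: if_splits)
          then show ?thesis using A[of p] A[of q] pq by simp
        qed
      qed
    next
      assume R: ?R
      have "c' u = c' v" by (simp add: c'_def)
      then have "l u = l v" using R assms by blast
      moreover have "c p = c q \<Longrightarrow> c' p = c' q" for p q by (simp add: c'_def)
      ultimately show ?L using R by blast
    qed
    then have "l \<in> Lab \<and> l u = l v \<and> (\<forall>p\<in>V. \<forall>q\<in>V. c p = c q \<longrightarrow> l p = l q) \<longleftrightarrow>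
        l \<in> Lab \<and> (\<forall>p\<in>V. \<forall>q\<in>V. c' p = c' q \<longrightarrow> l p = l q)" by (simp only:)
    then show ?thesis unfolding part_ker_def by (simp only: conj_ac flip: of_bool_conj)
  qed
  then have "(\<lambda>l. of_bool (l u = l v) * b l) = part_ker c'" using b by blast
  then show "(\<lambda>l. of_bool (l u = l v) * b l) \<in> part_span" by (simp add: fun_space.span_base)
qed (auto simp: algebra_simps fun_space.subspace_span)

text \<open>The indicator of an equality type is a product of factors $[l(u) = l(v)]$ and $1 - [l(u) = l(v)]$,
starting from the diagram without any constraint.\<close>

lemma equality_type_part_span: "(\<lambda>l. of_bool (l \<in> Lab \<and> equality_type l0 l)) \<in> part_span"
proof -
  have "(\<lambda>l. of_bool (l \<in> Lab \<and> (\<forall>(u, v)\<in>E. l u = l v \<longleftrightarrow> l0 u = l0 v))) \<in> part_span"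
    if "finite E" "E \<subseteq> V \<times> V" for E
    using that
  proof (induction E rule: finite_induct)
    case empty
    \<comment> \<open>All vertices get different colours, so no two labels are required to agree.\<close>
    define c where "c v = (case v of Top s \<Rightarrow> 2 * s | Bot s \<Rightarrow> 2 * s + 1)" for v
    have c: "u = v" if "c u = c v" for u v
      using that by (cases u; cases v) (simp_all add: c_def, presburger+)
    have "part_ker c = (\<lambda>l. of_bool (l \<in> Lab))"
      using c by (auto simp: part_ker_def fun_eq_iff)
    then have "(\<lambda>l. of_bool (l \<in> Lab)) \<in> part_span" by (metis fun_space.span_base rangeI)
    then show ?case by simp
  next
    case (insert e E)
    obtain u v where e: "e = (u, v)" by (cases e)
    let ?x = "\<lambda>l. of_bool (l \<in> Lab \<and> (\<forall>(u, v)\<in>E. l u = l v \<longleftrightarrow> l0 u = l0 v)) :: complex"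
    let ?y = "\<lambda>l. of_bool (l u = l v) * ?x l"
    have x: "?x \<in> part_span" using insert by auto
    have y: "?y \<in> part_span" using insert e x by (intro part_span_mult) auto
    have xy: "?x - ?y \<in> part_span" by (rule fun_space.span_diff[OF x y])
    have eq: "(\<lambda>l. of_bool (l \<in> Lab \<and> (\<forall>(u, v)\<in>insert e E. l u = l v \<longleftrightarrow> l0 u = l0 v)))
        = (if l0 u = l0 v then ?y else ?x - ?y)"
      by (auto simp: e fun_eq_iff)
    show ?case unfolding eq
      by (cases "l0 u = l0 v") (use y xy in \<open>simp_all only: if_True if_False simp_thms\<close>)
  qed
  from this[of "V \<times> V"] show ?thesis by (simp add: equality_type_def)
qed

text \<open>An invariant kernel is constant on equality types. Summing over all labelings counts each type as
often as it is realized, hence the weights \<open>w\<close>.\<close>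

lemma invariant_part_span:
  assumes \<kappa>: "invariant \<kappa>" obtains \<kappa>' where "\<kappa>' \<in> part_span" "\<And>l. l \<in> Lab \<Longrightarrow> \<kappa>' l = \<kappa> l"
proof -
  define S where "S = (\<lambda>(i, j). label i j) ` (Idx \<times> Idx)"
  have S: "finite S" "S = Lab"
  proof -
    show "finite S" unfolding S_def by (intro finite_imageI finite_cartesian_product) auto
    show "S = Lab" by (auto simp: S_def elim!: Lab_cases)
  qed
  define w where "w l0 = card {l \<in> Lab. equality_type l0 l}" for l0
  define \<kappa>' where "\<kappa>' = (\<Sum>l0\<in>Lab. fscale (\<kappa> l0 / of_nat (w l0)) (\<lambda>l. of_bool (l \<in> Lab \<and> equality_type l0 l)))"
  have "\<kappa>' \<in> part_span" unfolding \<kappa>'_def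
    by (intro fun_space.span_sum fun_space.span_scale equality_type_part_span)
  moreover have "\<kappa>' l = \<kappa> l" if l: "l \<in> Lab" for l
  proof -
    have sym: "equality_type l0 l \<longleftrightarrow> equality_type l l0" for l0 by (auto simp: equality_type_def)
    have w: "w l0 = w l" if "equality_type l l0" for l0
    proof -
      have "equality_type l0 l1 \<longleftrightarrow> equality_type l l1" for l1
        using that unfolding equality_type_def by blast
      then show ?thesis by (simp add: w_def)
    qed
    have fin: "finite {l0 \<in> Lab. equality_type l l0}" using S by auto
    have "l \<in> {l0 \<in> Lab. equality_type l l0}" using l by (simp add: equality_type_def)
    then have pos: "w l \<noteq> 0" using fin unfolding w_def by (metis card_0_eq empty_iff)
    have "\<kappa>' l = (\<Sum>l0\<in>Lab. if equality_type l l0 then \<kappa> l / of_nat (w l) else 0)"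
      unfolding \<kappa>'_def sum_fun_apply fscale_def
    proof (intro sum.cong refl)
      fix l0 assume l0: "l0 \<in> Lab"
      show "\<kappa> l0 / of_nat (w l0) * of_bool (l \<in> Lab \<and> equality_type l0 l)
          = (if equality_type l l0 then \<kappa> l / of_nat (w l) else 0)"
        using invariant_equality_type[OF \<kappa> l l0] w[of l0] l sym[of l0] by simp
    qed
    also have "\<dots> = (\<Sum>l0\<in>{l0 \<in> Lab. equality_type l l0}. \<kappa> l / of_nat (w l))"
      using S by (intro sum.inter_filter[symmetric]) simp
    also have "\<dots> = \<kappa> l" using pos by (simp add: w_def)
    finally show ?thesis .
  qed
  ultimately show thesis using that by blast
qed

end

theorem corollary3p3:
  fixes k n :: nat
  assumes "k \<ge> 3" and "n \<ge> 2 * k"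
  shows "generated_algebra (tensor_power k (permW n)) (bar n k ` generator_diagrams k) = QP k n"
proof -
  interpret tensor_setting n k by standard (use assms in simp)
  show ?thesis
  proof (intro equalityI subsetI)
    fix f assume "f \<in> gen_alg"
    then show "f \<in> QP k n" by (rule generated_subset_QP[OF assms(1)])
  next
    fix f assume "f \<in> QP k n"
    then obtain \<kappa> where \<kappa>: "invariant \<kappa>" "f = kop \<kappa>" by (rule QP_kernel)
    obtain \<kappa>' where \<kappa>': "\<kappa>' \<in> part_span" "\<And>l. l \<in> Lab \<Longrightarrow> \<kappa>' l = \<kappa> l" using invariant_part_span[OF \<kappa>(1)] by blast
    have "part_span \<subseteq> gen_sym"
      by (rule fun_space.span_minimal[OF _ gen_sym_subspace]) (use part_ker_generated[OF assms(1)] in auto)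
    then have "kop \<kappa>' \<in> gen_alg" using \<kappa>'(1) by (auto simp: gen_sym_def gen_kernels_def)
    then show "f \<in> gen_alg" using \<kappa>(2) kop_cong[of \<kappa>' \<kappa>] \<kappa>'(2) by simp
  qed
qed

end
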